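(* There is a nil ring $R$ such that the adjoint group $R^{\circ}$ is not an Engel group. Moreover, $R$ can be taken to be an algebra over an arbitrary field; that is, for every field $F$ there is a nil $F$-algebra $R$ such that $R^{\circ}$ is not an Engel group.
   Context: Rings and algebras are associative and are not assumed to have an identity element. A ring is nil if each of its elements is nilpotent. For a nil ring (more generally, a Jacobson radical ring) $R$, the adjoint group $R^{\circ}$ is the set $R$ with the group operation $a\circ b=ab+a+b$. For group elements put $[x,y]=xyx^{-1}y^{-1}$, $[x,{}_1y]=[x,y]$ and $[x,{}_{n+1}y]=[[x,{}_ny],y]$. A group $G$ is an Engel group if for all $x,y\in G$ there is $n\ge 1$ (depending on $x,y$) such that $[x,{}_ny]=1$. *)

theory Defs
  imports "HOL-Algebra.Module"
begin

text \<open>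
  Rings need not have an identity element. They are modelled on the library's ring records,
  whose field \<open>one\<close> is left unconstrained and is never used below; hence the axioms are those of
  \<open>ring\<close> in HOL-Algebra without the unit laws, and the library power \<open>[^]\<close> (which starts at
  \<open>one\<close>) is not available.
\<close>

locale nonunital_ring = abelian_group R for R (structure) +
  assumes rmult_closed [simp, intro]:
      "\<lbrakk>x \<in> carrier R; y \<in> carrier R\<rbrakk> \<Longrightarrow> x \<otimes> y \<in> carrier R"
    and rmult_assoc:
      "\<lbrakk>x \<in> carrier R; y \<in> carrier R; z \<in> carrier R\<rbrakk> \<Longrightarrow> (x \<otimes> y) \<otimes> z = x \<otimes> (y \<otimes> z)"
    and rmult_l_distr:
      "\<lbrakk>x \<in> carrier R; y \<in> carrier R; z \<in> carrier R\<rbrakk> \<Longrightarrow> (x \<oplus> y) \<otimes> z = x \<otimes> z \<oplus> y \<otimes> z"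
    and rmult_r_distr:
      "\<lbrakk>x \<in> carrier R; y \<in> carrier R; z \<in> carrier R\<rbrakk> \<Longrightarrow> z \<otimes> (x \<oplus> y) = z \<otimes> x \<oplus> z \<otimes> y"

locale nonunital_algebra = module F R + nonunital_ring R
  for F (structure) and R (structure) +
  assumes smult_mult_left:
      "\<lbrakk>c \<in> carrier F; x \<in> carrier R; y \<in> carrier R\<rbrakk> \<Longrightarrow>
       c \<odot>\<^bsub>R\<^esub> (x \<otimes>\<^bsub>R\<^esub> y) = (c \<odot>\<^bsub>R\<^esub> x) \<otimes>\<^bsub>R\<^esub> y"
    and smult_mult_right:
      "\<lbrakk>c \<in> carrier F; x \<in> carrier R; y \<in> carrier R\<rbrakk> \<Longrightarrow>
       c \<odot>\<^bsub>R\<^esub> (x \<otimes>\<^bsub>R\<^esub> y) = x \<otimes>\<^bsub>R\<^esub> (c \<odot>\<^bsub>R\<^esub> y)"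

text \<open>Without an identity only positive powers exist, so the exponent is shifted:
  \<open>pow_Suc R a n\<close> is the power of \<open>a\<close> with exponent \<open>n + 1\<close>.\<close>

primrec pow_Suc :: "('b, 'm) ring_scheme \<Rightarrow> 'b \<Rightarrow> nat \<Rightarrow> 'b" where
  "pow_Suc R a 0 = a"
| "pow_Suc R a (Suc n) = pow_Suc R a n \<otimes>\<^bsub>R\<^esub> a"

definition nilpotent :: "('b, 'm) ring_scheme \<Rightarrow> 'b \<Rightarrow> bool" where
  "nilpotent R a \<longleftrightarrow> (\<exists>n. pow_Suc R a n = \<zero>\<^bsub>R\<^esub>)"

locale nil_ring = nonunital_ring R for R (structure) +
  assumes nil: "a \<in> carrier R \<Longrightarrow> nilpotent R a"

locale nil_algebra = nonunital_algebra F R + nil_ring R for F (structure) and R (structure)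

definition adjoint_group :: "('b, 'm) ring_scheme \<Rightarrow> 'b monoid" where
  "adjoint_group R =
     \<lparr>carrier = carrier R,
      monoid.mult = (\<lambda>a b. a \<otimes>\<^bsub>R\<^esub> b \<oplus>\<^bsub>R\<^esub> a \<oplus>\<^bsub>R\<^esub> b),
      one = \<zero>\<^bsub>R\<^esub>\<rparr>"

definition gcommutator :: "('g, 'm) monoid_scheme \<Rightarrow> 'g \<Rightarrow> 'g \<Rightarrow> 'g" where
  "gcommutator G x y = x \<otimes>\<^bsub>G\<^esub> y \<otimes>\<^bsub>G\<^esub> inv\<^bsub>G\<^esub> x \<otimes>\<^bsub>G\<^esub> inv\<^bsub>G\<^esub> y"

text \<open>Setting the zeroth iterate to \<open>x\<close> makes the first iterate the commutator of \<open>x\<close> and \<open>y\<close>.\<close>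

primrec iter_commutator :: "('g, 'm) monoid_scheme \<Rightarrow> 'g \<Rightarrow> nat \<Rightarrow> 'g \<Rightarrow> 'g" where
  "iter_commutator G x 0 y = x"
| "iter_commutator G x (Suc n) y = gcommutator G (iter_commutator G x n y) y"

text \<open>A condition on a group \<open>G\<close>. That \<open>G\<close> is a group is not part of the definition, so its
  negation always provides elements violating the Engel condition; the adjoint structures of nil
  rings are shown to be groups in the lemma \<open>group_adjoint_group\<close>.\<close>

definition engel_group :: "('g, 'm) monoid_scheme \<Rightarrow> bool" where
  "engel_group G \<longleftrightarrow>
     (\<forall>x \<in> carrier G. \<forall>y \<in> carrier G. \<exists>n\<ge>1. iter_commutator G x n y = \<one>\<^bsub>G\<^esub>)"

context nonunital_ring
begin

lemma rmult_zero_left [simp]: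
  assumes "x \<in> carrier R" shows "\<zero> \<otimes> x = \<zero>"
proof -
  have "\<zero> \<otimes> x \<oplus> \<zero> \<otimes> x = \<zero> \<otimes> x \<oplus> \<zero>"
    using assms rmult_l_distr[of \<zero> \<zero> x] by simp
  then show ?thesis using assms by (metis add.l_cancel_one rmult_closed zero_closed r_zero)
qed

lemma rmult_minus_left:
  assumes "x \<in> carrier R" "y \<in> carrier R" shows "(\<ominus> x) \<otimes> y = \<ominus> (x \<otimes> y)"
proof -
  have "(\<ominus> x) \<otimes> y \<oplus> x \<otimes> y = \<zero>"
    using assms rmult_l_distr[of "\<ominus> x" x y] by (simp add: l_neg)
  then show ?thesis using assms by (metis a_inv_closed minus_equality rmult_closed)
qed

lemma pow_Suc_closed [simp, intro]: "a \<in> carrier R \<Longrightarrow> pow_Suc R a n \<in> carrier R"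
  by (induction n) auto

lemma adjoint_step:
  assumes a: "a \<in> carrier R" and b: "b \<in> carrier R"
    and q: "b \<otimes> a \<oplus> b \<oplus> a = q"
  shows "(b \<oplus> \<ominus> q) \<otimes> a \<oplus> (b \<oplus> \<ominus> q) \<oplus> a = \<ominus> (q \<otimes> a)"
proof -
  have q_in: "q \<in> carrier R" using a b q by auto
  have "(b \<oplus> \<ominus> q) \<otimes> a \<oplus> (b \<oplus> \<ominus> q) \<oplus> a
      = (b \<otimes> a \<oplus> \<ominus> (q \<otimes> a)) \<oplus> (b \<oplus> \<ominus> q) \<oplus> a"
    using a b q_in by (simp add: rmult_l_distr rmult_minus_left)
  also have "\<dots> = (b \<otimes> a \<oplus> b \<oplus> a) \<oplus> \<ominus> q \<oplus> \<ominus> (q \<otimes> a)"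
    using a b q_in by (simp add: a_ac)
  also have "\<dots> = \<ominus> (q \<otimes> a)"
    unfolding q using a b q_in by (simp add: r_neg)
  finally show ?thesis .
qed

lemma adjoint_approx_inverse:
  assumes a: "a \<in> carrier R"
  shows "\<exists>b \<in> carrier R. b \<otimes> a \<oplus> b \<oplus> a = pow_Suc R a n
                        \<or> b \<otimes> a \<oplus> b \<oplus> a = \<ominus> pow_Suc R a n"
proof (induction n)
  case 0
  show ?case using a by (intro bexI[of _ \<zero>]) auto
next
  case (Suc n)
  then obtain b where b: "b \<in> carrier R"
    and cs: "b \<otimes> a \<oplus> b \<oplus> a = pow_Suc R a n \<or> b \<otimes> a \<oplus> b \<oplus> a = \<ominus> pow_Suc R a n"
    by blast
  let ?q = "b \<otimes> a \<oplus> b \<oplus> a"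
  have "(b \<oplus> \<ominus> ?q) \<otimes> a \<oplus> (b \<oplus> \<ominus> ?q) \<oplus> a = \<ominus> (?q \<otimes> a)"
    using adjoint_step[OF a b refl] .
  moreover have "?q \<otimes> a = pow_Suc R a (Suc n) \<or> ?q \<otimes> a = \<ominus> pow_Suc R a (Suc n)"
    using cs a by (auto simp: rmult_minus_left)
  ultimately have "(b \<oplus> \<ominus> ?q) \<otimes> a \<oplus> (b \<oplus> \<ominus> ?q) \<oplus> a = pow_Suc R a (Suc n) \<or>
      (b \<oplus> \<ominus> ?q) \<otimes> a \<oplus> (b \<oplus> \<ominus> ?q) \<oplus> a = \<ominus> pow_Suc R a (Suc n)"
    using minus_minus[OF pow_Suc_closed[OF a, of "Suc n"]] by metis
  moreover have "b \<oplus> \<ominus> ?q \<in> carrier R" using a b by auto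
  ultimately show ?case by blast
qed

end

lemma (in nil_ring) group_adjoint_group: "group (adjoint_group R)"
proof (rule groupI)
  fix x assume "x \<in> carrier (adjoint_group R)"
  then have x: "x \<in> carrier R" by (simp add: adjoint_group_def)
  obtain n where n: "pow_Suc R x n = \<zero>" using nil[OF x] by (auto simp: nilpotent_def)
  obtain b where "b \<in> carrier R" "b \<otimes> x \<oplus> b \<oplus> x = \<zero>"
    using adjoint_approx_inverse[OF x, of n] unfolding n by auto
  then show "\<exists>y \<in> carrier (adjoint_group R).
      y \<otimes>\<^bsub>adjoint_group R\<^esub> x = \<one>\<^bsub>adjoint_group R\<^esub>"
    by (auto simp: adjoint_group_def)
next
  fix x y z
  assume "x \<in> carrier (adjoint_group R)" "y \<in> carrier (adjoint_group R)"
    "z \<in> carrier (adjoint_group R)"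
  then show "x \<otimes>\<^bsub>adjoint_group R\<^esub> y \<otimes>\<^bsub>adjoint_group R\<^esub> z =
      x \<otimes>\<^bsub>adjoint_group R\<^esub> (y \<otimes>\<^bsub>adjoint_group R\<^esub> z)"
    by (simp add: adjoint_group_def rmult_l_distr rmult_r_distr rmult_assoc a_ac)
qed (simp_all add: adjoint_group_def)

end

theory Submission
  imports Defs "HOL-Library.Multiset" "HOL-Library.Nat_Bijection" "HOL-Algebra.QuotRing"
begin

text \<open>
  The algebra is a quotient of the augmentation ideal of the free algebra in letters \<open>a\<close> (the
  number \<open>0\<close>) and \<open>b\<close> (the number \<open>1\<close>), and the group elements are \<open>x = 1 + a\<close> and \<open>y = 1 + b\<close>.

  Why the commutators survive. Suppose that \<open>a\<close> has square zero and \<open>b\<close> has cube zero. Then the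
  iterated commutator of \<open>x\<close> with \<open>n \<ge> 1\<close> copies of \<open>y\<close> is \<open>D\<^sub>n y\<^sup>-\<^sup>1\<close>, where \<open>D\<^sub>0 = x\<close> and
  \<open>D\<^sub>n\<^sub>+\<^sub>1 = D\<^sub>n y D\<^sub>n\<^sup>-\<^sup>1\<close> (\<open>unit_of_iter_commutator\<close>). Since \<open>x\<^sup>-\<^sup>1 = 1 - a\<close> and
  \<open>y\<^sup>-\<^sup>1 = 1 - b + b\<^sup>2\<close>, this recursion can be run in the free algebra, where the lift of \<open>D\<^sub>n\<close>
  has exactly one word of greatest degree both in \<open>a\<close> and in \<open>b\<close>
  (\<open>leading_word_pair\<close>): it takes \<open>a\<close> from each of the \<open>2 ^ n\<close> factors \<open>1 + a\<close> or \<open>1 - a\<close>, \<open>b\<close> from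
  each connecting \<open>y\<close> and \<open>b\<^sup>2\<close> from each connecting \<open>y\<^sup>-\<^sup>1\<close>. The sequence of the exponents of
  \<open>b\<close> in this word is the paperfolding sequence. Hence it is enough to have an ideal that
  contains \<open>a\<^sup>2\<close>, \<open>b\<^sup>3\<close> and a power of each polynomial without constant term, and that is killed by
  linear functionals which are supported on words of these two degrees and do not vanish on the
  leading words.

  Why powers vanish. The functional \<open>Phi\<close> gives signs to sequences of exponents. A sequence is
  divided into blocks, these into blocks of the stage below, and so on; each block of stage \<open>j + 1\<close>
  contains \<open>2 ^ j\<close> slots of equal length, and exchanging two of its slots changes the sign
  (\<open>Phi_swap\<close>). Let \<open>f\<close> be a polynomial. The coefficient of a word in \<open>f ^ N\<close> is a sum over the
  factorizations of the word into monomials of \<open>f\<close>. Each slot boundary cuts one of these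
  monomials, and what remains in front of the cut is a prefix of a monomial, so there are
  finitely many possibilities. When the number of slots exceeds the number of pairs of such
  prefixes, two slots are cut in the same way at both ends, and exchanging their contents merely
  permutes the factors. The product of the coefficients is unchanged and the sign is reversed,
  so everything cancels (\<open>factorizations_cancel\<close>). For \<open>N\<close> large, every product of \<open>N\<close> monomials
  contains a whole block with sufficiently many slots, whatever stands around it. The
  cancellation is a bijection between terms with sign \<open>1\<close> and terms with sign \<open>-1\<close>; the
  characteristic and the size of the field do not enter.

  Why the functional does not vanish on the leading words. The sign of a block is nonzero as
  soon as the contents of its slots differ, and windows of the paperfolding sequence at
  distances that are not divisible by a high power of two do differ
  (\<open>paperfold_windows_differ\<close>, \<open>Phi_paperfold\<close>).
\<close>

section \<open>The paperfolding sequence\<close>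

fun paperfold :: "nat \<Rightarrow> nat" where
  "paperfold n =
     (if n = 0 then 1 else if even n then paperfold (n div 2) else if n mod 4 = 1 then 1 else 2)"

declare paperfold.simps [simp del]

lemma paperfold_double: "n > 0 \<Longrightarrow> paperfold (2 * n) = paperfold n"
  by (subst paperfold.simps) simp

lemma paperfold_odd: "odd n \<Longrightarrow> paperfold n = (if n mod 4 = 1 then 1 else 2)"
  by (subst paperfold.simps) (auto intro: odd_pos)

lemma paperfold_range: "paperfold n \<in> {1, 2}"
proof (induction n rule: paperfold.induct)
  case (1 n)
  then show ?case by (subst paperfold.simps) auto
qed

lemma paperfold_power_mult: "m > 0 \<Longrightarrow> paperfold (2 ^ k * m) = paperfold m"
proof (induction k)
  case (Suc k)
  then show ?case using paperfold_double[of "2 ^ k * m"] by (simp add: mult.assoc)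
qed simp

lemma paperfold_power: "paperfold (2 ^ k) = 1"
  using paperfold_power_mult[of 1 k] by (simp add: paperfold_odd)

text \<open>
  The value at \<open>l\<close> depends only on the odd part of \<open>l\<close> modulo \<open>4\<close>, which is not changed by adding
  a multiple of four times the power of two in \<open>l\<close>.
\<close>
lemma paperfold_periodic: "\<not> 2 ^ n dvd l \<Longrightarrow> paperfold (l + 2 ^ Suc n) = paperfold l"
proof (induction n arbitrary: l)
  case (Suc n)
  show ?case
  proof (cases "even l")
    case True
    then obtain h where h: "l = 2 * h" by auto
    with Suc.prems have nd: "\<not> 2 ^ n dvd h" by simp
    then have "h > 0" by (cases h) auto
    then have "paperfold (2 * (h + 2 ^ Suc n)) = paperfold (2 * h)"
      using Suc.IH[OF nd] by (simp only: paperfold_double add_pos_pos)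
    then show ?thesis using h by (simp add: algebra_simps)
  next
    case False
    moreover have "(l + 2 ^ Suc (Suc n)) mod 4 = l mod 4"
      using mod_mult_self2[of l 4 "2 ^ n"] by simp
    moreover have "odd (l + 2 ^ Suc (Suc n))" using False by simp
    ultimately show ?thesis using False paperfold_odd by metis
  qed
qed simp

text \<open>
  Shifting by an odd \<open>d\<close> moves a suitable pair of odd places \<open>l\<close>, \<open>l + 4\<close>, where the
  sequence agrees, to two places \<open>2 g\<close>, \<open>2 (g + 2)\<close> with \<open>g\<close> odd, where it differs. An even
  shift reduces to half the shift on the even places.
\<close>
lemma paperfold_windows_differ:
  "\<not> 2 ^ p dvd d \<Longrightarrow> \<exists>t\<in>{1..2 ^ (p + 2)}. paperfold (a + t) \<noteq> paperfold (a + d + t)"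
proof (induction p arbitrary: a d)
  case (Suc p)
  show ?case
  proof (cases "odd d")
    case True
    obtain t where t: "t \<in> {1..4}" "(a + d + t) mod 4 = 2"
    proof -
      have "\<exists>u. 1 \<le> u \<and> u \<le> 4 \<and> (m + u) mod 4 = 2" for m :: nat by presburger
      then show ?thesis using that by (metis atLeastAtMost_iff)
    qed
    obtain g where g: "a + d + t = 2 * g" "odd g"
    proof -
      have "even (a + d + t)" "odd ((a + d + t) div 2)" using t(2) by presburger+
      then show ?thesis using that[of "(a + d + t) div 2"] by auto
    qed
    have oddl: "odd (a + t)" using True g(1) by presburger
    have "paperfold (a + t + 4) = paperfold (a + t)"
      using oddl by (simp add: paperfold_odd)
    moreover have "paperfold (2 * g) \<noteq> paperfold (2 * (g + 2))"
    proof -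
      have "(g mod 4 = 1) \<noteq> ((g + 2) mod 4 = 1)" using g(2) by presburger
      moreover have "g > 0" "odd (g + 2)" using g(2) by (auto simp: odd_pos)
      ultimately show ?thesis using g(2) by (simp add: paperfold_double paperfold_odd del: mult_Suc_right)
    qed
    moreover have "a + d + (t + 4) = 2 * (g + 2)" using g(1) by simp
    ultimately have "paperfold (a + t) \<noteq> paperfold (a + d + t) \<or>
      paperfold (a + (t + 4)) \<noteq> paperfold (a + d + (t + 4))"
      using g(1) by (metis add.assoc)
    moreover have "t \<in> {1..2 ^ (Suc p + 2)}" "t + 4 \<in> {1..2 ^ (Suc p + 2)}"
    proof -
      have "(2::nat) ^ (Suc p + 2) = 8 * 2 ^ p" by (simp add: power_add)
      moreover have "(1::nat) \<le> 2 ^ p" by simp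
      ultimately have "(8::nat) \<le> 2 ^ (Suc p + 2)" by linarith
      then show "t \<in> {1..2 ^ (Suc p + 2)}" "t + 4 \<in> {1..2 ^ (Suc p + 2)}"
        using t(1) unfolding atLeastAtMost_iff by linarith+
    qed
    ultimately show ?thesis by blast
  next
    case False
    then obtain e where e: "d = 2 * e" by auto
    with Suc.prems have "\<not> 2 ^ p dvd e" by simp
    from Suc.IH[OF this, of "a div 2"] obtain s where s: "s \<in> {1..2 ^ (p + 2)}"
      "paperfold (a div 2 + s) \<noteq> paperfold (a div 2 + e + s)" by blast
    define t where "t = 2 * (a div 2 + s) - a"
    have t1: "a + t = 2 * (a div 2 + s)" "a + d + t = 2 * (a div 2 + e + s)"
      using s(1) e by (auto simp: t_def)
    have "t \<in> {1..2 ^ (Suc p + 2)}" using s(1) by (auto simp: t_def)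
    moreover have "paperfold (a + t) \<noteq> paperfold (a + d + t)"
      unfolding t1 using s by (simp add: paperfold_double del: distrib_left_numeral)
    ultimately show ?thesis by blast
  qed
qed simp

section \<open>Alternating signs\<close>

fun chop :: "nat \<Rightarrow> 'a list \<Rightarrow> 'a list list" where
  "chop n xs = (if n = 0 \<or> xs = [] then [] else take n xs # chop n (drop n xs))"

declare chop.simps [simp del]

lemma chop_Nil [simp]: "chop n [] = []"
  by (subst chop.simps) simp

lemma chop_block: "length xs = n \<Longrightarrow> n > 0 \<Longrightarrow> chop n (xs @ ys) = xs # chop n ys"
  by (subst chop.simps) auto

lemma chop_append: "length xs = k * n \<Longrightarrow> n > 0 \<Longrightarrow> chop n (xs @ ys) = chop n xs @ chop n ys"
proof (induction k arbitrary: xs)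
  case (Suc k)
  have xs: "xs = take n xs @ drop n xs" by simp
  have l: "length (take n xs) = n" "length (drop n xs) = k * n" using Suc.prems by auto
  have "chop n (xs @ ys) = take n xs # chop n (drop n xs @ ys)"
    using chop_block[OF l(1) Suc.prems(2), of "drop n xs @ ys"] xs by (metis append.assoc)
  also have "\<dots> = take n xs # chop n (drop n xs) @ chop n ys"
    using Suc.IH[OF l(2) Suc.prems(2)] by simp
  also have "\<dots> = chop n xs @ chop n ys"
    using chop_block[OF l(1) Suc.prems(2), of "drop n xs"] xs by simp
  finally show ?case .
qed simp

lemma length_chop: "length xs = k * n \<Longrightarrow> n > 0 \<Longrightarrow> length (chop n xs) = k"
proof (induction k arbitrary: xs)
  case (Suc k)
  have "chop n xs = take n xs # chop n (drop n xs)"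
    using Suc.prems by (subst chop.simps) auto
  then show ?case using Suc by simp
qed simp

lemma chop_concat:
  "\<forall>z\<in>set zs. length z = n \<Longrightarrow> n > 0 \<Longrightarrow> chop n (concat zs @ ys) = zs @ chop n ys"
  by (induction zs) (auto simp: chop_block)

lemma chop_concat_multiple:
  "\<forall>z\<in>set zs. length z = k * n \<Longrightarrow> n > 0 \<Longrightarrow>
     chop n (concat zs @ ys) = concat (map (chop n) zs) @ chop n ys"
  by (induction zs) (auto simp: chop_append)

lemma chop_map_upt:
  "n > 0 \<Longrightarrow> chop n (map f [a + 1..<a + r * n + 1])
     = map (\<lambda>h. map f [a + h * n + 1..<a + Suc h * n + 1]) [0..<r]"
proof (induction r)
  case (Suc r)
  have eq: "[a + 1..<a + Suc r * n + 1] = [a + 1..<a + r * n + 1] @ [a + r * n + 1..<a + Suc r * n + 1]"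
    using upt_add_eq_append[of "a + 1" "a + r * n + 1" n] by (simp add: algebra_simps)
  have "chop n (map f [a + r * n + 1..<a + Suc r * n + 1]) = [map f [a + r * n + 1..<a + Suc r * n + 1]]"
    using chop_block[of "map f [a + r * n + 1..<a + Suc r * n + 1]" n "[]"] Suc.prems by simp
  then show ?case
    unfolding eq map_append using Suc
    by (subst chop_append[where k = r]) (auto simp: algebra_simps)
qed simp

text \<open>
  Any injection into a linear order gives an antisymmetric sign that is nonzero on distinct
  arguments.
\<close>
definition compare :: "nat list \<Rightarrow> nat list \<Rightarrow> int" where
  "compare u v = sgn (int (list_encode u) - int (list_encode v))"

lemma compare_sym: "compare u v = - compare v u"
  by (simp add: compare_def sgn_if)

text \<open>
  The product of the comparison signs over all pairs: for distinct entries the sign of the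
  permutation that sorts them decreasingly, and zero when an entry is repeated.
\<close>
primrec alt_sign :: "nat list list \<Rightarrow> int" where
  "alt_sign [] = 1"
| "alt_sign (z # zs) = prod_list (map (compare z) zs) * alt_sign zs"

lemma alt_sign_adjacent: "alt_sign (p @ x # y # s) = - alt_sign (p @ y # x # s)"
proof (induction p)
  case Nil
  show ?case using compare_sym[of x y] by simp
qed simp

text \<open>
  A transposition consists of two such moves over the same entries, whose signs cancel, and one
  adjacent exchange.
\<close>
lemma alt_sign_move: "alt_sign (p @ x # m @ s) = (- 1) ^ length m * alt_sign (p @ m @ x # s)"
proof (induction m arbitrary: p)
  case (Cons y m)
  have "alt_sign (p @ x # (y # m) @ s) = - alt_sign ((p @ [y]) @ x # m @ s)"
    using alt_sign_adjacent[of p x y "m @ s"] by simp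
  then show ?case using Cons[of "p @ [y]"] by simp
qed simp

lemma alt_sign_swap: "alt_sign (p @ y # m @ x # s) = - alt_sign (p @ x # m @ y # s)"
proof -
  have "alt_sign (p @ x # m @ y # s) = (- 1) ^ length m * alt_sign ((p @ m) @ x # y # s)"
    using alt_sign_move[of p x m "y # s"] by simp
  also have "\<dots> = - ((- 1) ^ length m * alt_sign (p @ m @ y # x # s))"
    using alt_sign_adjacent[of "p @ m" x y s] by simp
  also have "\<dots> = - alt_sign (p @ y # m @ x # s)"
    using alt_sign_move[of p y m "x # s"] by simp
  finally show ?thesis by simp
qed

definition swap_at :: "nat \<Rightarrow> nat \<Rightarrow> 'a list \<Rightarrow> 'a list" where
  "swap_at i j xs = xs[i := xs ! j, j := xs ! i]"

lemma length_swap_at [simp]: "length (swap_at i j xs) = length xs"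
  by (simp add: swap_at_def)

lemma nth_swap_at:
  "i < length xs \<Longrightarrow> j < length xs \<Longrightarrow> k < length xs \<Longrightarrow>
     swap_at i j xs ! k = (if k = j then xs ! i else if k = i then xs ! j else xs ! k)"
  by (simp add: swap_at_def nth_list_update)

lemma map_swap_at:
  "i < length xs \<Longrightarrow> j < length xs \<Longrightarrow> map f (swap_at i j xs) = swap_at i j (map f xs)"
  by (simp add: swap_at_def map_update)

lemma mset_swap_at: "i < length xs \<Longrightarrow> j < length xs \<Longrightarrow> mset (swap_at i j xs) = mset xs"
  unfolding swap_at_def by (rule mset_swap)

lemma set_swap_at: "i < length xs \<Longrightarrow> j < length xs \<Longrightarrow> set (swap_at i j xs) = set xs"
  by (metis mset_swap_at set_mset_mset)

lemma swap_at_swap_at: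
  "i < length xs \<Longrightarrow> j < length xs \<Longrightarrow> swap_at i j (swap_at i j xs) = xs"
  by (rule nth_equalityI) (auto simp: nth_swap_at)

lemma swap_at_split:
  assumes "i < j" "j < length xs"
  shows "\<exists>p m s. xs = p @ xs ! i # m @ xs ! j # s \<and> swap_at i j xs = p @ xs ! j # m @ xs ! i # s"
proof -
  define p m s where "p = take i xs" and "m = take (j - Suc i) (drop (Suc i) xs)" and "s = drop (Suc j) xs"
  have "drop (Suc i) xs = m @ xs ! j # s"
    using assms id_take_nth_drop[of "j - Suc i" "drop (Suc i) xs"] by (simp add: m_def s_def)
  then have xs: "xs = p @ xs ! i # m @ xs ! j # s"
    using assms id_take_nth_drop[of i xs] by (simp add: p_def)
  have len: "length p = i" "length m = j - Suc i" using assms by (auto simp: p_def m_def)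
  have "swap_at i j (p @ x # m @ y # s) = p @ y # m @ x # s" for x y
    using len assms by (auto simp: swap_at_def list_update_append nth_append nth_Cons split: nat.splits)
  then show ?thesis using xs by metis
qed

lemma alt_sign_swap_at: "i < j \<Longrightarrow> j < length zs \<Longrightarrow> alt_sign (swap_at i j zs) = - alt_sign zs"
  using swap_at_split[of i j zs] alt_sign_swap by metis

lemma alt_sign_nonzero: "distinct zs \<Longrightarrow> alt_sign zs \<noteq> 0"
  by (induction zs) (auto simp: compare_def sgn_0_0 prod_list_zero_iff inj_eq[OF inj_list_encode])

lemma alt_sign_bound: "\<bar>alt_sign zs\<bar> \<le> 1"
proof (induction zs)
  case (Cons z zs)
  have "\<bar>prod_list (map (compare z) ys)\<bar> \<le> 1" for ys
  proof (induction ys)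
    case (Cons y ys)
    have "\<bar>compare z y\<bar> \<le> 1" by (simp add: compare_def sgn_if)
    then show ?case using Cons by (simp add: abs_mult mult_le_one)
  qed simp
  then show ?case using Cons by (simp add: abs_mult mult_le_one)
qed simp

section \<open>An alternating functional on gap sequences\<close>

text \<open>
  Blocks of stage \<open>j\<close> have length \<open>2 ^ lev j\<close>. The increment leaves room for \<open>2 ^ j\<close> slots of length
  about \<open>2 ^ (j + 2)\<close>.
\<close>
primrec lev :: "nat \<Rightarrow> nat" where
  "lev 0 = 0"
| "lev (Suc j) = lev j + (2 * j + 3)"

text \<open>
  The length of a slot of stage \<open>j\<close>, counted in blocks of that stage. It is odd, so that the
  distance of two of the \<open>2 ^ j\<close> slots is never divisible by \<open>2 ^ j\<close>, and it is at least
  \<open>2 ^ (j + 2)\<close>, so that windows at such distances differ.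
\<close>
definition slot_len :: "nat \<Rightarrow> nat" where
  "slot_len j = 2 ^ (j + 2) + 1"

text \<open>
  A block of stage \<open>j + 1\<close> is a sequence of blocks of stage \<open>j\<close>. Only the last entries of these
  smaller blocks contribute to its own sign: they are grouped into \<open>2 ^ j\<close> windows of length
  \<open>slot_len j\<close>, one for each slot, and the remaining ones are ignored. A slot as a whole also
  contains the complete smaller blocks that belong to its window.
\<close>
primrec Phi :: "nat \<Rightarrow> nat list \<Rightarrow> int" where
  "Phi 0 cs = 1"
| "Phi (Suc j) cs =
     alt_sign (take (2 ^ j) (chop (slot_len j) (map last (chop (2 ^ lev j) cs))))
     * prod_list (map (Phi j) (chop (2 ^ lev j) cs))"

lemma upt_split: "a \<le> b \<Longrightarrow> b \<le> c \<Longrightarrow> [a..<c] = [a..<b] @ [b..<c]"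
  using upt_add_eq_append[of a b "c - b"] by simp

lemma slot_len_pos [simp]: "slot_len j > 0"
  by (simp add: slot_len_def)

text \<open>
  The inequality is strict, so the last block of stage \<open>j\<close> lies outside all slots. Its last entry
  is also the last entry of the surrounding block, which the higher stages read.
\<close>
lemma slots_fit: "2 ^ j * (slot_len j * 2 ^ lev j) < 2 ^ lev (Suc j)"
proof -
  have "2 ^ j * slot_len j < (2::nat) ^ (2 * j + 3)"
  proof -
    have "(2::nat) ^ (2 * j + 3) = 2 ^ j * (8 * 2 ^ j)"
      by (simp add: power_add power_even_eq power2_eq_square)
    moreover have "(1::nat) \<le> 2 ^ j" by simp
    then have "slot_len j < 8 * 2 ^ j"
      unfolding slot_len_def power_add power2_eq_square by linarith
    ultimately show ?thesis by simp
  qed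
  then have "2 ^ j * slot_len j * 2 ^ lev j < (2::nat) ^ (2 * j + 3) * 2 ^ lev j"
    by (rule mult_strict_right_mono) simp
  moreover have "(2::nat) ^ lev (Suc j) = 2 ^ (2 * j + 3) * 2 ^ lev j"
    by (simp only: lev.simps power_add mult.commute)
  ultimately show ?thesis by (simp only: mult.assoc)
qed

lemma lev_mono: "i \<le> j \<Longrightarrow> lev i \<le> lev j"
  by (induction rule: dec_induct) auto

lemma lev_le_cancel: "lev i \<le> lev j \<Longrightarrow> i \<le> j"
proof (rule ccontr)
  assume "lev i \<le> lev j" "\<not> i \<le> j"
  then have "lev (Suc j) \<le> lev j" using lev_mono[of "Suc j" i] by simp
  then show False by simp
qed

lemma le_lev: "j \<le> lev j"
  by (induction j) auto

lemma prod_list_bound: "(\<And>x. x \<in> set xs \<Longrightarrow> \<bar>f x\<bar> \<le> (1::int)) \<Longrightarrow> \<bar>prod_list (map f xs)\<bar> \<le> 1"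
  by (induction xs) (auto simp: abs_mult intro!: mult_le_one)

lemma Phi_bound: "\<bar>Phi j cs\<bar> \<le> 1"
proof (induction j arbitrary: cs)
  case (Suc j)
  then show ?case
    unfolding Phi.simps abs_mult
    by (intro mult_le_one alt_sign_bound prod_list_bound abs_ge_zero)
qed simp

lemma Phi_cases: "Phi j cs \<noteq> 0 \<Longrightarrow> Phi j cs = 1 \<or> Phi j cs = - 1"
  using Phi_bound[of j cs] by linarith

lemma length_concat_const: "\<forall>z\<in>set zs. length z = n \<Longrightarrow> length (concat zs) = length zs * n"
  by (induction zs) auto

lemma Phi_swap_top:
  assumes "\<forall>z\<in>set zs. length z = slot_len J * 2 ^ lev J" "length zs = 2 ^ J"
    and "i < i'" "i' < 2 ^ J"
  shows "Phi (Suc J) (concat (swap_at i i' zs) @ s) = - Phi (Suc J) (concat zs @ s)"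
proof -
  let ?K = "2 ^ lev J :: nat"
  let ?key = "\<lambda>z. map last (chop ?K z)"
  have ii: "i < length zs" "i' < length zs" using assms by auto
  have eval: "Phi (Suc J) (concat ys @ s) = alt_sign (map ?key ys)
      * (prod_list (map (\<lambda>z. prod_list (map (Phi J) (chop ?K z))) ys) * prod_list (map (Phi J) (chop ?K s)))"
    if ys: "\<forall>z\<in>set ys. length z = slot_len J * ?K" "length ys = 2 ^ J" for ys
  proof -
    have c: "chop ?K (concat ys @ s) = concat (map (chop ?K) ys) @ chop ?K s"
      using ys(1) by (intro chop_concat_multiple) auto
    have k: "map last (chop ?K (concat ys @ s)) = concat (map ?key ys) @ ?key s"
      unfolding c by (simp add: map_concat comp_def)
    have "chop (slot_len J) (concat (map ?key ys) @ ?key s) = map ?key ys @ chop (slot_len J) (?key s)"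
      by (rule chop_concat) (use ys(1) length_chop[of _ "slot_len J" ?K] in auto)
    then have "take (2 ^ J) (chop (slot_len J) (map last (chop ?K (concat ys @ s)))) = map ?key ys"
      unfolding k using ys(2) by simp
    moreover have "prod_list (map (Phi J) (chop ?K (concat ys @ s)))
        = prod_list (map (\<lambda>z. prod_list (map (Phi J) (chop ?K z))) ys) * prod_list (map (Phi J) (chop ?K s))"
    proof -
      have "prod_list (map g (concat xss)) = prod_list (map (\<lambda>z. prod_list (map g z)) xss)"
        for g :: "nat list \<Rightarrow> int" and xss by (induction xss) auto
      then show ?thesis unfolding c by (simp add: comp_def)
    qed
    ultimately show ?thesis by simp
  qed
  have "Phi (Suc J) (concat (swap_at i i' zs) @ s) = alt_sign (map ?key (swap_at i i' zs))
      * (prod_list (map (\<lambda>z. prod_list (map (Phi J) (chop ?K z))) (swap_at i i' zs))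
         * prod_list (map (Phi J) (chop ?K s)))"
    by (rule eval) (use assms ii set_swap_at[OF ii] in auto)
  moreover have "alt_sign (map ?key (swap_at i i' zs)) = - alt_sign (map ?key zs)"
    unfolding map_swap_at[OF ii] using assms ii by (intro alt_sign_swap_at) auto
  moreover have "prod_list (map g (swap_at i i' zs)) = prod_list (map g zs)" for g :: "nat list \<Rightarrow> int"
    by (metis mset_map mset_swap_at[OF ii] prod_mset_prod_list)
  ultimately show ?thesis using eval[OF assms(1,2)] by simp
qed

text \<open>
  Exchanging two slots permutes the blocks of all lower stages and leaves all higher
  stages alone, so only the sign of the stage of the slots changes.
\<close>
lemma Phi_swap:
  assumes "\<forall>z\<in>set zs. length z = slot_len j * 2 ^ lev j" "length zs = 2 ^ j"
    and "i < i'" "i' < 2 ^ j"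
    and "j < J" "length p = b * 2 ^ lev (Suc j)" "length (p @ concat zs @ s) = 2 ^ lev J"
  shows "Phi J (p @ concat (swap_at i i' zs) @ s) = - Phi J (p @ concat zs @ s)"
  using assms(5-7)
proof (induction J arbitrary: p b s)
  case (Suc J)
  have lz: "length (concat zs) = 2 ^ j * (slot_len j * 2 ^ lev j)"
    using length_concat_const[OF assms(1)] assms(2) by simp
  show ?case
  proof (cases "j = J")
    case True
    have "b = 0"
    proof (rule ccontr)
      assume "b \<noteq> 0"
      then have "length p \<ge> 2 ^ lev (Suc J)" using Suc.prems(2) True by (cases b) auto
      moreover have "length (concat zs) > 0" unfolding lz by simp
      ultimately have "length (p @ concat zs @ s) > 2 ^ lev (Suc J)" unfolding length_append by linarith
      then show False using Suc.prems(3) by simp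
    qed
    then have "p = []" using Suc.prems(2) by simp
    then show ?thesis using Phi_swap_top[of zs J i i' s] assms(1-4) True by simp
  next
    case False
    then have jJ: "j < J" using Suc.prems(1) by simp
    let ?K = "2 ^ lev J :: nat" and ?k = "2 ^ lev (Suc j) :: nat"
    have Kpos: "?K > 0" by simp
    have kK: "?k dvd ?K" using jJ by (intro le_imp_power_dvd lev_mono) simp
    define g p1 p2 where "g = length p div ?K" and "p1 = take (g * ?K) p" and "p2 = drop (g * ?K) p"
    have gl: "g * ?K \<le> length p" by (simp add: g_def)
    have p: "p = p1 @ p2" "length p1 = g * ?K" "length p2 = length p mod ?K"
      using gl by (auto simp: p1_def p2_def g_def minus_div_mult_eq_mod)
    have "?k dvd length p2"
      unfolding p(3) using kK Suc.prems(2) by (simp add: dvd_mod)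
    then obtain b' where b': "length p2 = b' * ?k" by (metis dvd_div_mult_self)
    obtain r where r: "?K = r * ?k" using kK by (metis dvd_div_mult_self)
    have "length p2 < ?K" unfolding p(3) by simp
    then have "b' < r" unfolding b' r by simp
    then have "(b' + 1) * ?k \<le> ?K" unfolding r by (intro mult_le_mono1) simp
    then have lt: "length p2 + length (concat zs) < ?K"
      unfolding b' lz using slots_fit[of j] by simp
    define n where "n = ?K - (length p2 + length (concat zs))"
    define s1 s2 where "s1 = take n s" and "s2 = drop n s"
    have "g < 2 ^ (2 * J + 3)"
    proof -
      have "g * ?K \<le> length p" by (rule gl)
      also have "\<dots> < 2 ^ lev (Suc J)"
      proof -
        have "length (concat zs) > 0" unfolding lz by simp
        then have "length p < length (p @ concat zs @ s)" unfolding length_append by linarith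
        then show ?thesis unfolding Suc.prems(3) .
      qed
      also have "\<dots> = 2 ^ (2 * J + 3) * ?K" by (simp add: power_add)
      finally show ?thesis by simp
    qed
    then have "(g + 1) * ?K \<le> 2 ^ (2 * J + 3) * ?K" by (intro mult_le_mono1) simp
    then have "(g + 1) * ?K \<le> length (p @ concat zs @ s)"
      unfolding Suc.prems(3) by (simp add: power_add mult.commute)
    then have "n \<le> length s"
      using p(1,2) lt by (simp add: n_def)
    then have s: "s = s1 @ s2" "length s1 = n" by (auto simp: s1_def s2_def)
    then have s1: "s1 \<noteq> []" using lt by (auto simp: n_def)
    have len: "length (p2 @ concat zs @ s1) = ?K" using lt s by (simp add: n_def)
    have len': "length (p2 @ concat (swap_at i i' zs) @ s1) = ?K"
    proof -
      have ii: "i < length zs" "i' < length zs" using assms(2-4) by auto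
      have "\<forall>z\<in>set (swap_at i i' zs). length z = slot_len j * 2 ^ lev j"
        unfolding set_swap_at[OF ii] by (rule assms(1))
      then have "length (concat (swap_at i i' zs)) = length (concat zs)"
        using assms(2) lz by (simp only: length_concat_const length_swap_at)
      then show ?thesis using len by simp
    qed
    have ch: "chop ?K (p1 @ x @ s2) = chop ?K p1 @ x # chop ?K s2" if "length x = ?K" for x
      using that by (simp add: chop_append[OF p(2)] chop_block[OF that])
    have IH: "Phi J (p2 @ concat (swap_at i i' zs) @ s1) = - Phi J (p2 @ concat zs @ s1)"
      by (rule Suc.IH[OF jJ b' len])
    have eq: "p @ xs @ s = p1 @ (p2 @ xs @ s1) @ s2" for xs using p(1) s(1) by simp
    have last: "last (p2 @ xs @ s1) = last s1" for xs using s1 by simp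
    \<comment> \<open>The slots lie inside one smaller block and avoid its last entry, so the sign at stage \<open>J\<close> is unaffected.\<close>
    show ?thesis
    proof -
      have "Phi (Suc J) (p1 @ (p2 @ concat (swap_at i i' zs) @ s1) @ s2)
          = - Phi (Suc J) (p1 @ (p2 @ concat zs @ s1) @ s2)"
        unfolding Phi.simps ch[OF len] ch[OF len'] by (simp add: IH last del: append_assoc)
      then show ?thesis by (simp only: eq)
    qed
  qed
qed simp

lemma take_chop_map_upt:
  assumes "n > 0" "q * n \<le> m"
  shows "take q (chop n (map f [a + 1..<a + m + 1]))
    = map (\<lambda>i. map f [a + i * n + 1..<a + Suc i * n + 1]) [0..<q]"
proof -
  have "[a + 1..<a + m + 1] = [a + 1..<a + q * n + 1] @ [a + q * n + 1..<a + m + 1]"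
    using assms by (intro upt_split) auto
  then have "chop n (map f [a + 1..<a + m + 1])
      = chop n (map f [a + 1..<a + q * n + 1] @ map f [a + q * n + 1..<a + m + 1])"
    by (metis map_append)
  also have "\<dots> = chop n (map f [a + 1..<a + q * n + 1]) @ chop n (map f [a + q * n + 1..<a + m + 1])"
    using assms(1) by (intro chop_append[where k = q]) (auto simp del: upt_Suc)
  finally show ?thesis unfolding chop_map_upt[OF assms(1)] by simp
qed

text \<open>
  The distance of two windows is an odd multiple of a positive number below \<open>2 ^ j\<close>.
\<close>
lemma distinct_paperfold_windows:
  "distinct (map (\<lambda>i. map paperfold [c + i * slot_len j + 1..<c + Suc i * slot_len j + 1]) [0..<2 ^ j])"
proof -
  let ?win = "\<lambda>i. map paperfold [c + i * slot_len j + 1..<c + Suc i * slot_len j + 1]"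
  have diff: "?win i \<noteq> ?win i'" if "i < i'" "i' < 2 ^ j" for i i'
  proof -
    define d where "d = (i' - i) * slot_len j"
    have "\<not> 2 ^ j dvd d"
    proof
      assume "2 ^ j dvd d"
      moreover have "coprime (2 ^ j) (slot_len j)"
        by (simp add: slot_len_def coprime_left_2_iff_odd)
      ultimately have "2 ^ j dvd i' - i"
        unfolding d_def by (simp only: coprime_dvd_mult_left_iff)
      then have "2 ^ j \<le> i' - i" using that(1) by (intro dvd_imp_le) auto
      then show False using that by linarith
    qed
    from paperfold_windows_differ[OF this, of "c + i * slot_len j"] obtain t where
      t: "t \<in> {1..2 ^ (j + 2)}"
        "paperfold (c + i * slot_len j + t) \<noteq> paperfold (c + i * slot_len j + d + t)" by blast
    have d: "c + i * slot_len j + d = c + i' * slot_len j"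
      using that(1) by (simp add: d_def diff_mult_distrib)
    have "map paperfold [b + 1..<b + n + 1] ! (t - 1) = paperfold (b + t)" if "t \<le> n" for b n
      using t(1) that by (subst nth_map) (auto simp del: upt_Suc)
    moreover have "t \<le> slot_len j" using t(1) by (simp add: slot_len_def)
    moreover have "c + Suc i * slot_len j = c + i * slot_len j + slot_len j" for i by simp
    ultimately have "?win i ! (t - 1) = paperfold (c + i * slot_len j + t)" for i
      by (simp only:)
    then show ?thesis using t(2) unfolding d by metis
  qed
  have "inj_on ?win {0..<2 ^ j}"
    by (rule linorder_inj_onI') (use diff in auto)
  then show ?thesis by (simp only: distinct_map distinct_upt set_upt simp_thms)
qed

text \<open>
  Aligned pieces of the paperfolding sequence reproduce themselves: the last entries of the
  smaller blocks of such a piece form again a piece of the paperfolding sequence, because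
  multiplying the position by a power of two does not change the value.
\<close>
lemma Phi_paperfold: "Phi j (map paperfold [g * 2 ^ lev j + 1..<Suc g * 2 ^ lev j + 1]) \<noteq> 0"
proof (induction j arbitrary: g)
  case (Suc j)
  let ?K = "2 ^ lev j :: nat" and ?M = "2 ^ (2 * j + 3) :: nat" and ?S = "slot_len j"
  let ?cs = "map paperfold [g * 2 ^ lev (Suc j) + 1..<Suc g * 2 ^ lev (Suc j) + 1]"
  have KM: "2 ^ lev (Suc j) = ?M * ?K" by (simp add: power_add)
  have chop: "chop ?K ?cs = map (\<lambda>h. map paperfold [(g * ?M + h) * ?K + 1..<Suc (g * ?M + h) * ?K + 1]) [0..<?M]"
  proof -
    have "g * 2 ^ lev (Suc j) = g * ?M * ?K" "Suc g * 2 ^ lev (Suc j) = g * ?M * ?K + ?M * ?K"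
      unfolding KM by (simp_all only: mult.assoc mult_Suc add.commute)
    moreover have "g * ?M * ?K + h * ?K = (g * ?M + h) * ?K" for h
      by (simp only: add_mult_distrib)
    moreover have "?K > 0" by simp
    moreover have "g * ?M * ?K + Suc h * ?K = Suc (g * ?M + h) * ?K" for h
      by (simp only: add_mult_distrib[symmetric] add_Suc_right)
    ultimately show ?thesis
      using chop_map_upt[of ?K paperfold "g * ?M * ?K" ?M] by (simp only:)
  qed
  have "map last (chop ?K ?cs) = map (\<lambda>h. paperfold (Suc (g * ?M + h))) [0..<?M]"
  proof -
    have "last (map paperfold [a * n + 1..<Suc a * n + 1]) = paperfold (Suc a * n)" if "n > 0" for a n
      using that by (simp add: last_map)
    moreover have "paperfold (Suc a * ?K) = paperfold (Suc a)" for a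
      using paperfold_power_mult[of "Suc a" "lev j"] by (simp only: mult.commute zero_less_Suc)
    moreover have "?K > 0" by simp
    ultimately have "last (map paperfold [a * ?K + 1..<Suc a * ?K + 1]) = paperfold (Suc a)" for a
      by metis
    then show ?thesis unfolding chop map_map comp_def by simp
  qed
  also have "\<dots> = map paperfold [g * ?M + 1..<g * ?M + ?M + 1]"
  proof -
    have "map (\<lambda>h. paperfold (Suc (c + h))) [0..<n] = map paperfold [c + 1..<c + n + 1]" for c n
      by (induction n) auto
    then show ?thesis .
  qed
  finally have skel: "map last (chop ?K ?cs) = map paperfold [g * ?M + 1..<g * ?M + ?M + 1]" .
  let ?win = "\<lambda>i. map paperfold [g * ?M + i * ?S + 1..<g * ?M + Suc i * ?S + 1]"
  have "take (2 ^ j) (chop ?S (map last (chop ?K ?cs))) = map ?win [0..<2 ^ j]"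
  proof -
    have "2 ^ j * ?S * ?K < ?M * ?K" using slots_fit[of j] unfolding KM by (simp only: mult.assoc)
    then have "2 ^ j * ?S \<le> ?M" by (metis mult_less_cancel2 less_imp_le_nat)
    then show ?thesis unfolding skel by (rule take_chop_map_upt[OF slot_len_pos])
  qed
  moreover have "distinct (map ?win [0..<2 ^ j])"
    by (rule distinct_paperfold_windows)
  ultimately have "alt_sign (take (2 ^ j) (chop ?S (map last (chop ?K ?cs)))) \<noteq> 0"
    by (simp only: alt_sign_nonzero not_False_eq_True)
  moreover have "prod_list (map (Phi j) (chop ?K ?cs)) \<noteq> 0"
  proof -
    have "0 \<notin> set (map (Phi j) (map f [0..<n]))" if "\<And>h. Phi j (f h) \<noteq> 0" for f and n :: nat
    proof
      assume "0 \<in> set (map (Phi j) (map f [0..<n]))"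
      then obtain h where "Phi j (f h) = 0" by auto
      then show False using that by blast
    qed
    from this[OF Suc] show ?thesis unfolding chop prod_list_zero_iff .
  qed
  ultimately show ?case unfolding Phi.simps by (simp only: mult_eq_0_iff simp_thms)
qed simp

section \<open>Words with bounded gaps\<close>

text \<open>
  The word \<open>a b\<^sup>c\<^sup>1 a b\<^sup>c\<^sup>2 \<dots>\<close> with prescribed gaps, for \<open>a = 0\<close> and \<open>b = 1\<close>.
\<close>
definition gap_word :: "nat list \<Rightarrow> nat list" where
  "gap_word cs = concat (map (\<lambda>c. 0 # replicate c 1) cs)"

lemma gap_word_Nil [simp]: "gap_word [] = []"
  by (simp add: gap_word_def)

lemma gap_word_Cons: "gap_word (c # cs) = 0 # replicate c 1 @ gap_word cs"
  by (simp add: gap_word_def)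

lemma gap_word_append [simp]: "gap_word (cs @ ds) = gap_word cs @ gap_word ds"
  by (simp add: gap_word_def)

lemma gap_word_concat: "gap_word (concat ds) = concat (map gap_word ds)"
  by (induction ds) auto

lemma gap_word_inject: "gap_word cs = gap_word ds \<Longrightarrow> cs = ds"
proof (induction cs arbitrary: ds)
  case Nil
  then show ?case by (cases ds) (auto simp: gap_word_Cons)
next
  case (Cons c cs)
  then obtain d ds' where ds: "ds = d # ds'" by (cases ds) (auto simp: gap_word_Cons)
  have eq: "replicate c 1 @ gap_word cs = replicate d 1 @ gap_word ds'"
    using Cons.prems unfolding ds gap_word_Cons by simp
  have tw: "length (takeWhile ((=) 1) (replicate n 1 @ gap_word es)) = n" for n es
  proof -
    have "takeWhile ((=) 1) (gap_word es) = []" by (cases es) (auto simp: gap_word_Cons)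
    then show ?thesis by (subst takeWhile_append2) auto
  qed
  have "c = d" using tw[of c cs] tw[of d ds'] unfolding eq by simp
  then have "cs = ds'" using eq by (intro Cons.IH) simp
  then show ?case using ds \<open>c = d\<close> by simp
qed

lemma length_gap_word: "length (gap_word cs) = length cs + sum_list cs"
  by (induction cs) (auto simp: gap_word_Cons)

lemma length_gap_word_le: "set cs \<subseteq> {1, 2} \<Longrightarrow> length (gap_word cs) \<le> 3 * length cs"
  by (induction cs) (auto simp: gap_word_Cons)

lemma length_le_gap_word: "length cs \<le> length (gap_word cs)"
  by (simp add: length_gap_word)

lemma count_list_replicate: "count_list (replicate n a) b = (if a = b then n else 0)"
  by (induction n) auto

lemma count_gap_word_0: "count_list (gap_word cs) 0 = length cs"
  by (induction cs) (auto simp: gap_word_Cons count_list_replicate)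

lemma count_gap_word_1: "count_list (gap_word cs) 1 = sum_list cs"
  by (induction cs) (auto simp: gap_word_Cons count_list_replicate)

lemma gap_word_starts_0: "gap_word cs = a # w \<Longrightarrow> a = 0"
  by (cases cs) (auto simp: gap_word_Cons)

lemma replicate_12:
  "c \<in> {1, 2} \<Longrightarrow> replicate c (1::nat) = [1] \<or> replicate c (1::nat) = [1, 1]"
  by (auto simp: numeral_2_eq_2)

lemma gap_word_no_00: "set cs \<subseteq> {1, 2} \<Longrightarrow> gap_word cs \<noteq> x @ [0, 0] @ y"
proof (induction cs arbitrary: x)
  case (Cons c cs)
  have c: "replicate c (1::nat) = [1] \<or> replicate c (1::nat) = [1, 1]"
    using Cons.prems by (intro replicate_12) auto
  show ?case
  proof
    assume eq: "gap_word (c # cs) = x @ [0, 0] @ y"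
    show False
    proof (cases x)
      case Nil
      then show False using eq c by (auto simp: gap_word_Cons)
    next
      case (Cons a x')
      then have "(\<exists>x''. gap_word cs = x'' @ [0, 0] @ y)"
        using eq c gap_word_starts_0[of cs] by (auto simp: gap_word_Cons Cons_eq_append_conv)
      then show False using Cons.IH Cons.prems by auto
    qed
  qed
qed simp

lemma gap_word_no_111: "set cs \<subseteq> {1, 2} \<Longrightarrow> gap_word cs \<noteq> x @ [1, 1, 1] @ y"
proof (induction cs arbitrary: x)
  case (Cons c cs)
  have c: "replicate c (1::nat) = [1] \<or> replicate c (1::nat) = [1, 1]"
    using Cons.prems by (intro replicate_12) auto
  show ?case
  proof
    assume eq: "gap_word (c # cs) = x @ [1, 1, 1] @ y"
    show False
    proof (cases x)
      case Nil
      then show False using eq by (auto simp: gap_word_Cons)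
    next
      case (Cons a x')
      then have "(\<exists>x''. gap_word cs = x'' @ [1, 1, 1] @ y)"
        using eq c gap_word_starts_0[of cs] by (auto simp: gap_word_Cons Cons_eq_append_conv)
      then show False using Cons.IH Cons.prems by auto
    qed
  qed
qed simp

lemma gap_word_prefix:
  assumes "gap_word cs = x @ r" "set cs \<subseteq> {1, 2}"
  shows "\<exists>cs1 cs2 z. cs = cs1 @ cs2 \<and> length cs1 = count_list x 0 \<and> gap_word cs1 = x @ z \<and> length z \<le> 2"
  using assms
proof (induction cs arbitrary: x)
  case Nil
  then show ?case by auto
next
  case (Cons c cs)
  show ?case
  proof (cases x)
    case Nil
    then show ?thesis by (intro exI[of _ "[]"] exI[of _ "c # cs"]) auto
  next
    case (Cons a x')
    then have a: "a = 0" and eq: "replicate c 1 @ gap_word cs = x' @ r"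
      using Cons.prems(1) by (auto simp: gap_word_Cons)
    have c: "c \<le> 2" using Cons.prems(2) by auto
    from eq consider u where "replicate c 1 = x' @ u" | u where "x' = replicate c 1 @ u" "gap_word cs = u @ r"
      by (auto simp: append_eq_append_conv2)
    then show ?thesis
    proof cases
      case 1
      have "set x' \<subseteq> {1}"
      proof -
        have "set x' \<subseteq> set (replicate c 1)" unfolding 1 by simp
        then show ?thesis by (auto split: if_splits)
      qed
      then have "count_list x' 0 = 0" by (intro count_notin) auto
      moreover have "length u \<le> 2"
      proof -
        have "length (x' @ u) = c" unfolding 1[symmetric] by simp
        then show ?thesis using c by simp
      qed
      ultimately show ?thesis
        using Cons a 1
        by (intro exI[of _ "[c]"] exI[of _ cs] exI[of _ u]) (simp add: gap_word_Cons)
    next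
      case 2
      with Cons.IH[OF 2(2)] Cons.prems(2) obtain cs1 cs2 z where
        IH: "cs = cs1 @ cs2" "length cs1 = count_list u 0" "gap_word cs1 = u @ z" "length z \<le> 2" by auto
      have "count_list x 0 = Suc (count_list u 0)"
        using Cons a 2(1) by (simp add: count_list_replicate)
      then show ?thesis
        using Cons a 2(1) IH
        by (intro exI[of _ "c # cs1"] exI[of _ cs2] exI[of _ z]) (simp add: gap_word_Cons)
    qed
  qed
qed

text \<open>
  The position of the block depends only on the number of zeros in front of the window, so it is
  the same for all words with the same context.
\<close>
lemma window_contains_block:
  assumes "gap_word cs = x @ v @ y" "set cs \<subseteq> {1, 2}" "K > 0" "9 * K + 3 \<le> length v"
  shows "\<exists>p bl s v1 v2. cs = p @ bl @ s \<and> length p = (count_list x 0 div K + 2) * K \<and> length bl = K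
    \<and> gap_word p = x @ v1 \<and> v = v1 @ gap_word bl @ v2 \<and> v2 \<noteq> [] \<and> K \<le> length v1"
proof -
  define t where "t = count_list x 0"
  obtain cs1 cs2 z where cs: "cs = cs1 @ cs2" "length cs1 = t" "gap_word cs1 = x @ z" "length z \<le> 2"
    using gap_word_prefix[OF assms(1,2)] unfolding t_def by auto
  \<comment> \<open>The block starts one full block after the next block boundary, so that at least \<open>K\<close> letters precede it in the window.\<close>
  define n where "n = (t div K + 2) * K - t"
  have t: "t = t div K * K + t mod K" "t mod K < K" using assms(3) by auto
  have n: "(t div K + 2) * K = t + n" "K \<le> n" "n \<le> 2 * K"
  proof -
    have "(t div K + 2) * K = t div K * K + 2 * K" by (rule add_mult_distrib)
    then show "(t div K + 2) * K = t + n" "K \<le> n" "n \<le> 2 * K"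
      using t unfolding n_def by linarith+
  qed
  have S: "set cs1 \<subseteq> {1, 2}" "set cs2 \<subseteq> {1, 2}" using assms(2) cs(1) by auto
  have gap_word2: "z @ gap_word cs2 = v @ y" using assms(1) cs(1,3) by simp
  have "length (gap_word cs2) \<le> 3 * length cs2" by (rule length_gap_word_le[OF S(2)])
  moreover have "length v + length y = length z + length (gap_word cs2)"
    using arg_cong[OF gap_word2, of length] by simp
  ultimately have l2: "3 * K \<le> length cs2" using assms(4) cs(4) by linarith
  define m bl s where "m = take n cs2" and "bl = take K (drop n cs2)" and "s = drop K (drop n cs2)"
  have cs2: "cs2 = m @ bl @ s" by (simp add: m_def bl_def s_def del: drop_drop)
  have lm: "length m = n" "length bl = K" using l2 n by (auto simp: m_def bl_def)
  have "length (gap_word m) \<le> 3 * n" "length (gap_word bl) \<le> 3 * K"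
    using length_gap_word_le[of m] length_gap_word_le[of bl] S(2) lm unfolding cs2 by auto
  then have short: "length (z @ gap_word m @ gap_word bl) < length v"
    using cs(4) n(3) assms(4) by simp
  have "(z @ gap_word m @ gap_word bl) @ gap_word s = v @ y" using gap_word2 cs2 by simp
  then obtain v2 where v2: "v = (z @ gap_word m @ gap_word bl) @ v2"
    using short by (auto simp: append_eq_append_conv2)
  then have "v2 \<noteq> []" using short by auto
  moreover have "K \<le> length (z @ gap_word m)" using length_le_gap_word[of m] lm n by simp
  ultimately show ?thesis
    using cs cs2 lm n v2 unfolding t_def[symmetric]
    by (intro exI[of _ "cs1 @ m"] exI[of _ bl] exI[of _ s] exI[of _ "z @ gap_word m"] exI[of _ v2]) simp
qed

section \<open>Cutting a factorization\<close>

fun full_factors :: "nat \<Rightarrow> 'a list list \<Rightarrow> 'a list list" where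
  "full_factors n [] = []"
| "full_factors n (m # ms) = (if length m \<le> n then m # full_factors (n - length m) ms else [])"

lemma full_factors_append:
  "n = length (concat A) + k \<Longrightarrow> R \<noteq> [] \<Longrightarrow> k < length (hd R) \<Longrightarrow> full_factors n (A @ R) = A"
proof (induction A arbitrary: n)
  case Nil
  then show ?case by (cases R) auto
qed auto

lemma full_factors_split:
  "n < length (concat ms) \<Longrightarrow> \<exists>T r. ms = full_factors n ms @ T \<and> T \<noteq> [] \<and> length r < length (hd T)
     \<and> concat (full_factors n ms) @ r = take n (concat ms)"
proof (induction ms arbitrary: n)
  case (Cons m ms)
  show ?case
  proof (cases "length m \<le> n")
    case True
    with Cons.prems have "n - length m < length (concat ms)" by simp
    from Cons.IH[OF this] obtain T r where
      "ms = full_factors (n - length m) ms @ T" "T \<noteq> []" "length r < length (hd T)"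
      "concat (full_factors (n - length m) ms) @ r = take (n - length m) (concat ms)" by blast
    then show ?thesis using True by (intro exI[of _ T] exI[of _ r]) auto
  next
    case False
    then show ?thesis by (intro exI[of _ "m # ms"] exI[of _ "take n m"]) auto
  qed
qed simp

text \<open>
  A list of factors is cut where the segments \<open>zs\<close> of its concatenation meet: \<open>As ! i\<close> consists of the
  factors whose last letter lies in segment \<open>i\<close>, the residue \<open>rs ! i\<close> is the part of the first of
  them that lies in front of the segment, and \<open>T\<close> consists of the factors that are not completed
  when the last segment ends. Residues are required to be proper prefixes, which makes the cutting
  unique.
\<close>
definition cutting :: "'a list list list \<Rightarrow> 'a list list \<Rightarrow> 'a list list \<Rightarrow> 'a list list \<Rightarrow> bool" where
  "cutting As rs zs T \<longleftrightarrow> length As = length zs \<and> length rs = Suc (length zs)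
     \<and> (\<forall>i<length zs. As ! i \<noteq> [] \<and> length (rs ! i) < length (hd (As ! i))
          \<and> concat (As ! i) @ rs ! Suc i = rs ! i @ zs ! i)
     \<and> T \<noteq> [] \<and> length (rs ! length zs) < length (hd T)"

lemma cutting_Nil: "cutting As rs [] T \<longleftrightarrow> As = [] \<and> (\<exists>r. rs = [r] \<and> T \<noteq> [] \<and> length r < length (hd T))"
  by (cases rs) (auto simp: cutting_def)

lemma cutting_Cons:
  "cutting As rs (z # zs) T \<longleftrightarrow> (\<exists>A As' r r' rs'. As = A # As' \<and> rs = r # r' # rs' \<and> A \<noteq> []
     \<and> length r < length (hd A) \<and> concat A @ r' = r @ z \<and> cutting As' (r' # rs') zs T)"
proof
  assume L: "cutting As rs (z # zs) T"
  then obtain A As' where A: "As = A # As'" by (cases As) (auto simp: cutting_def)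
  from L obtain r rs1 where "rs = r # rs1" "length rs1 = Suc (length zs)"
    by (cases rs) (auto simp: cutting_def)
  then obtain r' rs' where rs: "rs = r # r' # rs'" by (cases rs1) auto
  show "\<exists>A As' r r' rs'. As = A # As' \<and> rs = r # r' # rs' \<and> A \<noteq> []
     \<and> length r < length (hd A) \<and> concat A @ r' = r @ z \<and> cutting As' (r' # rs') zs T"
    using L unfolding A rs cutting_def by (simp add: All_less_Suc2)
next
  assume "\<exists>A As' r r' rs'. As = A # As' \<and> rs = r # r' # rs' \<and> A \<noteq> []
     \<and> length r < length (hd A) \<and> concat A @ r' = r @ z \<and> cutting As' (r' # rs') zs T"
  then show "cutting As rs (z # zs) T" unfolding cutting_def by (auto simp: All_less_Suc2)
qed

lemma cutting_head:
  "cutting As (r # rs) zs T \<Longrightarrow> concat As @ T \<noteq> [] \<and> length r < length (hd (concat As @ T))"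
  by (cases zs) (auto simp: cutting_Nil cutting_Cons)

lemma cutting_unique:
  "cutting As rs zs T \<Longrightarrow> cutting As' rs' zs T' \<Longrightarrow> rs ! 0 = rs' ! 0 \<Longrightarrow> concat As @ T = concat As' @ T'
     \<Longrightarrow> As = As' \<and> rs = rs' \<and> T = T'"
proof (induction zs arbitrary: As rs As' rs')
  case Nil
  then show ?case by (auto simp: cutting_Nil)
next
  case (Cons z zs)
  obtain A Bs r r1 rs1 where 1: "As = A # Bs" "rs = r # r1 # rs1" "A \<noteq> []" "concat A @ r1 = r @ z"
    "cutting Bs (r1 # rs1) zs T" using Cons.prems(1) by (auto simp: cutting_Cons)
  obtain A' Bs' r2 rs2 where 2: "As' = A' # Bs'" "rs' = r # r2 # rs2" "A' \<noteq> []" "concat A' @ r2 = r @ z"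
    "cutting Bs' (r2 # rs2) zs T'" using Cons.prems(2,3) 1(2) by (auto simp: cutting_Cons)
  let ?n = "length r + length z"
  have "full_factors ?n (A @ concat Bs @ T) = A"
    using arg_cong[OF 1(4), of length] cutting_head[OF 1(5)]
    by (intro full_factors_append[where k = "length r1"]) auto
  moreover have "full_factors ?n (A' @ concat Bs' @ T') = A'"
    using arg_cong[OF 2(4), of length] cutting_head[OF 2(5)]
    by (intro full_factors_append[where k = "length r2"]) auto
  moreover have eq: "A @ concat Bs @ T = A' @ concat Bs' @ T'" using Cons.prems(4) 1(1) 2(1) by simp
  ultimately have A: "A = A'" by metis
  then have r: "r1 = r2" using 1(4) 2(4) by (metis same_append_eq)
  have "Bs = Bs' \<and> r1 # rs1 = r2 # rs2 \<and> T = T'"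
    using Cons.IH[OF 1(5) 2(5)] eq A r by simp
  then show ?case using 1 2 A by simp
qed

text \<open>
  Segments that are at least as long as every factor complete at least one factor each.
\<close>
lemma cutting_exists:
  assumes "concat ms = r @ concat zs @ post" "ms \<noteq> []" "length r < length (hd ms)" "post \<noteq> []"
    and "\<forall>z\<in>set zs. L \<le> length z" "\<forall>m\<in>set ms. length m \<le> L"
  shows "\<exists>As rs T. cutting As rs zs T \<and> rs ! 0 = r \<and> ms = concat As @ T"
  using assms
proof (induction zs arbitrary: ms r)
  case Nil
  then show ?case by (intro exI[of _ "[]"] exI[of _ "[r]"] exI[of _ ms]) (auto simp: cutting_Nil)
next
  case (Cons z zs)
  let ?n = "length r + length z"
  have "?n < length (concat ms)" using Cons.prems(1,4) by simp
  then obtain T r' where T: "ms = full_factors ?n ms @ T" "T \<noteq> []" "length r' < length (hd T)"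
    "concat (full_factors ?n ms) @ r' = take ?n (concat ms)"
    using full_factors_split by blast
  define A where "A = full_factors ?n ms"
  have eq: "concat A @ r' = r @ z" using T(4) Cons.prems(1) by (simp add: A_def)
  obtain m ms' where ms: "ms = m # ms'" using Cons.prems(2) by (cases ms) auto
  have "length m \<le> length z" using Cons.prems(5,6) ms by fastforce
  then have hd: "A \<noteq> []" "hd A = m" unfolding A_def ms by auto
  have ms2: "ms = A @ T" using T(1) by (simp add: A_def)
  have "concat A @ concat T = concat A @ r' @ concat zs @ post"
    using Cons.prems(1) unfolding ms2 by (simp flip: eq append_assoc)
  then have cT: "concat T = r' @ concat zs @ post" by simp
  have "\<exists>As rs U. cutting As rs zs U \<and> rs ! 0 = r' \<and> T = concat As @ U"
    by (rule Cons.IH[OF cT T(2,3) Cons.prems(4)]) (use Cons.prems(5,6) ms2 in auto)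
  then obtain As rs U where IH: "cutting As rs zs U" "rs ! 0 = r'" "T = concat As @ U" by blast
  obtain rs' where rs: "rs = r' # rs'" using IH(1,2) by (cases rs) (auto simp: cutting_def)
  have "cutting (A # As) (r # rs) (z # zs) U"
    unfolding cutting_Cons using hd eq IH(1) Cons.prems(3) ms rs by auto
  then show ?case using ms2 IH(3) by (intro exI[of _ "A # As"] exI[of _ "r # rs"] exI[of _ U]) auto
qed

lemma cutting_concat:
  "cutting As rs zs T \<Longrightarrow> concat (concat As) @ rs ! length zs = rs ! 0 @ concat zs"
proof (induction zs arbitrary: As rs)
  case Nil
  then show ?case by (auto simp: cutting_Nil)
next
  case (Cons z zs)
  obtain A Bs r r1 rs1 where 1: "As = A # Bs" "rs = r # r1 # rs1" "concat A @ r1 = r @ z"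
    "cutting Bs (r1 # rs1) zs T" using Cons.prems by (auto simp: cutting_Cons)
  from Cons.IH[OF 1(4)] have "concat (concat Bs) @ rs ! length (z # zs) = r1 @ concat zs"
    using 1(2) by simp
  then show ?case using 1 by (metis append.assoc concat.simps(2) concat_append nth_Cons_0)
qed

text \<open>
  Slots cut at the same residues may be exchanged together with the factors that end in
  them; the residues at all cuts stay the same.
\<close>
lemma cutting_swap:
  assumes "cutting As rs zs T" "i < length zs" "j < length zs"
    and "rs ! i = rs ! j" "rs ! Suc i = rs ! Suc j"
  shows "cutting (swap_at i j As) rs (swap_at i j zs) T"
proof -
  have l: "length As = length zs" using assms(1) by (simp add: cutting_def)
  show ?thesis
    using assms unfolding cutting_def by (auto simp: nth_swap_at l)
qed

text \<open>
  Residues are prefixes of factors; this bounds the number of residues by the polynomial alone.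
\<close>
lemma cutting_residue:
  assumes "cutting As rs zs T" "i < length zs"
  shows "\<exists>m\<in>set (concat As). \<exists>n\<le>length m. rs ! i = take n m"
proof -
  have i: "As ! i \<noteq> []" "length (rs ! i) < length (hd (As ! i))"
    "concat (As ! i) @ rs ! Suc i = rs ! i @ zs ! i" "i < length As"
    using assms by (auto simp: cutting_def)
  then obtain m ms where m: "As ! i = m # ms" by (cases "As ! i") auto
  have "m @ concat ms @ rs ! Suc i = rs ! i @ zs ! i" using i(3) m by simp
  then have "rs ! i = take (length (rs ! i)) m"
    using i(2) m by (auto simp: append_eq_append_conv_if)
  moreover have "m \<in> set (concat As)" using nth_mem[OF i(4)] unfolding m by (auto intro!: bexI[of _ "m # ms"])
  ultimately show ?thesis using i(2) m by (metis less_imp_le list.sel(1))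
qed

lemma cutting_last_residue:
  assumes "cutting As rs zs T" "concat T = rs ! length zs @ u"
  shows "\<exists>m\<in>set T. \<exists>n\<le>length m. rs ! length zs = take n m"
proof -
  have T: "T \<noteq> []" "length (rs ! length zs) < length (hd T)" using assms(1) by (auto simp: cutting_def)
  then obtain m ms where m: "T = m # ms" by (cases T) auto
  have "m @ concat ms = rs ! length zs @ u" using assms(2) m by simp
  then have "rs ! length zs = take (length (rs ! length zs)) m"
    using T(2) m by (auto simp: append_eq_append_conv_if)
  then show ?thesis using T(2) m by (metis less_imp_le list.sel(1) list.set_intros(1))
qed

section \<open>Cancellation along factorizations\<close>

text \<open>
  The total of the gaps is fixed, so that all words in the support of the functional have the same
  degree in both letters.
\<close>
definition gap_seqs :: "nat \<Rightarrow> nat list set" where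
  "gap_seqs J = {cs. length cs = 2 ^ lev J \<and> set cs \<subseteq> {1, 2}
     \<and> sum_list cs = sum_list (map paperfold [1..<2 ^ lev J + 1])}"

definition signed_words :: "nat \<Rightarrow> int \<Rightarrow> nat list set" where
  "signed_words J e = gap_word ` {cs \<in> gap_seqs J. Phi J cs = e}"

lemma finite_signed_words: "finite (signed_words J e)"
proof -
  have "finite {cs. set cs \<subseteq> {1, 2::nat} \<and> length cs = 2 ^ lev J}"
    by (rule finite_lists_length_eq) simp
  then have "finite (gap_seqs J)"
    by (rule finite_subset[rotated]) (auto simp: gap_seqs_def)
  then show ?thesis unfolding signed_words_def by simp
qed

definition factorizations ::
    "nat list set \<Rightarrow> nat \<Rightarrow> nat list set \<Rightarrow> nat list list set" where
  "factorizations S N W = {ms. length ms = N \<and> set ms \<subseteq> S \<and> concat ms \<in> W}"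

text \<open>
  A pair of slots cut at equal residues. Slot \<open>i\<close> is segment \<open>i + 1\<close> of a cutting, segment \<open>0\<close> being
  what precedes the slots. The pair is a function of the residues alone; since these do not
  change in an exchange, exchanging twice leads back.
\<close>
definition pick :: "nat \<Rightarrow> nat list list \<Rightarrow> nat \<times> nat" where
  "pick q rs = (SOME ii. fst ii < snd ii \<and> snd ii < q
     \<and> rs ! Suc (fst ii) = rs ! Suc (snd ii) \<and> rs ! Suc (Suc (fst ii)) = rs ! Suc (Suc (snd ii)))"

lemma pick_props:
  assumes "i < i'" "i' < q" "rs ! Suc i = rs ! Suc i'" "rs ! Suc (Suc i) = rs ! Suc (Suc i')"
    and "pick q rs = (a, b)"
  shows "a < b" "b < q" "rs ! Suc a = rs ! Suc b" "rs ! Suc (Suc a) = rs ! Suc (Suc b)"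
proof -
  have "fst (pick q rs) < snd (pick q rs) \<and> snd (pick q rs) < q
     \<and> rs ! Suc (fst (pick q rs)) = rs ! Suc (snd (pick q rs))
     \<and> rs ! Suc (Suc (fst (pick q rs))) = rs ! Suc (Suc (snd (pick q rs)))"
    unfolding pick_def by (rule someI[of _ "(i, i')"]) (use assms(1-4) in \<open>simp only: fst_conv snd_conv simp_thms\<close>)
  then show "a < b" "b < q" "rs ! Suc a = rs ! Suc b" "rs ! Suc (Suc a) = rs ! Suc (Suc b)"
    using assms(5) by auto
qed

text \<open>
  The exchange takes place in the block whose position is determined by the context \<open>x\<close>, so
  that a factorization and its image are treated in the same block.
\<close>
definition exchange ::
    "nat \<Rightarrow> nat list \<Rightarrow> nat list \<Rightarrow> nat list list \<Rightarrow> nat list list \<Rightarrow> bool" where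
  "exchange j x y ms ms' \<longleftrightarrow> (\<exists>p ds s v As rs T a b.
     x @ concat ms @ y = gap_word (p @ concat ds @ s)
     \<and> length p = (count_list x 0 div 2 ^ lev (Suc j) + 2) * 2 ^ lev (Suc j)
     \<and> length ds = 2 ^ j \<and> (\<forall>d\<in>set ds. length d = slot_len j * 2 ^ lev j)
     \<and> gap_word p = x @ v
     \<and> cutting As rs (v # map gap_word ds) T \<and> rs ! 0 = [] \<and> ms = concat As @ T
     \<and> pick (2 ^ j) rs = (a, b) \<and> a < b \<and> b < 2 ^ j
     \<and> rs ! Suc a = rs ! Suc b \<and> rs ! Suc (Suc a) = rs ! Suc (Suc b)
     \<and> ms' = concat (swap_at (Suc a) (Suc b) As) @ T)"

lemma exchangeI:
  assumes "x @ concat ms @ y = gap_word (p @ concat ds @ s)"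
    and "length p = (count_list x 0 div 2 ^ lev (Suc j) + 2) * 2 ^ lev (Suc j)"
    and "length ds = 2 ^ j" and "\<forall>d\<in>set ds. length d = slot_len j * 2 ^ lev j"
    and "gap_word p = x @ v"
    and "cutting As rs (v # map gap_word ds) T" and "rs ! 0 = []" and "ms = concat As @ T"
    and "pick (2 ^ j) rs = (a, b)" and "a < b" and "b < 2 ^ j"
    and "rs ! Suc a = rs ! Suc b" and "rs ! Suc (Suc a) = rs ! Suc (Suc b)"
    and "ms' = concat (swap_at (Suc a) (Suc b) As) @ T"
  shows "exchange j x y ms ms'"
  unfolding exchange_def
  by (rule exI[of _ p], rule exI[of _ ds], rule exI[of _ s], rule exI[of _ v],
      rule exI[of _ As], rule exI[of _ rs], rule exI[of _ T], rule exI[of _ a], rule exI[of _ b])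
    (intro conjI assms)

lemma concat_eq_blocks:
  "length xs = length ys \<Longrightarrow> \<forall>x\<in>set xs. length x = n \<Longrightarrow> \<forall>y\<in>set ys. length y = n
     \<Longrightarrow> concat xs @ s = concat ys @ t \<Longrightarrow> xs = ys \<and> s = t"
  by (induction xs ys rule: list_induct2) auto

text \<open>
  The gaps can be read off from the word, the slots from their lengths, and the cutting from its
  first residue.
\<close>
lemma exchange_unique:
  assumes "exchange j x y ms ms1" "exchange j x y ms ms2"
  shows "ms1 = ms2"
proof -
  obtain p ds s v As rs T a b where 1:
    "x @ concat ms @ y = gap_word (p @ concat ds @ s)"
    "length p = (count_list x 0 div 2 ^ lev (Suc j) + 2) * 2 ^ lev (Suc j)"
    "length ds = 2 ^ j" "\<forall>d\<in>set ds. length d = slot_len j * 2 ^ lev j" "gap_word p = x @ v"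
    "cutting As rs (v # map gap_word ds) T" "rs ! 0 = []" "ms = concat As @ T"
    "pick (2 ^ j) rs = (a, b)" "ms1 = concat (swap_at (Suc a) (Suc b) As) @ T"
    using assms(1) unfolding exchange_def by blast
  obtain p' ds' s' v' As' rs' T' a' b' where 2:
    "x @ concat ms @ y = gap_word (p' @ concat ds' @ s')"
    "length p' = (count_list x 0 div 2 ^ lev (Suc j) + 2) * 2 ^ lev (Suc j)"
    "length ds' = 2 ^ j" "\<forall>d\<in>set ds'. length d = slot_len j * 2 ^ lev j" "gap_word p' = x @ v'"
    "cutting As' rs' (v' # map gap_word ds') T'" "rs' ! 0 = []" "ms = concat As' @ T'"
    "pick (2 ^ j) rs' = (a', b')" "ms2 = concat (swap_at (Suc a') (Suc b') As') @ T'"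
    using assms(2) unfolding exchange_def by blast
  have "p @ concat ds @ s = p' @ concat ds' @ s'"
    by (rule gap_word_inject[OF trans[OF 1(1)[symmetric] 2(1)]])
  then have p: "p = p'" "concat ds @ s = concat ds' @ s'"
    using trans[OF 1(2) 2(2)[symmetric]] by simp_all
  have ds: "ds = ds'" using concat_eq_blocks[OF trans[OF 1(3) 2(3)[symmetric]] 1(4) 2(4) p(2)] by simp
  have v: "v = v'" using trans[OF 1(5)[symmetric] 2(5)[folded p(1)]] by simp
  have 3: "cutting As' rs' (v # map gap_word ds) T'" unfolding ds v by (rule 2(6))
  have eq: "As = As' \<and> rs = rs' \<and> T = T'"
  proof (rule cutting_unique[OF 1(6) 3])
    show "rs ! 0 = rs' ! 0" unfolding 1(7) 2(7) ..
    show "concat As @ T = concat As' @ T'" by (rule trans[OF 1(8)[symmetric] 2(8)])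
  qed
  then have "(a, b) = (a', b')" using trans[OF 1(9)[symmetric]] 2(9) by metis
  then show ?thesis unfolding 1(10) 2(10) using eq by simp
qed

lemma swap_at_Suc_Cons: "swap_at (Suc i) (Suc j) (z # zs) = z # swap_at i j zs"
  by (simp add: swap_at_def)

lemma exchange_props:
  assumes "exchange j x y ms ms'"
  shows "exchange j x y ms' ms" "mset ms' = mset ms"
    and "\<exists>p ds s i i'. x @ concat ms @ y = gap_word (p @ concat ds @ s)
      \<and> x @ concat ms' @ y = gap_word (p @ concat (swap_at i i' ds) @ s)
      \<and> length p = (count_list x 0 div 2 ^ lev (Suc j) + 2) * 2 ^ lev (Suc j)
      \<and> length ds = 2 ^ j \<and> (\<forall>d\<in>set ds. length d = slot_len j * 2 ^ lev j) \<and> i < i' \<and> i' < 2 ^ j"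
proof -
  obtain p ds s v As rs T a b where 1:
    "x @ concat ms @ y = gap_word (p @ concat ds @ s)"
    "length p = (count_list x 0 div 2 ^ lev (Suc j) + 2) * 2 ^ lev (Suc j)"
    "length ds = 2 ^ j" "\<forall>d\<in>set ds. length d = slot_len j * 2 ^ lev j" "gap_word p = x @ v"
    and 2: "cutting As rs (v # map gap_word ds) T" "rs ! 0 = []" "ms = concat As @ T"
    and ab: "pick (2 ^ j) rs = (a, b)" "a < b" "b < 2 ^ j"
    "rs ! Suc a = rs ! Suc b" "rs ! Suc (Suc a) = rs ! Suc (Suc b)"
    and ms': "ms' = concat (swap_at (Suc a) (Suc b) As) @ T"
    using assms unfolding exchange_def by blast
  have ids: "a < length ds" "b < length ds" using ab(2,3) 1(3) by auto
  have lAs: "length As = Suc (2 ^ j)" using 2(1) 1(3) by (simp add: cutting_def)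
  have iAs: "Suc a < length As" "Suc b < length As" using ab(2,3) lAs by auto
  have seg': "cutting (swap_at (Suc a) (Suc b) As) rs (v # map gap_word (swap_at a b ds)) T"
  proof -
    have "cutting (swap_at (Suc a) (Suc b) As) rs (swap_at (Suc a) (Suc b) (v # map gap_word ds)) T"
      by (rule cutting_swap[OF 2(1)]) (use ids ab(4,5) in auto)
    then show ?thesis by (simp add: swap_at_Suc_Cons map_swap_at[OF ids])
  qed
  let ?r = "rs ! Suc (length ds)"
  have c: "concat (concat As) @ ?r = v @ gap_word (concat ds)"
    using cutting_concat[OF 2(1)] 2(2) by (simp add: gap_word_concat)
  have c': "concat (concat (swap_at (Suc a) (Suc b) As)) @ ?r = v @ gap_word (concat (swap_at a b ds))"
    using cutting_concat[OF seg'] 2(2) by (simp add: gap_word_concat)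
  have "concat (concat As) @ concat T @ y = v @ gap_word (concat ds) @ gap_word s"
    using 1(1,5) 2(3) by simp
  also have "\<dots> = concat (concat As) @ ?r @ gap_word s" using c by (metis append.assoc)
  finally have T: "concat T @ y = ?r @ gap_word s" by simp
  have "concat ms' @ y = concat (concat (swap_at (Suc a) (Suc b) As)) @ ?r @ gap_word s"
    unfolding ms' using T by simp
  also have "\<dots> = v @ gap_word (concat (swap_at a b ds)) @ gap_word s" using c' by (metis append.assoc)
  finally have word': "x @ concat ms' @ y = gap_word (p @ concat (swap_at a b ds) @ s)"
    using 1(5) by simp
  have ds': "\<forall>d\<in>set (swap_at a b ds). length d = slot_len j * 2 ^ lev j"
    unfolding set_swap_at[OF ids] by (rule 1(4))
  show "exchange j x y ms' ms"
  proof (rule exchangeI[OF word' 1(2) _ ds' 1(5) seg' 2(2) ms' ab])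
    show "length (swap_at a b ds) = 2 ^ j" using 1(3) by simp
    show "ms = concat (swap_at (Suc a) (Suc b) (swap_at (Suc a) (Suc b) As)) @ T"
      unfolding swap_at_swap_at[OF iAs] by (rule 2(3))
  qed
  show "mset ms' = mset ms"
  proof -
    have mc: "mset (concat Bs) = sum_list (map mset Bs)" for Bs :: "nat list list list"
      by (induction Bs) auto
    have "mset (concat (swap_at (Suc a) (Suc b) As)) = mset (concat As)"
      unfolding mc by (metis mset_map mset_swap_at[OF iAs] sum_mset_sum_list)
    then show ?thesis unfolding ms' 2(3) by simp
  qed
  show "\<exists>p ds s i i'. x @ concat ms @ y = gap_word (p @ concat ds @ s)
      \<and> x @ concat ms' @ y = gap_word (p @ concat (swap_at i i' ds) @ s)
      \<and> length p = (count_list x 0 div 2 ^ lev (Suc j) + 2) * 2 ^ lev (Suc j)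
      \<and> length ds = 2 ^ j \<and> (\<forall>d\<in>set ds. length d = slot_len j * 2 ^ lev j) \<and> i < i' \<and> i' < 2 ^ j"
    using 1 word' ab(2,3) by blast
qed

text \<open>
  The part \<open>p\<close> in front of the block is at least as long as a block of stage \<open>j + 1\<close>, so the stage \<open>j\<close>
  lies below \<open>J\<close>, as the sign rule requires.
\<close>
lemma exchange_signed_words:
  assumes "exchange j x y ms ms'" "x @ concat ms @ y \<in> signed_words J e"
  shows "x @ concat ms' @ y \<in> signed_words J (- e)"
proof -
  obtain p ds s i i' where 1: "x @ concat ms @ y = gap_word (p @ concat ds @ s)"
    "x @ concat ms' @ y = gap_word (p @ concat (swap_at i i' ds) @ s)"
    "length p = (count_list x 0 div 2 ^ lev (Suc j) + 2) * 2 ^ lev (Suc j)"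
    "length ds = 2 ^ j" "\<forall>d\<in>set ds. length d = slot_len j * 2 ^ lev j" "i < i'" "i' < 2 ^ j"
    using exchange_props(3)[OF assms(1)] by blast
  let ?cs = "p @ concat ds @ s" and ?cs' = "p @ concat (swap_at i i' ds) @ s"
  from assms(2) obtain cs where cs: "cs \<in> gap_seqs J" "Phi J cs = e" "gap_word cs = gap_word ?cs"
    unfolding signed_words_def 1(1) by auto
  have "cs = ?cs" by (rule gap_word_inject[OF cs(3)])
  then have C: "?cs \<in> gap_seqs J" "Phi J ?cs = e" using cs by auto
  then have len: "length ?cs = 2 ^ lev J" by (simp add: gap_seqs_def)
  have j: "j < J"
  proof -
    have "(2::nat) ^ lev (Suc j) \<le> length p" unfolding 1(3) by simp
    also have "\<dots> \<le> 2 ^ lev J" using len by simp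
    finally have le: "(2::nat) ^ lev (Suc j) \<le> 2 ^ lev J" .
    have "1 < (2::nat)" by simp
    from power_le_imp_le_exp[OF this le] have "Suc j \<le> J" by (rule lev_le_cancel)
    then show ?thesis by simp
  qed
  have "Phi J ?cs' = - e"
    using Phi_swap[OF 1(5,4,6,7) j 1(3) len] C(2) by simp
  moreover have "?cs' \<in> gap_seqs J"
  proof -
    have ii: "i < length ds" "i' < length ds" using 1(4,6,7) by auto
    have mc: "mset (concat Bs) = sum_list (map mset Bs)" for Bs :: "nat list list"
      by (induction Bs) auto
    have "mset (concat (swap_at i i' ds)) = mset (concat ds)"
      unfolding mc by (metis mset_map mset_swap_at[OF ii] sum_mset_sum_list)
    then have m: "mset ?cs' = mset ?cs" by simp
    have "length ?cs' = length ?cs" "set ?cs' = set ?cs" "sum_list ?cs' = sum_list ?cs"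
      using m by (metis size_mset, metis set_mset_mset, metis sum_mset_sum_list)
    then show ?thesis using C(1) unfolding gap_seqs_def by simp
  qed
  ultimately show ?thesis unfolding signed_words_def 1(2) by blast
qed

text \<open>
  The window contains a complete block, and \<open>2 ^ j\<close> slots are more than there are pairs of
  residues.
\<close>
lemma exchange_exists:
  assumes S: "finite S" "[] \<notin> S"
    and P: "P = (\<lambda>(m, n). take n m) ` (SIGMA m:S. {..length m})"
    and j: "card P * card P < 2 ^ j" "\<forall>m\<in>S. length m \<le> slot_len j"
    and ms: "set ms \<subseteq> S" "9 * 2 ^ lev (Suc j) + 3 \<le> length ms" "x @ concat ms @ y \<in> signed_words J e"
  shows "\<exists>ms'. exchange j x y ms ms'"
proof -
  let ?K = "2 ^ lev (Suc j) :: nat" and ?sl = "slot_len j * 2 ^ lev j"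
  from ms(3) obtain cs where cs: "cs \<in> gap_seqs J" "gap_word cs = x @ concat ms @ y"
    unfolding signed_words_def by auto
  have S12: "set cs \<subseteq> {1, 2}" using cs(1) by (simp add: gap_seqs_def)
  have "length ms \<le> length (concat ms)" if "[] \<notin> set ms" for ms :: "nat list list"
    using that by (induction ms) (auto simp: Suc_le_eq intro!: add_le_mono[of 1, simplified])
  then have "length ms \<le> length (concat ms)" using S(2) ms(1) by blast
  then have len: "9 * ?K + 3 \<le> length (concat ms)" using ms(2) by linarith
  obtain p bl s v v2 where w: "cs = p @ bl @ s" "length p = (count_list x 0 div ?K + 2) * ?K" "length bl = ?K"
    "gap_word p = x @ v" "concat ms = v @ gap_word bl @ v2" "v2 \<noteq> []" "?K \<le> length v"
    using window_contains_block[OF cs(2) S12 _ len] by auto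
  define ds s' where "ds = chop ?sl (take (2 ^ j * ?sl) bl)" and "s' = drop (2 ^ j * ?sl) bl"
  have slK: "2 ^ j * ?sl < ?K" by (rule slots_fit)
  have l: "length (take (2 ^ j * ?sl) bl) = 2 ^ j * ?sl" using slK w(3) by simp
  have slpos: "?sl > 0" by simp
  have "concat (chop n xs) = xs \<and> (\<forall>d\<in>set (chop n xs). length d = n)" if "n > 0" "length xs = k * n"
    for n k and xs :: "nat list"
    using that(2)
  proof (induction k arbitrary: xs)
    case (Suc k)
    have "chop n xs = take n xs # chop n (drop n xs)"
      using Suc.prems \<open>n > 0\<close> by (subst chop.simps) auto
    then show ?case using Suc.IH[of "drop n xs"] Suc.prems by simp
  qed simp
  from this[OF slpos l] have ds: "concat ds = take (2 ^ j * ?sl) bl" "\<forall>d\<in>set ds. length d = ?sl"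
    unfolding ds_def by auto
  have lds: "length ds = 2 ^ j" unfolding ds_def by (rule length_chop[OF l slpos])
  have bl: "bl = concat ds @ s'" unfolding ds(1) s'_def by simp
  \<comment> \<open>The part \<open>v\<close> in front of the block is cut as segment \<open>0\<close> with empty residue.\<close>
  have cms: "concat ms = [] @ concat (v # map gap_word ds) @ gap_word s' @ v2"
    using w(5) unfolding bl by (simp add: gap_word_concat)
  have slj: "slot_len j \<le> ?sl" by simp
  have "\<exists>As rs T. cutting As rs (v # map gap_word ds) T \<and> rs ! 0 = [] \<and> ms = concat As @ T"
  proof (rule cutting_exists[OF cms])
    show "ms \<noteq> []" using ms(2) by auto
    then show "length [] < length (hd ms)" using S(2) ms(1) by (cases ms) auto
    show "gap_word s' @ v2 \<noteq> []" using w(6) by simp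
    show "\<forall>m\<in>set ms. length m \<le> slot_len j" using j(2) ms(1) by auto
    show "\<forall>z\<in>set (v # map gap_word ds). slot_len j \<le> length z"
    proof -
      have "?sl \<le> 2 ^ j * ?sl" by simp
      then have "slot_len j \<le> length v" using slK slj w(7) by linarith
      moreover have "slot_len j \<le> length (gap_word d)" if "d \<in> set ds" for d
      proof -
        have "length d = ?sl" using ds(2) that by blast
        then show ?thesis using slj length_le_gap_word[of d] by linarith
      qed
      ultimately show ?thesis by auto
    qed
  qed
  then obtain As rs T where seg: "cutting As rs (v # map gap_word ds) T" "rs ! 0 = []" "ms = concat As @ T" by blast
  have fP: "finite P" unfolding P using S(1) by auto
  have inP: "take n m \<in> P" if "m \<in> S" "n \<le> length m" for n m using that unfolding P by force
  have lz: "length (v # map gap_word ds) = Suc (2 ^ j)" using lds by simp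
  have cT: "concat T = rs ! length (v # map gap_word ds) @ gap_word s' @ v2"
  proof -
    have "concat (concat As) @ concat T = concat (concat As) @ rs ! length (v # map gap_word ds) @ gap_word s' @ v2"
      using cutting_concat[OF seg(1)] cms seg(2,3) by (metis append.assoc append_Nil concat_append)
    then show ?thesis by simp
  qed
  have rP: "rs ! i \<in> P" if "i \<le> Suc (2 ^ j)" for i
  proof (cases "i < Suc (2 ^ j)")
    case True
    then show ?thesis using cutting_residue[OF seg(1), of i] lz ms(1) seg(3) inP by fastforce
  next
    case False
    then have "i = length (v # map gap_word ds)" using that lz by simp
    then show ?thesis using cutting_last_residue[OF seg(1) cT] ms(1) seg(3) inP by fastforce
  qed
  let ?f = "\<lambda>i. (rs ! Suc i, rs ! Suc (Suc i))"
  have "?f ` {..<2 ^ j} \<subseteq> P \<times> P" using rP by auto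
  then have "card (?f ` {..<2 ^ j}) \<le> card (P \<times> P)" using fP by (intro card_mono) auto
  then have "card (?f ` {..<2 ^ j}) < card {..<(2::nat) ^ j}"
    using j(1) by (simp add: card_cartesian_product)
  then have "\<not> inj_on ?f {..<2 ^ j}" by (rule pigeonhole)
  then obtain i i' where "i < i'" "i' < 2 ^ j" "?f i = ?f i'"
    unfolding inj_on_def by (metis lessThan_iff linorder_neqE_nat)
  then have ii: "i < i'" "i' < 2 ^ j" "rs ! Suc i = rs ! Suc i'" "rs ! Suc (Suc i) = rs ! Suc (Suc i')" by auto
  obtain a b where ab: "pick (2 ^ j) rs = (a, b)" by fastforce
  note pk = pick_props[OF ii ab]
  have "exchange j x y ms (concat (swap_at (Suc a) (Suc b) As) @ T)"
  proof (rule exchangeI[OF _ w(2) lds ds(2) w(4) seg ab pk refl])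
    show "x @ concat ms @ y = gap_word (p @ concat ds @ s' @ s)"
      using cs(2) w(1) bl by simp
  qed
  then show ?thesis by blast
qed

text \<open>
  The involution \<open>exchange\<close> pairs the factorizations of words of sign \<open>1\<close> with those of words of
  sign \<open>-1\<close>. The bound \<open>N\<close> depends only on the set of monomials, not on the context or on the
  functional.
\<close>
theorem factorizations_cancel:
  assumes "finite S" "[] \<notin> S"
  shows "\<exists>N>0. \<forall>J x y. \<exists>h.
    bij_betw h (factorizations S N {w. x @ w @ y \<in> signed_words J 1})
               (factorizations S N {w. x @ w @ y \<in> signed_words J (- 1)})
    \<and> (\<forall>ms. ms \<in> factorizations S N {w. x @ w @ y \<in> signed_words J 1} \<longrightarrow> mset (h ms) = mset ms)"
proof -
  define P where "P = (\<lambda>(m, n). take n m) ` (SIGMA m:S. {..length m})"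
  define L where "L = Max (insert 0 (length ` S))"
  have L: "\<forall>m\<in>S. length m \<le> L" unfolding L_def using assms(1) by (auto intro!: Max_ge)
  \<comment> \<open>A stage with enough slots for the pigeonhole principle whose slots are longer than all monomials.\<close>
  define j where "j = card P * card P + L"
  have j: "card P * card P < 2 ^ j" "\<forall>m\<in>S. length m \<le> slot_len j"
  proof -
    have "j < 2 ^ j" by simp
    then show "card P * card P < 2 ^ j" unfolding j_def by linarith
    have "(2::nat) ^ j \<le> 2 ^ (j + 2)" by (rule power_increasing) auto
    then have "L \<le> slot_len j" using \<open>j < 2 ^ j\<close> unfolding slot_len_def j_def by linarith
    then show "\<forall>m\<in>S. length m \<le> slot_len j" using L by fastforce
  qed
  define N where "N = 9 * 2 ^ lev (Suc j) + (3::nat)"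
  have main: "\<exists>h. bij_betw h (factorizations S N {w. x @ w @ y \<in> signed_words J 1})
               (factorizations S N {w. x @ w @ y \<in> signed_words J (- 1)})
    \<and> (\<forall>ms. ms \<in> factorizations S N {w. x @ w @ y \<in> signed_words J 1} \<longrightarrow> mset (h ms) = mset ms)" for J x y
  proof -
    let ?F = "\<lambda>e. factorizations S N {w. x @ w @ y \<in> signed_words J e}"
    define h where "h ms = (THE ms'. exchange j x y ms ms')" for ms
    have h: "exchange j x y ms (h ms)" if "ms \<in> ?F e" for ms e
    proof -
      have "\<exists>ms'. exchange j x y ms ms'"
        by (rule exchange_exists[OF assms P_def j]) (use that in \<open>auto simp: factorizations_def N_def\<close>)
      then have "\<exists>!ms'. exchange j x y ms ms'" using exchange_unique by blast
      then show ?thesis unfolding h_def by (rule theI')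
    qed
    have F: "h ms \<in> ?F (- e)" if "ms \<in> ?F e" for ms e
    proof -
      have "mset (h ms) = mset ms" by (rule exchange_props(2)[OF h[OF that]])
      then have "length (h ms) = length ms" "set (h ms) = set ms"
        by (metis size_mset, metis set_mset_mset)
      then show ?thesis
        using that exchange_signed_words[OF h[OF that]] by (auto simp: factorizations_def)
    qed
    have hh: "h (h ms) = ms" if "ms \<in> ?F e" for ms e
      using exchange_unique[OF h[OF F[OF that]] exchange_props(1)[OF h[OF that]]] .
    have "bij_betw h (?F 1) (?F (- 1))"
      by (rule bij_betw_byWitness[where f' = h]) (use hh F[of _ 1] F[of _ "- 1"] in auto)
    then show ?thesis using exchange_props(2)[OF h] by blast
  qed
  show ?thesis by (intro exI[of _ N] conjI allI main) (simp add: N_def)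
qed

section \<open>The free algebra on words\<close>

text \<open>
  The product of the free algebra, the sum over all ways to split the word. The first summand is
  the split with empty left part; the recursion passes to the derivative of the left factor by
  the first letter.
\<close>
fun conv :: "('f, 'm) ring_scheme \<Rightarrow> (nat list \<Rightarrow> 'f) \<Rightarrow> (nat list \<Rightarrow> 'f) \<Rightarrow> nat list \<Rightarrow> 'f" where
  "conv F f g [] = f [] \<otimes>\<^bsub>F\<^esub> g []"
| "conv F f g (c # w) = f [] \<otimes>\<^bsub>F\<^esub> g (c # w) \<oplus>\<^bsub>F\<^esub> conv F (\<lambda>v. f (c # v)) g w"

definition free_alg :: "('f, 'm) ring_scheme \<Rightarrow> (nat list \<Rightarrow> 'f) ring" where
  "free_alg F =
     \<lparr>carrier = {f. (\<forall>w. f w \<in> carrier F) \<and> finite {w. f w \<noteq> \<zero>\<^bsub>F\<^esub>}},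
      monoid.mult = conv F,
      one = (\<lambda>w. if w = [] then \<one>\<^bsub>F\<^esub> else \<zero>\<^bsub>F\<^esub>),
      zero = (\<lambda>w. \<zero>\<^bsub>F\<^esub>),
      add = (\<lambda>f g w. f w \<oplus>\<^bsub>F\<^esub> g w)\<rparr>"

definition single :: "('f, 'm) ring_scheme \<Rightarrow> 'f \<Rightarrow> nat list \<Rightarrow> nat list \<Rightarrow> 'f" where
  "single F c u = (\<lambda>w. if w = u then c else \<zero>\<^bsub>F\<^esub>)"

context cring
begin

lemma conv_closed:
  "(\<And>w. f w \<in> carrier R) \<Longrightarrow> (\<And>w. g w \<in> carrier R) \<Longrightarrow> conv R f g w \<in> carrier R"
  by (induction w arbitrary: f) auto

lemma conv_add_left:
  "(\<And>w. f w \<in> carrier R) \<Longrightarrow> (\<And>w. f' w \<in> carrier R) \<Longrightarrow> (\<And>w. g w \<in> carrier R)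
     \<Longrightarrow> conv R (\<lambda>v. f v \<oplus> f' v) g w = conv R f g w \<oplus> conv R f' g w"
proof (induction w arbitrary: f f')
  case (Cons c w)
  have "conv R (\<lambda>v. f (c # v) \<oplus> f' (c # v)) g w
      = conv R (\<lambda>v. f (c # v)) g w \<oplus> conv R (\<lambda>v. f' (c # v)) g w"
    by (rule Cons.IH) (use Cons.prems in auto)
  then show ?case using Cons.prems by (simp add: l_distr conv_closed a_ac)
qed (simp add: l_distr)

lemma conv_add_right:
  "(\<And>w. f w \<in> carrier R) \<Longrightarrow> (\<And>w. g w \<in> carrier R) \<Longrightarrow> (\<And>w. g' w \<in> carrier R)
     \<Longrightarrow> conv R f (\<lambda>v. g v \<oplus> g' v) w = conv R f g w \<oplus> conv R f g' w"
proof (induction w arbitrary: f)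
  case (Cons c w)
  have "conv R (\<lambda>v. f (c # v)) (\<lambda>v. g v \<oplus> g' v) w
      = conv R (\<lambda>v. f (c # v)) g w \<oplus> conv R (\<lambda>v. f (c # v)) g' w"
    by (rule Cons.IH) (use Cons.prems in auto)
  then show ?case using Cons.prems by (simp add: r_distr conv_closed a_ac)
qed (simp add: r_distr)

lemma conv_scale_left:
  "a \<in> carrier R \<Longrightarrow> (\<And>w. f w \<in> carrier R) \<Longrightarrow> (\<And>w. g w \<in> carrier R)
     \<Longrightarrow> conv R (\<lambda>v. a \<otimes> f v) g w = a \<otimes> conv R f g w"
proof (induction w arbitrary: f)
  case (Cons c w)
  have "conv R (\<lambda>v. a \<otimes> f (c # v)) g w = a \<otimes> conv R (\<lambda>v. f (c # v)) g w"
    by (rule Cons.IH) (use Cons.prems in auto)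
  then show ?case using Cons.prems by (simp add: r_distr conv_closed m_assoc)
qed (simp add: m_assoc)

lemma conv_zero_left: "(\<And>w. g w \<in> carrier R) \<Longrightarrow> conv R (\<lambda>w. \<zero>) g w = \<zero>"
  by (induction w) auto

lemma conv_zero_right: "(\<And>w. f w \<in> carrier R) \<Longrightarrow> conv R f (\<lambda>w. \<zero>) w = \<zero>"
  by (induction w arbitrary: f) auto

lemma conv_one_left:
  "(\<And>w. g w \<in> carrier R) \<Longrightarrow> conv R (\<lambda>w. if w = [] then \<one> else \<zero>) g w = g w"
  by (cases w) (auto simp: conv_zero_left)

lemma conv_one_right:
  "(\<And>w. f w \<in> carrier R) \<Longrightarrow> conv R f (\<lambda>w. if w = [] then \<one> else \<zero>) w = f w"
  by (induction w arbitrary: f) auto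

lemma conv_assoc:
  "(\<And>w. f w \<in> carrier R) \<Longrightarrow> (\<And>w. g w \<in> carrier R) \<Longrightarrow> (\<And>w. h w \<in> carrier R)
     \<Longrightarrow> conv R (conv R f g) h w = conv R f (conv R g h) w"
proof (induction w arbitrary: f g)
  case Nil
  then show ?case by (simp add: m_assoc)
next
  case (Cons c w)
  let ?f = "\<lambda>v. f (c # v)" and ?g = "\<lambda>v. g (c # v)"
  have "conv R (\<lambda>v. conv R f g (c # v)) h w = conv R (\<lambda>v. f [] \<otimes> ?g v \<oplus> conv R ?f g v) h w"
    by simp
  also have "\<dots> = conv R (\<lambda>v. f [] \<otimes> ?g v) h w \<oplus> conv R (conv R ?f g) h w"
    by (rule conv_add_left) (use Cons.prems in \<open>auto simp: conv_closed\<close>)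
  also have "\<dots> = f [] \<otimes> conv R ?g h w \<oplus> conv R ?f (conv R g h) w"
  proof -
    have "conv R (conv R ?f g) h w = conv R ?f (conv R g h) w"
      by (rule Cons.IH) (use Cons.prems in auto)
    then show ?thesis using Cons.prems by (simp add: conv_scale_left)
  qed
  finally show ?case
    using Cons.prems by (simp add: r_distr conv_closed m_assoc a_assoc)
qed

lemma conv_nonzero:
  "conv R f g w \<noteq> \<zero> \<Longrightarrow> (\<And>w. f w \<in> carrier R) \<Longrightarrow> (\<And>w. g w \<in> carrier R)
     \<Longrightarrow> \<exists>u v. w = u @ v \<and> f u \<noteq> \<zero> \<and> g v \<noteq> \<zero>"
proof (induction w arbitrary: f)
  case Nil
  then have "f [] \<noteq> \<zero> \<and> g [] \<noteq> \<zero>" by auto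
  then show ?case by (intro exI[of _ "[]"]) simp
next
  case (Cons c w)
  show ?case
  proof (cases "conv R (\<lambda>v. f (c # v)) g w = \<zero>")
    case True
    then have "f [] \<noteq> \<zero> \<and> g (c # w) \<noteq> \<zero>" using Cons.prems by auto
    then show ?thesis by (intro exI[of _ "[]"] exI[of _ "c # w"]) simp
  next
    case False
    then obtain u v where "w = u @ v" "f (c # u) \<noteq> \<zero>" "g v \<noteq> \<zero>"
      using Cons.IH[of "\<lambda>v. f (c # v)"] Cons.prems by blast
    then show ?thesis by (intro exI[of _ "c # u"] exI[of _ v]) simp
  qed
qed

text \<open>
  When only one splitting of a word meets both supports, the coefficient is a single product.
  This computes products with monomials and, later, the coefficients of leading words.
\<close>
lemma conv_unique_split:
  "(\<And>w. f w \<in> carrier R) \<Longrightarrow> (\<And>w. g w \<in> carrier R)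
     \<Longrightarrow> (\<And>u' v'. u @ v = u' @ v' \<Longrightarrow> f u' \<noteq> \<zero> \<Longrightarrow> g v' \<noteq> \<zero> \<Longrightarrow> u' = u)
     \<Longrightarrow> conv R f g (u @ v) = f u \<otimes> g v"
proof (induction u arbitrary: f)
  case Nil
  show ?case
  proof (cases v)
    case (Cons c w)
    have "conv R (\<lambda>v. f (c # v)) g w = \<zero>"
    proof (rule ccontr)
      assume "conv R (\<lambda>v. f (c # v)) g w \<noteq> \<zero>"
      then obtain u1 v1 where "w = u1 @ v1" "f (c # u1) \<noteq> \<zero>" "g v1 \<noteq> \<zero>"
        using conv_nonzero[of "\<lambda>v. f (c # v)" g w] Nil.prems(1,2) by blast
      then show False using Nil.prems(3)[of "c # u1" v1] Cons by simp
    qed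
    then show ?thesis using Cons Nil.prems by simp
  qed simp
next
  case (Cons c u)
  have "f [] \<otimes> g ((c # u) @ v) = \<zero>"
  proof (rule ccontr)
    assume "f [] \<otimes> g ((c # u) @ v) \<noteq> \<zero>"
    then have "f [] \<noteq> \<zero>" "g ((c # u) @ v) \<noteq> \<zero>" using Cons.prems(1,2) by auto
    then show False using Cons.prems(3)[of "[]" "(c # u) @ v"] by simp
  qed
  moreover have "conv R (\<lambda>v. f (c # v)) g (u @ v) = f (c # u) \<otimes> g v"
  proof (rule Cons.IH)
    fix u' v' assume "u @ v = u' @ v'" "f (c # u') \<noteq> \<zero>" "g v' \<noteq> \<zero>"
    then show "u' = u" using Cons.prems(3)[of "c # u'" v'] by simp
  qed (use Cons.prems in auto)
  ultimately show ?case using Cons.prems(1,2) by simp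
qed

lemma single_closed: "c \<in> carrier R \<Longrightarrow> single R c u w \<in> carrier R"
  by (simp add: single_def)

lemma conv_single_left:
  assumes "c \<in> carrier R" "\<And>w. g w \<in> carrier R"
  shows "conv R (single R c u) g (u @ v) = c \<otimes> g v"
proof -
  have "conv R (single R c u) g (u @ v) = single R c u u \<otimes> g v"
  proof (rule conv_unique_split)
    fix u' v' assume "single R c u u' \<noteq> \<zero>"
    then show "u' = u" by (simp add: single_def split: if_splits)
  qed (use assms single_closed in auto)
  then show ?thesis by (simp add: single_def)
qed

lemma conv_single_right:
  assumes "c \<in> carrier R" "\<And>w. f w \<in> carrier R"
  shows "conv R f (single R c u) (v @ u) = f v \<otimes> c"
proof -
  have "conv R f (single R c u) (v @ u) = f v \<otimes> single R c u u"
  proof (rule conv_unique_split)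
    fix u' v' assume "v @ u = u' @ v'" "single R c u v' \<noteq> \<zero>"
    then show "u' = v" by (simp add: single_def split: if_splits)
  qed (use assms single_closed in auto)
  then show ?thesis by (simp add: single_def)
qed

lemma free_alg_coeff: "f \<in> carrier (free_alg R) \<Longrightarrow> f w \<in> carrier R"
  by (simp add: free_alg_def)

lemma free_alg_support: "f \<in> carrier (free_alg R) \<Longrightarrow> finite {w. f w \<noteq> \<zero>}"
  by (simp add: free_alg_def)

lemma free_algI:
  "(\<And>w. f w \<in> carrier R) \<Longrightarrow> finite S \<Longrightarrow> (\<And>w. w \<notin> S \<Longrightarrow> f w = \<zero>) \<Longrightarrow> f \<in> carrier (free_alg R)"
  unfolding free_alg_def by (simp, rule finite_subset[of _ S]) auto

lemma free_alg_simps [simp]: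
  "\<zero>\<^bsub>free_alg R\<^esub> = (\<lambda>w. \<zero>)" "f \<oplus>\<^bsub>free_alg R\<^esub> g = (\<lambda>w. f w \<oplus> g w)"
  "f \<otimes>\<^bsub>free_alg R\<^esub> g = conv R f g" "\<one>\<^bsub>free_alg R\<^esub> = single R \<one> []"
  by (simp_all add: free_alg_def single_def)

lemma single_in_free_alg: "c \<in> carrier R \<Longrightarrow> single R c u \<in> carrier (free_alg R)"
  by (rule free_algI[of _ "{u}"]) (auto simp: single_def)

lemma add_in_free_alg:
  assumes "f \<in> carrier (free_alg R)" "g \<in> carrier (free_alg R)"
  shows "(\<lambda>w. f w \<oplus> g w) \<in> carrier (free_alg R)"
  by (rule free_algI[of _ "{w. f w \<noteq> \<zero>} \<union> {w. g w \<noteq> \<zero>}"])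
    (use free_alg_coeff[OF assms(1)] free_alg_coeff[OF assms(2)]
      free_alg_support[OF assms(1)] free_alg_support[OF assms(2)] in auto)

lemma conv_in_free_alg:
  assumes "f \<in> carrier (free_alg R)" "g \<in> carrier (free_alg R)"
  shows "conv R f g \<in> carrier (free_alg R)"
proof (rule free_algI[of _ "(\<lambda>(u, v). u @ v) ` ({w. f w \<noteq> \<zero>} \<times> {w. g w \<noteq> \<zero>})"])
  fix w assume "w \<notin> (\<lambda>(u, v). u @ v) ` ({w. f w \<noteq> \<zero>} \<times> {w. g w \<noteq> \<zero>})"
  then show "conv R f g w = \<zero>"
  proof (rule contrapos_np)
    assume "conv R f g w \<noteq> \<zero>"
    then obtain u v where "w = u @ v" "f u \<noteq> \<zero>" "g v \<noteq> \<zero>"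
      using conv_nonzero[of f g w] free_alg_coeff[OF assms(1)] free_alg_coeff[OF assms(2)] by blast
    then show "w \<in> (\<lambda>(u, v). u @ v) ` ({w. f w \<noteq> \<zero>} \<times> {w. g w \<noteq> \<zero>})"
      by (intro image_eqI[of _ _ "(u, v)"]) auto
  qed
qed (use free_alg_coeff[OF assms(1)] free_alg_coeff[OF assms(2)]
  free_alg_support[OF assms(1)] free_alg_support[OF assms(2)] in \<open>auto simp: conv_closed\<close>)

lemma ring_free_alg: "ring (free_alg R)"
proof (rule ringI)
  note c = free_alg_coeff
  show "abelian_group (free_alg R)"
  proof (rule abelian_groupI)
    fix f assume f: "f \<in> carrier (free_alg R)"
    have "(\<lambda>w. \<ominus> f w) \<in> carrier (free_alg R)"
      using free_alg_support[OF f] c[OF f] by (intro free_algI[of _ "{w. f w \<noteq> \<zero>}"]) auto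
    then show "\<exists>g\<in>carrier (free_alg R). g \<oplus>\<^bsub>free_alg R\<^esub> f = \<zero>\<^bsub>free_alg R\<^esub>"
      using c[OF f] by (intro bexI[of _ "\<lambda>w. \<ominus> f w"]) (auto simp: l_neg)
    show "\<zero>\<^bsub>free_alg R\<^esub> \<oplus>\<^bsub>free_alg R\<^esub> f = f" using c[OF f] by simp
  next
    fix f g assume f: "f \<in> carrier (free_alg R)" and g: "g \<in> carrier (free_alg R)"
    show "f \<oplus>\<^bsub>free_alg R\<^esub> g \<in> carrier (free_alg R)" using add_in_free_alg[OF f g] by simp
    show "f \<oplus>\<^bsub>free_alg R\<^esub> g = g \<oplus>\<^bsub>free_alg R\<^esub> f" using c[OF f] c[OF g] by (simp add: a_comm)
    fix h assume h: "h \<in> carrier (free_alg R)"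
    show "f \<oplus>\<^bsub>free_alg R\<^esub> g \<oplus>\<^bsub>free_alg R\<^esub> h = f \<oplus>\<^bsub>free_alg R\<^esub> (g \<oplus>\<^bsub>free_alg R\<^esub> h)"
      using c[OF f] c[OF g] c[OF h] by (simp add: a_assoc)
  qed (auto intro: free_algI[of _ "{}"])
  show "monoid (free_alg R)"
  proof (rule monoidI)
    fix f assume f: "f \<in> carrier (free_alg R)"
    show "\<one>\<^bsub>free_alg R\<^esub> \<otimes>\<^bsub>free_alg R\<^esub> f = f" "f \<otimes>\<^bsub>free_alg R\<^esub> \<one>\<^bsub>free_alg R\<^esub> = f"
      using conv_one_left[of f, OF c[OF f]] conv_one_right[of f, OF c[OF f]] by (auto simp: single_def)
  next
    fix f g assume f: "f \<in> carrier (free_alg R)" and g: "g \<in> carrier (free_alg R)"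
    show "f \<otimes>\<^bsub>free_alg R\<^esub> g \<in> carrier (free_alg R)" using conv_in_free_alg[OF f g] by simp
    fix h assume h: "h \<in> carrier (free_alg R)"
    show "f \<otimes>\<^bsub>free_alg R\<^esub> g \<otimes>\<^bsub>free_alg R\<^esub> h = f \<otimes>\<^bsub>free_alg R\<^esub> (g \<otimes>\<^bsub>free_alg R\<^esub> h)"
      using conv_assoc[of f g h, OF c[OF f] c[OF g] c[OF h]] by auto
  qed (use single_in_free_alg[OF one_closed] in simp)
  fix f g h
  assume f: "f \<in> carrier (free_alg R)" and g: "g \<in> carrier (free_alg R)" and h: "h \<in> carrier (free_alg R)"
  show "(f \<oplus>\<^bsub>free_alg R\<^esub> g) \<otimes>\<^bsub>free_alg R\<^esub> h = f \<otimes>\<^bsub>free_alg R\<^esub> h \<oplus>\<^bsub>free_alg R\<^esub> g \<otimes>\<^bsub>free_alg R\<^esub> h"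
    using conv_add_left[of f g h, OF c[OF f] c[OF g] c[OF h]] by auto
  show "h \<otimes>\<^bsub>free_alg R\<^esub> (f \<oplus>\<^bsub>free_alg R\<^esub> g) = h \<otimes>\<^bsub>free_alg R\<^esub> f \<oplus>\<^bsub>free_alg R\<^esub> h \<otimes>\<^bsub>free_alg R\<^esub> g"
    using conv_add_right[of h f g, OF c[OF h] c[OF f] c[OF g]] by auto
qed

section \<open>Ideals cut out by balanced pairs of word sets\<close>

text \<open>
  Summing the coefficients of a product over a set \<open>W\<close> of words: each word \<open>z\<close> of the left factor
  contributes the sum of the right factor over the left quotient of \<open>W\<close> by \<open>z\<close>.
\<close>
lemma finsum_conv_left:
  assumes "finite S" "finite W" "\<And>w. f w \<in> carrier R" "\<And>w. g w \<in> carrier R" "\<And>w. w \<notin> S \<Longrightarrow> f w = \<zero>"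
  shows "(\<Oplus>w\<in>W. conv R f g w) = (\<Oplus>z\<in>S. f z \<otimes> (\<Oplus>v\<in>{v. z @ v \<in> W}. g v))"
  using assms(1,3,5)
proof (induction S arbitrary: f)
  case empty
  then have "f = (\<lambda>w. \<zero>)" by auto
  then show ?case using assms(4) by (simp add: conv_zero_left)
next
  case (insert z S)
  define f' where "f' = f(z := \<zero>)"
  have f': "\<And>w. f' w \<in> carrier R" "\<And>w. w \<notin> S \<Longrightarrow> f' w = \<zero>"
    using insert.prems by (auto simp: f'_def)
  have f: "f = (\<lambda>w. single R (f z) z w \<oplus> f' w)"
    using insert.prems(1) by (auto simp: f'_def single_def)
  have s: "\<And>w. single R (f z) z w \<in> carrier R" using insert.prems(1) by (simp add: single_closed)
  have c1: "\<And>w. conv R (single R (f z) z) g w \<in> carrier R" using s assms(4) by (simp add: conv_closed)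
  have c2: "\<And>w. conv R f' g w \<in> carrier R" using f'(1) assms(4) by (simp add: conv_closed)
  have fin: "finite {v. z @ v \<in> W}"
    using finite_vimageI[OF assms(2), of "append z"] by (simp add: vimage_def inj_on_def)
  have "(\<Oplus>w\<in>W. conv R (single R (f z) z) g w) = (\<Oplus>w\<in>append z ` {v. z @ v \<in> W}. conv R (single R (f z) z) g w)"
  proof (rule add.finprod_mono_neutral_cong_right)
    fix w assume w: "w \<in> W - append z ` {v. z @ v \<in> W}"
    show "conv R (single R (f z) z) g w = \<zero>"
    proof (rule ccontr)
      assume "conv R (single R (f z) z) g w \<noteq> \<zero>"
      then obtain u v where "w = u @ v" "single R (f z) z u \<noteq> \<zero>"
        using conv_nonzero[of "single R (f z) z" g w] s assms(4) by blast
      then show False using w by (auto simp: single_def split: if_splits)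
    qed
  qed (use assms(2) c1 in auto)
  also have "\<dots> = (\<Oplus>v\<in>{v. z @ v \<in> W}. conv R (single R (f z) z) g (z @ v))"
    by (rule finsum_reindex) (use c1 in \<open>auto simp: inj_on_def\<close>)
  also have "\<dots> = (\<Oplus>v\<in>{v. z @ v \<in> W}. f z \<otimes> g v)"
    using insert.prems(1) assms(4) by (simp add: conv_single_left)
  also have "\<dots> = f z \<otimes> (\<Oplus>v\<in>{v. z @ v \<in> W}. g v)"
    using fin insert.prems(1) assms(4) by (intro finsum_rdistr[symmetric]) auto
  finally have 1: "(\<Oplus>w\<in>W. conv R (single R (f z) z) g w) = f z \<otimes> (\<Oplus>v\<in>{v. z @ v \<in> W}. g v)" .
  have "conv R f g w = conv R (single R (f z) z) g w \<oplus> conv R f' g w" for w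
  proof -
    have "conv R (\<lambda>w. single R (f z) z w \<oplus> f' w) g w = conv R (single R (f z) z) g w \<oplus> conv R f' g w"
      by (rule conv_add_left[OF s f'(1) assms(4)])
    then show ?thesis unfolding f[symmetric] .
  qed
  then have "(\<Oplus>w\<in>W. conv R f g w) = (\<Oplus>w\<in>W. conv R (single R (f z) z) g w) \<oplus> (\<Oplus>w\<in>W. conv R f' g w)"
    using c1 c2 by (simp add: finsum_addf)
  also have "(\<Oplus>w\<in>W. conv R f' g w) = (\<Oplus>z\<in>S. f' z \<otimes> (\<Oplus>v\<in>{v. z @ v \<in> W}. g v))"
    by (rule insert.IH[OF f'])
  also have "\<dots> = (\<Oplus>z\<in>S. f z \<otimes> (\<Oplus>v\<in>{v. z @ v \<in> W}. g v))"
    using insert.hyps(2) insert.prems(1) assms(4)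
    by (intro finsum_cong') (auto simp: f'_def)
  finally show ?case
    unfolding 1 using insert.hyps insert.prems(1) assms(4) by simp
qed

lemma finsum_conv_right:
  assumes "finite S" "finite W" "\<And>w. f w \<in> carrier R" "\<And>w. g w \<in> carrier R" "\<And>w. w \<notin> S \<Longrightarrow> g w = \<zero>"
  shows "(\<Oplus>w\<in>W. conv R f g w) = (\<Oplus>z\<in>S. g z \<otimes> (\<Oplus>v\<in>{v. v @ z \<in> W}. f v))"
  using assms(1,4,5)
proof (induction S arbitrary: g)
  case empty
  then have "g = (\<lambda>w. \<zero>)" by auto
  then show ?case using assms(3) by (simp add: conv_zero_right)
next
  case (insert z S)
  define g' where "g' = g(z := \<zero>)"
  let ?s = "single R (g z) z"
  have g': "\<And>w. g' w \<in> carrier R" "\<And>w. w \<notin> S \<Longrightarrow> g' w = \<zero>"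
    using insert.prems by (auto simp: g'_def)
  have g: "g = (\<lambda>w. ?s w \<oplus> g' w)"
    using insert.prems(1) by (auto simp: g'_def single_def)
  have s: "\<And>w. ?s w \<in> carrier R" using insert.prems(1) by (simp add: single_closed)
  have c1: "\<And>w. conv R f ?s w \<in> carrier R" using s assms(3) by (simp add: conv_closed)
  have c2: "\<And>w. conv R f g' w \<in> carrier R" using g'(1) assms(3) by (simp add: conv_closed)
  have fin: "finite {v. v @ z \<in> W}"
    using finite_vimageI[OF assms(2), of "\<lambda>v. v @ z"] by (simp add: vimage_def inj_on_def)
  have "(\<Oplus>w\<in>W. conv R f ?s w) = (\<Oplus>w\<in>(\<lambda>v. v @ z) ` {v. v @ z \<in> W}. conv R f ?s w)"
  proof (rule add.finprod_mono_neutral_cong_right)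
    fix w assume w: "w \<in> W - (\<lambda>v. v @ z) ` {v. v @ z \<in> W}"
    show "conv R f ?s w = \<zero>"
    proof (rule ccontr)
      assume "conv R f ?s w \<noteq> \<zero>"
      then obtain u v where "w = u @ v" "?s v \<noteq> \<zero>"
        using conv_nonzero[of f ?s w] s assms(3) by blast
      then show False using w by (auto simp: single_def split: if_splits)
    qed
  qed (use assms(2) c1 in auto)
  also have "\<dots> = (\<Oplus>v\<in>{v. v @ z \<in> W}. conv R f ?s (v @ z))"
    by (rule finsum_reindex) (use c1 in \<open>auto simp: inj_on_def\<close>)
  also have "\<dots> = (\<Oplus>v\<in>{v. v @ z \<in> W}. g z \<otimes> f v)"
    using insert.prems(1) assms(3) by (simp add: conv_single_right m_comm)
  also have "\<dots> = g z \<otimes> (\<Oplus>v\<in>{v. v @ z \<in> W}. f v)"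
    using fin insert.prems(1) assms(3) by (intro finsum_rdistr[symmetric]) auto
  finally have 1: "(\<Oplus>w\<in>W. conv R f ?s w) = g z \<otimes> (\<Oplus>v\<in>{v. v @ z \<in> W}. f v)" .
  have "conv R f g w = conv R f ?s w \<oplus> conv R f g' w" for w
  proof -
    have "conv R f (\<lambda>w. ?s w \<oplus> g' w) w = conv R f ?s w \<oplus> conv R f g' w"
      by (rule conv_add_right[OF assms(3) s g'(1)])
    then show ?thesis unfolding g[symmetric] .
  qed
  then have "(\<Oplus>w\<in>W. conv R f g w) = (\<Oplus>w\<in>W. conv R f ?s w) \<oplus> (\<Oplus>w\<in>W. conv R f g' w)"
    using c1 c2 by (simp add: finsum_addf)
  also have "(\<Oplus>w\<in>W. conv R f g' w) = (\<Oplus>z\<in>S. g' z \<otimes> (\<Oplus>v\<in>{v. v @ z \<in> W}. f v))"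
    by (rule insert.IH[OF g'])
  also have "\<dots> = (\<Oplus>z\<in>S. g z \<otimes> (\<Oplus>v\<in>{v. v @ z \<in> W}. f v))"
    using insert.hyps(2) insert.prems(1) assms(3)
    by (intro finsum_cong') (auto simp: g'_def)
  finally show ?case
    unfolding 1 using insert.hyps insert.prems(1) assms(3) by simp
qed

end

text \<open>
  The sets \<open>P k\<close> and \<open>M k\<close> carry the values \<open>1\<close> and \<open>-1\<close> of the \<open>k\<close>-th functional. The condition over
  all contexts \<open>x\<close> and \<open>y\<close> describes the largest two-sided ideal on which all functionals vanish.
\<close>
definition balanced_ideal :: "('f, 'm) ring_scheme \<Rightarrow> (nat \<Rightarrow> nat list set) \<Rightarrow> (nat \<Rightarrow> nat list set)
    \<Rightarrow> (nat list \<Rightarrow> 'f) set" where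
  "balanced_ideal F P M = {f \<in> carrier (free_alg F). \<forall>k x y.
     finsum F f {w. x @ w @ y \<in> P k} = finsum F f {w. x @ w @ y \<in> M k}}"

lemma finite_context: "finite W \<Longrightarrow> finite {w. x @ w @ y \<in> (W :: 'a list set)}"
  using finite_vimageI[of W "\<lambda>w. x @ w @ y"] by (simp add: vimage_def inj_on_def)

context cring
begin

lemma ideal_balanced_ideal:
  assumes fin: "\<And>k. finite (P k)" "\<And>k. finite (M k)"
  shows "ideal (balanced_ideal R P M) (free_alg R)"
proof (rule idealI)
  let ?I = "balanced_ideal R P M" and ?A = "free_alg R"
  interpret A: ring ?A by (rule ring_free_alg)
  have IA: "f \<in> carrier ?A" if "f \<in> ?I" for f using that by (simp add: balanced_ideal_def)
  have bal: "finsum R f {w. x @ w @ y \<in> P k} = finsum R f {w. x @ w @ y \<in> M k}" if "f \<in> ?I" for f x y k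
    using that by (simp add: balanced_ideal_def)
  have neg: "\<ominus>\<^bsub>?A\<^esub> f = (\<lambda>w. \<ominus> f w)" if "f \<in> carrier ?A" for f
  proof -
    have "(\<lambda>w. \<ominus> f w) \<in> carrier ?A"
      using free_alg_support[OF that] free_alg_coeff[OF that]
      by (intro free_algI[of _ "{w. f w \<noteq> \<zero>}"]) auto
    moreover have "(\<lambda>w. \<ominus> f w) \<oplus>\<^bsub>?A\<^esub> f = \<zero>\<^bsub>?A\<^esub>"
      using free_alg_coeff[OF that] by (auto simp: l_neg)
    ultimately show ?thesis using that A.minus_equality by blast
  qed
  have neg_sum: "(\<Oplus>w\<in>W. \<ominus> f w) = \<ominus> (\<Oplus>w\<in>W. f w)" if "finite W" "\<And>w. f w \<in> carrier R" for f and W :: "nat list set"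
    using that by (induction W) (auto simp: minus_add)
  show "ring ?A" by (rule ring_free_alg)
  show "subgroup ?I (add_monoid ?A)"
  proof (rule group.subgroupI[OF A.a_group])
    show "?I \<subseteq> carrier (add_monoid ?A)" using IA by auto
    have "\<zero>\<^bsub>?A\<^esub> \<in> ?I" using A.zero_closed by (auto simp: balanced_ideal_def)
    then show "?I \<noteq> {}" by blast
    show "inv\<^bsub>add_monoid ?A\<^esub> f \<in> ?I" if "f \<in> ?I" for f
    proof -
      have "finsum R (\<lambda>w. \<ominus> f w) {w. x @ w @ y \<in> P k} = finsum R (\<lambda>w. \<ominus> f w) {w. x @ w @ y \<in> M k}" for x y k
        using neg_sum[where f = f, OF finite_context[OF fin(1)] free_alg_coeff[OF IA[OF that]]]
          neg_sum[where f = f, OF finite_context[OF fin(2)] free_alg_coeff[OF IA[OF that]]] bal[OF that] by simp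
      then have "\<ominus>\<^bsub>?A\<^esub> f \<in> ?I"
        using A.a_inv_closed[OF IA[OF that]] unfolding balanced_ideal_def neg[OF IA[OF that]] by blast
      then show ?thesis by (simp add: a_inv_def)
    qed
    show "f \<otimes>\<^bsub>add_monoid ?A\<^esub> g \<in> ?I" if "f \<in> ?I" "g \<in> ?I" for f g
    proof -
      have "finsum R (\<lambda>w. f w \<oplus> g w) W = finsum R f W \<oplus> finsum R g W" for W
        using free_alg_coeff[OF IA[OF that(1)]] free_alg_coeff[OF IA[OF that(2)]]
        by (intro finsum_addf) auto
      then have "f \<oplus>\<^bsub>?A\<^esub> g \<in> ?I"
        using add_in_free_alg[OF IA[OF that(1)] IA[OF that(2)]] bal[OF that(1)] bal[OF that(2)]
        unfolding balanced_ideal_def by simp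
      then show ?thesis by simp
    qed
  qed
  fix f g assume f: "f \<in> ?I" and g: "g \<in> carrier ?A"
  have S: "finite {w. g w \<noteq> \<zero>}" by (rule free_alg_support[OF g])
  note gc = free_alg_coeff[OF g] and fc = free_alg_coeff[OF IA[OF f]]
  show "g \<otimes>\<^bsub>?A\<^esub> f \<in> ?I"
  proof -
    have e: "(\<Oplus>w\<in>{w. x @ w @ y \<in> W}. conv R g f w)
        = (\<Oplus>z\<in>{w. g w \<noteq> \<zero>}. g z \<otimes> (\<Oplus>v\<in>{v. (x @ z) @ v @ y \<in> W}. f v))" if "finite W" for x y W
      using finsum_conv_left[where f = g and g = f, OF S finite_context[OF that] gc fc] by simp
    have "(\<Oplus>w\<in>{w. x @ w @ y \<in> P k}. conv R g f w) = (\<Oplus>w\<in>{w. x @ w @ y \<in> M k}. conv R g f w)" for x y k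
      unfolding e[OF fin(1)] e[OF fin(2)] bal[OF f] ..
    then show ?thesis using conv_in_free_alg[OF g IA[OF f]] by (simp add: balanced_ideal_def)
  qed
  show "f \<otimes>\<^bsub>?A\<^esub> g \<in> ?I"
  proof -
    have e: "(\<Oplus>w\<in>{w. x @ w @ y \<in> W}. conv R f g w)
        = (\<Oplus>z\<in>{w. g w \<noteq> \<zero>}. g z \<otimes> (\<Oplus>v\<in>{v. x @ v @ z @ y \<in> W}. f v))" if "finite W" for x y W
      using finsum_conv_right[where f = f and g = g, OF S finite_context[OF that] fc gc] by simp
    have "(\<Oplus>w\<in>{w. x @ w @ y \<in> P k}. conv R f g w) = (\<Oplus>w\<in>{w. x @ w @ y \<in> M k}. conv R f g w)" for x y k
      unfolding e[OF fin(1)] e[OF fin(2)] bal[OF f] ..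
    then show ?thesis using conv_in_free_alg[OF IA[OF f] g] by (simp add: balanced_ideal_def)
  qed
qed

text \<open>
  The contribution of a factorization to a coefficient of a power of \<open>f\<close>.
\<close>
primrec weight :: "(nat list \<Rightarrow> 'a) \<Rightarrow> nat list list \<Rightarrow> 'a" where
  "weight f [] = \<one>"
| "weight f (m # ms) = f m \<otimes> weight f ms"

lemma weight_closed: "(\<And>w. f w \<in> carrier R) \<Longrightarrow> weight f ms \<in> carrier R"
  by (induction ms) auto

lemma weight_remove1:
  "(\<And>w. f w \<in> carrier R) \<Longrightarrow> m \<in> set ms \<Longrightarrow> weight f ms = f m \<otimes> weight f (remove1 m ms)"
  by (induction ms) (auto simp: weight_closed m_lcomm)

lemma weight_mset: "(\<And>w. f w \<in> carrier R) \<Longrightarrow> mset ms = mset ms' \<Longrightarrow> weight f ms = weight f ms'"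
proof (induction ms arbitrary: ms')
  case (Cons m ms)
  have "m \<in> set ms'" using Cons.prems(2) by (metis list.set_intros(1) set_mset_mset)
  moreover have "mset ms = mset (remove1 m ms')"
    using Cons.prems(2) by (metis add_mset_remove_trivial mset.simps(2) mset_remove1)
  ultimately show ?case using Cons by (metis weight.simps(2) weight_remove1)
qed simp

lemma finite_factorizations: "finite S \<Longrightarrow> finite (factorizations S N W)"
  by (rule finite_subset[OF _ finite_lists_length_eq[of S N]]) (auto simp: factorizations_def)

lemma power_sum:
  assumes f: "f \<in> carrier (free_alg R)" and S: "S = {w. f w \<noteq> \<zero>}" and W: "finite W"
  shows "(\<Oplus>w\<in>W. (f [^]\<^bsub>free_alg R\<^esub> N) w) = (\<Oplus>ms\<in>factorizations S N W. weight f ms)"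
  using W
proof (induction N arbitrary: W)
  case 0
  interpret A: ring "free_alg R" by (rule ring_free_alg)
  have F: "factorizations S 0 W = (if [] \<in> W then {[]} else {})" by (auto simp: factorizations_def)
  have "(\<Oplus>w\<in>W. single R \<one> [] w) = (\<Oplus>w\<in>W \<inter> {[]}. \<one>)"
    by (rule add.finprod_mono_neutral_cong_right) (use 0 in \<open>auto simp: single_def\<close>)
  then show ?case unfolding F by auto
next
  case (Suc N)
  interpret A: ring "free_alg R" by (rule ring_free_alg)
  have fS: "finite S" unfolding S by (rule free_alg_support[OF f])
  have fc: "\<And>w. f w \<in> carrier R" by (rule free_alg_coeff[OF f])
  have p: "f [^]\<^bsub>free_alg R\<^esub> N \<in> carrier (free_alg R)" by (rule A.nat_pow_closed[OF f])
  have finW: "finite {v. z @ v \<in> W}" for z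
    using finite_vimageI[OF Suc.prems, of "append z"] by (simp add: vimage_def inj_on_def)
  have "(\<Oplus>w\<in>W. (f [^]\<^bsub>free_alg R\<^esub> Suc N) w) = (\<Oplus>w\<in>W. conv R f (f [^]\<^bsub>free_alg R\<^esub> N) w)"
    unfolding A.nat_pow_Suc2[OF f] by simp
  also have "\<dots> = (\<Oplus>z\<in>S. f z \<otimes> (\<Oplus>v\<in>{v. z @ v \<in> W}. (f [^]\<^bsub>free_alg R\<^esub> N) v))"
    by (rule finsum_conv_left[OF fS Suc.prems fc free_alg_coeff[OF p]]) (simp add: S)
  also have "\<dots> = (\<Oplus>z\<in>S. \<Oplus>ms\<in>(#) z ` factorizations S N {v. z @ v \<in> W}. weight f ms)"
  proof (rule finsum_cong', rule refl)
    fix z assume z: "z \<in> S"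
    have "f z \<otimes> (\<Oplus>v\<in>{v. z @ v \<in> W}. (f [^]\<^bsub>free_alg R\<^esub> N) v)
        = f z \<otimes> (\<Oplus>ms\<in>factorizations S N {v. z @ v \<in> W}. weight f ms)"
      using Suc.IH[OF finW] by simp
    also have "\<dots> = (\<Oplus>ms\<in>factorizations S N {v. z @ v \<in> W}. f z \<otimes> weight f ms)"
      using fc by (intro finsum_rdistr) (auto simp: finite_factorizations fS weight_closed)
    also have "\<dots> = (\<Oplus>ms\<in>(#) z ` factorizations S N {v. z @ v \<in> W}. weight f ms)"
      using fc by (subst finsum_reindex) (auto simp: weight_closed inj_on_def)
    finally show "f z \<otimes> (\<Oplus>v\<in>{v. z @ v \<in> W}. (f [^]\<^bsub>free_alg R\<^esub> N) v)
        = (\<Oplus>ms\<in>(#) z ` factorizations S N {v. z @ v \<in> W}. weight f ms)" .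
  qed (use fc in \<open>auto simp: weight_closed intro!: finsum_closed\<close>)
  also have "\<dots> = (\<Oplus>ms\<in>(\<Union>z\<in>S. (#) z ` factorizations S N {v. z @ v \<in> W}). weight f ms)"
    by (rule add.finprod_UN_disjoint[symmetric])
      (use fS fc in \<open>auto simp: finite_factorizations weight_closed pairwise_def disjnt_def\<close>)
  also have "(\<Union>z\<in>S. (#) z ` factorizations S N {v. z @ v \<in> W}) = factorizations S (Suc N) W"
    by (auto simp: factorizations_def length_Suc_conv image_iff)
  finally show ?case .
qed

abbreviation "null_ideal \<equiv> balanced_ideal R (\<lambda>J. signed_words J 1) (\<lambda>J. signed_words J (- 1))"

lemma ideal_null_ideal: "ideal null_ideal (free_alg R)"
  by (rule ideal_balanced_ideal) (simp_all add: finite_signed_words)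

text \<open>
  Both sums expand into sums over factorizations, and the bijection between these preserves the
  multiset of factors, hence the contributions.
\<close>
lemma power_in_null_ideal:
  assumes f: "f \<in> carrier (free_alg R)" "f [] = \<zero>"
  shows "\<exists>N>0. f [^]\<^bsub>free_alg R\<^esub> (N :: nat) \<in> null_ideal"
proof -
  interpret A: ring "free_alg R" by (rule ring_free_alg)
  define S where "S = {w. f w \<noteq> \<zero>}"
  have fc: "\<And>w. f w \<in> carrier R" by (rule free_alg_coeff[OF f(1)])
  have fS: "finite S" unfolding S_def by (rule free_alg_support[OF f(1)])
  have "[] \<notin> S" using f(2) by (simp add: S_def)
  from factorizations_cancel[OF fS this] obtain N where N: "N > 0" "\<And>J x y. \<exists>h.
    bij_betw h (factorizations S N {w. x @ w @ y \<in> signed_words J 1})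
               (factorizations S N {w. x @ w @ y \<in> signed_words J (- 1)})
    \<and> (\<forall>ms. ms \<in> factorizations S N {w. x @ w @ y \<in> signed_words J 1} \<longrightarrow> mset (h ms) = mset ms)" by blast
  have "(\<Oplus>w\<in>{w. x @ w @ y \<in> signed_words J 1}. (f [^]\<^bsub>free_alg R\<^esub> N) w)
      = (\<Oplus>w\<in>{w. x @ w @ y \<in> signed_words J (- 1)}. (f [^]\<^bsub>free_alg R\<^esub> N) w)" for J x y
  proof -
    let ?F = "\<lambda>e. factorizations S N {w. x @ w @ y \<in> signed_words J e}"
    obtain h where h: "bij_betw h (?F 1) (?F (- 1))" "\<And>ms. ms \<in> ?F 1 \<Longrightarrow> mset (h ms) = mset ms"
      using N(2)[of x y J] by blast
    have "(\<Oplus>ms\<in>?F (- 1). weight f ms) = (\<Oplus>ms\<in>h ` ?F 1. weight f ms)"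
      using h(1) by (simp add: bij_betw_def)
    also have "\<dots> = (\<Oplus>ms\<in>?F 1. weight f (h ms))"
      using h(1) fc by (intro finsum_reindex) (auto simp: bij_betw_def weight_closed)
    also have "\<dots> = (\<Oplus>ms\<in>?F 1. weight f ms)"
      using h(2) fc by (intro finsum_cong') (auto simp: weight_closed intro: weight_mset)
    finally show ?thesis
      using power_sum[OF f(1) S_def finite_context[OF finite_signed_words]] by metis
  qed
  then show ?thesis using N(1) A.nat_pow_closed[OF f(1)] by (auto simp: balanced_ideal_def)
qed

end

section \<open>Iterated commutators in adjoint groups\<close>

text \<open>
  A nil ring inside a ring with identity embeds its adjoint group into the unit group by
  \<open>r \<mapsto> 1 + r\<close>.
\<close>
locale nil_subring = nil_ring N + Q: ring Q for N (structure) and Q +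
  assumes sub: "carrier N \<subseteq> carrier Q"
    and same_mult: "monoid.mult N = monoid.mult Q"
    and same_add: "add N = add Q"
    and same_zero: "zero N = zero Q"
begin

definition unit_of :: "'a \<Rightarrow> 'a" where
  "unit_of x = \<one>\<^bsub>Q\<^esub> \<oplus>\<^bsub>Q\<^esub> x"

lemma unit_of_closed: "x \<in> carrier N \<Longrightarrow> unit_of x \<in> carrier Q"
  using sub by (auto simp: unit_of_def)

lemma carrier_adjoint: "carrier (adjoint_group N) = carrier N"
  by (simp add: adjoint_group_def)

lemma one_adjoint: "\<one>\<^bsub>adjoint_group N\<^esub> = \<zero>\<^bsub>Q\<^esub>"
  by (simp add: adjoint_group_def same_zero)

lemma unit_of_mult:
  assumes "x \<in> carrier N" "y \<in> carrier N"
  shows "unit_of (x \<otimes>\<^bsub>adjoint_group N\<^esub> y) = unit_of x \<otimes>\<^bsub>Q\<^esub> unit_of y"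
proof -
  have xy: "x \<in> carrier Q" "y \<in> carrier Q" using assms sub by auto
  then show ?thesis
    by (simp add: unit_of_def adjoint_group_def same_mult same_add Q.l_distr Q.r_distr Q.a_ac)
qed

lemma unit_of_inv:
  assumes "x \<in> carrier N"
  shows "unit_of (inv\<^bsub>adjoint_group N\<^esub> x) \<otimes>\<^bsub>Q\<^esub> unit_of x = \<one>\<^bsub>Q\<^esub>"
proof -
  interpret G: group "adjoint_group N" by (rule group_adjoint_group)
  have x: "x \<in> carrier (adjoint_group N)" using assms by (simp add: carrier_adjoint)
  have "unit_of (inv\<^bsub>adjoint_group N\<^esub> x) \<otimes>\<^bsub>Q\<^esub> unit_of x
      = unit_of (inv\<^bsub>adjoint_group N\<^esub> x \<otimes>\<^bsub>adjoint_group N\<^esub> x)"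
    using unit_of_mult[OF G.inv_closed[OF x, unfolded carrier_adjoint] assms] by simp
  also have "\<dots> = \<one>\<^bsub>Q\<^esub>" unfolding G.l_inv[OF x] by (simp add: one_adjoint unit_of_def)
  finally show ?thesis .
qed

lemma gcommutator_closed:
  assumes "x \<in> carrier N" "y \<in> carrier N"
  shows "gcommutator (adjoint_group N) x y \<in> carrier N"
proof -
  interpret G: group "adjoint_group N" by (rule group_adjoint_group)
  have "gcommutator (adjoint_group N) x y \<in> carrier (adjoint_group N)"
    using assms unfolding gcommutator_def by (simp add: carrier_adjoint[symmetric])
  then show ?thesis by (simp add: carrier_adjoint)
qed

lemma iter_commutator_closed:
  "x \<in> carrier N \<Longrightarrow> y \<in> carrier N \<Longrightarrow> iter_commutator (adjoint_group N) x n y \<in> carrier N"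
  by (induction n) (auto intro: gcommutator_closed)

lemma unit_of_gcommutator:
  assumes x: "x \<in> carrier N" and y: "y \<in> carrier N"
  shows "unit_of (gcommutator (adjoint_group N) x y) \<otimes>\<^bsub>Q\<^esub> unit_of y
    = unit_of x \<otimes>\<^bsub>Q\<^esub> unit_of y \<otimes>\<^bsub>Q\<^esub> unit_of (inv\<^bsub>adjoint_group N\<^esub> x)"
proof -
  interpret G: group "adjoint_group N" by (rule group_adjoint_group)
  let ?G = "adjoint_group N"
  have c: "x \<in> carrier ?G" "y \<in> carrier ?G" using x y by (simp_all add: carrier_adjoint)
  have i: "inv\<^bsub>?G\<^esub> x \<in> carrier N" "inv\<^bsub>?G\<^esub> y \<in> carrier N"
    using G.inv_closed[OF c(1)] G.inv_closed[OF c(2)] by (simp_all add: carrier_adjoint)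
  have "x \<otimes>\<^bsub>?G\<^esub> y \<in> carrier N" "x \<otimes>\<^bsub>?G\<^esub> y \<otimes>\<^bsub>?G\<^esub> inv\<^bsub>?G\<^esub> x \<in> carrier N"
    using G.m_closed[OF c] G.m_closed[OF G.m_closed[OF c] G.inv_closed[OF c(1)]]
    by (simp_all add: carrier_adjoint)
  then have "unit_of (gcommutator ?G x y)
      = unit_of x \<otimes>\<^bsub>Q\<^esub> unit_of y \<otimes>\<^bsub>Q\<^esub> unit_of (inv\<^bsub>?G\<^esub> x) \<otimes>\<^bsub>Q\<^esub> unit_of (inv\<^bsub>?G\<^esub> y)"
    using x y i unfolding gcommutator_def by (simp add: unit_of_mult)
  then show ?thesis
    using unit_of_closed[OF x] unit_of_closed[OF y] unit_of_closed[OF i(1)] unit_of_closed[OF i(2)]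
      unit_of_inv[OF y] by (simp add: Q.m_assoc)
qed

text \<open>
  Writing a commutator with \<open>Y\<close> as \<open>w = D Y\<inverse>\<close> turns the recursion
  \<open>w \<mapsto> w Y w\<inverse> Y\<inverse>\<close> into \<open>D \<mapsto> D Y D\<inverse>\<close>, in which nothing cancels any more.
\<close>
lemma unit_of_iter_commutator:
  assumes x: "x \<in> carrier N" and y: "y \<in> carrier N"
    and D: "\<And>n. D n \<in> carrier Q" and E: "\<And>n. E n \<in> carrier Q"
    and D0: "D 0 = unit_of x"
    and DE: "\<And>n. D n \<otimes>\<^bsub>Q\<^esub> E n = \<one>\<^bsub>Q\<^esub>"
    and DS: "\<And>n. D (Suc n) = D n \<otimes>\<^bsub>Q\<^esub> (unit_of y \<otimes>\<^bsub>Q\<^esub> E n)"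
  shows "unit_of (iter_commutator (adjoint_group N) x (Suc n) y) \<otimes>\<^bsub>Q\<^esub> unit_of y = D (Suc n)"
proof -
  let ?G = "adjoint_group N"
  have Y: "unit_of y \<in> carrier Q" by (rule unit_of_closed[OF y])
  have inv_eq: "unit_of (inv\<^bsub>?G\<^esub> z) = V"
    if "z \<in> carrier N" "V \<in> carrier Q" "unit_of z \<otimes>\<^bsub>Q\<^esub> V = \<one>\<^bsub>Q\<^esub>" for z V
  proof -
    interpret G: group ?G by (rule group_adjoint_group)
    have "inv\<^bsub>?G\<^esub> z \<in> carrier N"
      using G.inv_closed[of z] that(1) by (simp add: carrier_adjoint)
    then show ?thesis
      using Q.inv_unique[OF unit_of_inv[OF that(1)] that(3)] unit_of_closed that by blast
  qed
  show ?thesis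
  proof (induction n)
    case 0
    have "unit_of (inv\<^bsub>?G\<^esub> x) = E 0" by (rule inv_eq[OF x E]) (simp add: D0[symmetric] DE)
    then show ?case
      using unit_of_gcommutator[OF x y] unit_of_closed[OF x] Y E
      by (simp add: DS D0 Q.m_assoc)
  next
    case (Suc n)
    let ?z = "iter_commutator ?G x (Suc n) y"
    have z: "?z \<in> carrier N" by (rule iter_commutator_closed[OF x y])
    have "unit_of ?z \<otimes>\<^bsub>Q\<^esub> (unit_of y \<otimes>\<^bsub>Q\<^esub> E (Suc n)) = \<one>\<^bsub>Q\<^esub>"
      using Q.m_assoc[OF unit_of_closed[OF z] Y E, symmetric] Suc DE by metis
    then have inv: "unit_of (inv\<^bsub>?G\<^esub> ?z) = unit_of y \<otimes>\<^bsub>Q\<^esub> E (Suc n)"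
      using Y E by (intro inv_eq[OF z]) auto
    have "unit_of (iter_commutator ?G x (Suc (Suc n)) y) \<otimes>\<^bsub>Q\<^esub> unit_of y
        = unit_of ?z \<otimes>\<^bsub>Q\<^esub> unit_of y \<otimes>\<^bsub>Q\<^esub> unit_of (inv\<^bsub>?G\<^esub> ?z)"
      using unit_of_gcommutator[OF z y] by (simp only: iter_commutator.simps(2))
    also have "\<dots> = D (Suc (Suc n))"
      unfolding inv Suc DS[of "Suc n"] ..
    finally show ?case .
  qed
qed

text \<open>
  It therefore suffices to find arbitrarily large \<open>n\<close> with nontrivial commutator.
\<close>
lemma iter_commutator_stays_one:
  assumes y: "y \<in> carrier N"
    and "iter_commutator (adjoint_group N) x n y = \<one>\<^bsub>adjoint_group N\<^esub>" "n \<le> m"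
  shows "iter_commutator (adjoint_group N) x m y = \<one>\<^bsub>adjoint_group N\<^esub>"
  using assms(3)
proof (induction m rule: dec_induct)
  case (step m)
  interpret G: group "adjoint_group N" by (rule group_adjoint_group)
  have "y \<in> carrier (adjoint_group N)" using y by (simp add: carrier_adjoint)
  then show ?case using step by (simp add: gcommutator_def)
qed (rule assms(2))

end

section \<open>The leading words of the iterated commutators\<close>

text \<open>
  In contrast to a leading term for a word order, such a word is detected by every functional that
  is supported on words of its bidegree and does not vanish on it.
\<close>
definition leading_word :: "('f, 'm) ring_scheme \<Rightarrow> (nat list \<Rightarrow> 'f) \<Rightarrow> nat list \<Rightarrow> bool" where
  "leading_word F f u \<longleftrightarrow> f u \<noteq> \<zero>\<^bsub>F\<^esub> \<and> (\<forall>w. f w \<noteq> \<zero>\<^bsub>F\<^esub> \<longrightarrow>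
     count_list w 0 \<le> count_list u 0 \<and> count_list w 1 \<le> count_list u 1
     \<and> (count_list w 0 = count_list u 0 \<and> count_list w 1 = count_list u 1 \<longrightarrow> w = u))"

lemma leading_wordD:
  assumes "leading_word F f u"
  shows "f u \<noteq> \<zero>\<^bsub>F\<^esub>"
    and "f w \<noteq> \<zero>\<^bsub>F\<^esub> \<Longrightarrow> count_list w 0 \<le> count_list u 0"
    and "f w \<noteq> \<zero>\<^bsub>F\<^esub> \<Longrightarrow> count_list w 1 \<le> count_list u 1"
    and "f w \<noteq> \<zero>\<^bsub>F\<^esub> \<Longrightarrow> count_list w 0 = count_list u 0 \<Longrightarrow> count_list w 1 = count_list u 1 \<Longrightarrow> w = u"
  using assms unfolding leading_word_def by simp_all

context domain
begin

lemma leading_word_conv: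
  assumes f: "\<And>w. f w \<in> carrier R" and g: "\<And>w. g w \<in> carrier R"
    and lf: "leading_word R f u" and lg: "leading_word R g v"
  shows "leading_word R (conv R f g) (u @ v)"
proof -
  note F = leading_wordD[OF lf] and G = leading_wordD[OF lg]
  have split: "u' = u \<and> v' = v"
    if "f u' \<noteq> \<zero>" "g v' \<noteq> \<zero>" "count_list (u' @ v') 0 = count_list (u @ v) 0"
      "count_list (u' @ v') 1 = count_list (u @ v) 1" for u' v'
  proof -
    have "count_list u' 0 + count_list v' 0 = count_list u 0 + count_list v 0"
      "count_list u' 1 + count_list v' 1 = count_list u 1 + count_list v 1"
      using that(3,4) by (simp_all only: count_list_append)
    then have "count_list u' 0 = count_list u 0" "count_list v' 0 = count_list v 0"
      "count_list u' 1 = count_list u 1" "count_list v' 1 = count_list v 1"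
      using F(2,3)[OF that(1)] G(2,3)[OF that(2)] by linarith+
    then show ?thesis using F(4)[OF that(1)] G(4)[OF that(2)] by blast
  qed
  have val: "conv R f g (u @ v) = f u \<otimes> g v"
  proof (rule conv_unique_split)
    fix u' v' assume "u @ v = u' @ v'" "f u' \<noteq> \<zero>" "g v' \<noteq> \<zero>"
    then show "u' = u" using split[of u' v'] by simp
  qed (rule f, rule g)
  have nz: "conv R f g (u @ v) \<noteq> \<zero>"
  proof
    assume "conv R f g (u @ v) = \<zero>"
    from integral[OF this[unfolded val] f g] show False using F(1) G(1) by blast
  qed
  have "count_list w 0 \<le> count_list (u @ v) 0 \<and> count_list w 1 \<le> count_list (u @ v) 1
     \<and> (count_list w 0 = count_list (u @ v) 0 \<and> count_list w 1 = count_list (u @ v) 1 \<longrightarrow> w = u @ v)"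
    if nzw: "conv R f g w \<noteq> \<zero>" for w
  proof -
    obtain u' v' where w: "w = u' @ v'" "f u' \<noteq> \<zero>" "g v' \<noteq> \<zero>"
      using conv_nonzero[of f g w, OF nzw f g] by blast
    have "count_list w 0 \<le> count_list (u @ v) 0" "count_list w 1 \<le> count_list (u @ v) 1"
      using F(2,3)[OF w(2)] G(2,3)[OF w(3)] unfolding w(1) count_list_append by linarith+
    moreover have "w = u @ v" if "count_list w 0 = count_list (u @ v) 0" "count_list w 1 = count_list (u @ v) 1"
      using split[OF w(2,3)] that unfolding w(1) by simp
    ultimately show ?thesis by blast
  qed
  then show ?thesis using nz unfolding leading_word_def by blast
qed

end

text \<open>
  The leading words of \<open>D\<^sub>n\<close> and of its inverse. Their gap sequences are the paperfolding sequence
  before and after position \<open>2 ^ n\<close>; the two differ only in the middle gap.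
\<close>
definition fold_word :: "nat \<Rightarrow> nat list" where
  "fold_word n = gap_word (map paperfold [1..<2 ^ n]) @ [0]"

definition fold_word_rev :: "nat \<Rightarrow> nat list" where
  "fold_word_rev n = gap_word (map paperfold [2 ^ n + 1..<2 ^ Suc n]) @ [0]"

lemma upt_split3: "a \<le> b \<Longrightarrow> b < c \<Longrightarrow> [a..<c] = [a..<b] @ b # [b + 1..<c]"
  using upt_split[of a b c] upt_conv_Cons[of b c] by simp

lemma fold_word_0: "fold_word 0 = [0]" "fold_word_rev 0 = [0]"
  by (simp_all add: fold_word_def fold_word_rev_def)

lemma fold_word_Suc: "fold_word (Suc n) = fold_word n @ [1] @ fold_word_rev n"
proof -
  have "(1::nat) \<le> 2 ^ n" "(2::nat) ^ n < 2 ^ Suc n" by simp_all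
  from upt_split3[OF this] show ?thesis
    by (simp add: fold_word_def fold_word_rev_def gap_word_Cons paperfold_power del: power_Suc upt_Suc)
qed

lemma fold_word_rev_Suc: "fold_word_rev (Suc n) = fold_word n @ [1, 1] @ fold_word_rev n"
proof -
  let ?c = "2 ^ Suc n :: nat"
  \<comment> \<open>Positions beyond \<open>2 ^ (n + 1)\<close> repeat the earlier values, except that the value at \<open>2 ^ n\<close> changes from one to two.\<close>
  have per: "paperfold (?c + l) = paperfold l" if "l \<in> {1..<?c}" "l \<noteq> 2 ^ n" for l
  proof -
    have "\<not> 2 ^ n dvd l"
    proof
      assume "2 ^ n dvd l"
      then obtain m where m: "l = 2 ^ n * m" by (rule dvdE)
      then have "m < 2" using that(1) by simp
      then show False using that m by (cases m) auto
    qed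
    from paperfold_periodic[OF this] show ?thesis by (simp only: add.commute)
  qed
  have shift: "[a + c..<b + c] = map (\<lambda>l. l + c) [a..<b]" for a b c :: nat
    by (induction b) auto
  have "[1 + ?c..<?c + ?c] = [1 + ?c..<2 ^ n + ?c] @ (2 ^ n + ?c) # [2 ^ n + ?c + 1..<?c + ?c]"
    by (rule upt_split3) auto
  then have e: "[?c + 1..<2 ^ Suc (Suc n)] = map (\<lambda>l. l + ?c) [1..<2 ^ n] @ (2 ^ n + ?c) # map (\<lambda>l. l + ?c) [2 ^ n + 1..<?c]"
    unfolding shift[symmetric] by (simp add: ac_simps del: upt_Suc)
  have "paperfold (2 ^ n + ?c) = 2"
  proof -
    have "2 ^ n + ?c = 2 ^ n * 3" by simp
    then show ?thesis using paperfold_power_mult[of 3 n] by (simp only:) (simp add: paperfold_odd)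
  qed
  moreover have "map paperfold (map (\<lambda>l. l + ?c) [1..<2 ^ n]) = map paperfold [1..<2 ^ n]"
    unfolding map_map by (rule map_cong[OF refl]) (use per in \<open>auto simp: add.commute\<close>)
  moreover have "map paperfold (map (\<lambda>l. l + ?c) [2 ^ n + 1..<?c]) = map paperfold [2 ^ n + 1..<?c]"
    unfolding map_map by (rule map_cong[OF refl]) (use per in \<open>auto simp: add.commute\<close>)
  ultimately show ?thesis
    unfolding fold_word_rev_def[of "Suc n"] e map_append list.map
    by (simp add: fold_word_def fold_word_rev_def gap_word_Cons numeral_2_eq_2 del: upt_Suc power_Suc map_map)
qed

section \<open>A nil algebra whose adjoint group is not Engel\<close>

context field
begin

interpretation A: ring "free_alg R" by (rule ring_free_alg)
interpretation I: ideal null_ideal "free_alg R" by (rule ideal_null_ideal)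
interpretation Q: ring "free_alg R Quot null_ideal" by (rule I.quotient_is_ring)

abbreviation quot :: "(nat list \<Rightarrow> 'a) set ring" where
  "quot \<equiv> free_alg R Quot null_ideal"

abbreviation proj :: "(nat list \<Rightarrow> 'a) \<Rightarrow> (nat list \<Rightarrow> 'a) set" where
  "proj f \<equiv> null_ideal +>\<^bsub>free_alg R\<^esub> f"

definition augmentation :: "(nat list \<Rightarrow> 'a) set set" where
  "augmentation = proj ` {f \<in> carrier (free_alg R). f [] = \<zero>}"

lemma proj_closed: "f \<in> carrier (free_alg R) \<Longrightarrow> proj f \<in> carrier quot"
  by (rule ring_hom_closed[OF I.rcos_ring_hom])

lemma proj_mult: "f \<in> carrier (free_alg R) \<Longrightarrow> g \<in> carrier (free_alg R)
    \<Longrightarrow> proj (conv R f g) = proj f \<otimes>\<^bsub>quot\<^esub> proj g"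
  using ring_hom_mult[OF I.rcos_ring_hom, of f g] by simp

lemma proj_add: "f \<in> carrier (free_alg R) \<Longrightarrow> g \<in> carrier (free_alg R)
    \<Longrightarrow> proj (\<lambda>w. f w \<oplus> g w) = proj f \<oplus>\<^bsub>quot\<^esub> proj g"
  using ring_hom_add[OF I.rcos_ring_hom, of f g] by simp

lemma proj_one: "proj (single R \<one> []) = \<one>\<^bsub>quot\<^esub>"
  using ring_hom_one[OF I.rcos_ring_hom] by simp

lemma proj_null: "f \<in> null_ideal \<Longrightarrow> proj f = \<zero>\<^bsub>quot\<^esub>"
  using I.a_rcos_const by (simp add: FactRing_def)

lemma proj_zero: "proj (\<lambda>w. \<zero>) = \<zero>\<^bsub>quot\<^esub>"
  using proj_null[OF I.zero_closed] by simp

lemma augmentationI: "f \<in> carrier (free_alg R) \<Longrightarrow> f [] = \<zero> \<Longrightarrow> proj f \<in> augmentation"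
  by (auto simp: augmentation_def)

lemma augmentationE:
  assumes "X \<in> augmentation"
  obtains f where "X = proj f" "f \<in> carrier (free_alg R)" "f [] = \<zero>"
  using assms by (auto simp: augmentation_def)

lemma augmentation_sub: "augmentation \<subseteq> carrier quot"
  by (auto simp: augmentation_def proj_closed)

lemma augmentation_add:
  assumes "X \<in> augmentation" "Y \<in> augmentation"
  shows "X \<oplus>\<^bsub>quot\<^esub> Y \<in> augmentation"
proof -
  obtain f g where f: "X = proj f" "f \<in> carrier (free_alg R)" "f [] = \<zero>"
    and g: "Y = proj g" "g \<in> carrier (free_alg R)" "g [] = \<zero>"
    using assms by (metis augmentationE)
  have "proj (\<lambda>w. f w \<oplus> g w) \<in> augmentation"
    by (rule augmentationI[OF add_in_free_alg[OF f(2) g(2)]]) (simp add: f(3) g(3))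
  then show ?thesis unfolding f(1) g(1) proj_add[OF f(2) g(2)] .
qed

lemma augmentation_mult_left:
  assumes "X \<in> carrier quot" "Y \<in> augmentation"
  shows "X \<otimes>\<^bsub>quot\<^esub> Y \<in> augmentation"
proof -
  obtain g where g: "Y = proj g" "g \<in> carrier (free_alg R)" "g [] = \<zero>"
    using assms(2) by (rule augmentationE)
  obtain f where f: "X = proj f" "f \<in> carrier (free_alg R)"
    using assms(1) by (auto simp: FactRing_def A_RCOSETS_def')
  have "proj (conv R f g) \<in> augmentation"
    by (rule augmentationI[OF conv_in_free_alg[OF f(2) g(2)]])
      (simp add: g(3) free_alg_coeff[OF f(2)])
  then show ?thesis unfolding f(1) g(1) proj_mult[OF f(2) g(2)] .
qed

lemma single_conv:
  assumes "c \<in> carrier R" "f \<in> carrier (free_alg R)"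
  shows "conv R (single R c []) f = (\<lambda>w. c \<otimes> f w)" "conv R f (single R c []) = (\<lambda>w. c \<otimes> f w)"
proof -
  note c = free_alg_coeff[OF assms(2)]
  show "conv R (single R c []) f = (\<lambda>w. c \<otimes> f w)"
    using conv_single_left[of c f "[]", OF assms(1) c] by (intro ext) simp
  show "conv R f (single R c []) = (\<lambda>w. c \<otimes> f w)"
  proof
    fix w
    have "conv R f (single R c []) (w @ []) = f w \<otimes> c"
      by (rule conv_single_right) (use assms(1) c in auto)
    then show "conv R f (single R c []) w = c \<otimes> f w" using m_comm[OF assms(1) c[of w]] by simp
  qed
qed

lemma single_single:
  assumes "c \<in> carrier R" "d \<in> carrier R"
  shows "conv R (single R c u) (single R d v) = single R (c \<otimes> d) (u @ v)"
proof
  fix w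
  show "conv R (single R c u) (single R d v) w = single R (c \<otimes> d) (u @ v) w"
  proof (cases "w = u @ v")
    case True
    have "conv R (single R c u) (single R d v) (u @ v) = c \<otimes> single R d v v"
      by (rule conv_single_left[OF assms(1) single_closed[OF assms(2)]])
    then show ?thesis using True by (simp add: single_def)
  next
    case False
    have "conv R (single R c u) (single R d v) w = \<zero>"
    proof (rule ccontr)
      assume nz: "conv R (single R c u) (single R d v) w \<noteq> \<zero>"
      obtain u' v' where "w = u' @ v'" "single R c u u' \<noteq> \<zero>" "single R d v v' \<noteq> \<zero>"
        using conv_nonzero[OF nz single_closed[OF assms(1)] single_closed[OF assms(2)]] by blast
      then show False using False by (auto simp: single_def split: if_splits)
    qed
    then show ?thesis using False by (simp add: single_def)
  qed
qed

lemma augmentation_neg: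
  assumes "X \<in> augmentation"
  shows "\<exists>Y\<in>augmentation. Y \<oplus>\<^bsub>quot\<^esub> X = \<zero>\<^bsub>quot\<^esub>"
proof -
  obtain f where f: "X = proj f" "f \<in> carrier (free_alg R)" "f [] = \<zero>"
    using assms by (rule augmentationE)
  note c = free_alg_coeff[OF f(2)]
  define g where "g = (\<lambda>w. \<ominus> f w)"
  have g: "g \<in> carrier (free_alg R)"
    by (rule free_algI[of _ "{w. f w \<noteq> \<zero>}"]) (auto simp: g_def c free_alg_support[OF f(2)])
  have "proj g \<oplus>\<^bsub>quot\<^esub> proj f = proj (\<lambda>w. g w \<oplus> f w)" by (rule proj_add[OF g f(2), symmetric])
  also have "(\<lambda>w. g w \<oplus> f w) = (\<lambda>w. \<zero>)" by (auto simp: g_def c l_neg)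
  finally have "proj g \<oplus>\<^bsub>quot\<^esub> proj f = \<zero>\<^bsub>quot\<^esub>" unfolding proj_zero .
  moreover have "proj g \<in> augmentation" by (rule augmentationI[OF g]) (simp add: g_def f(3))
  ultimately show ?thesis unfolding f(1) by blast
qed

text \<open>
  The powers with positive exponent use only the multiplication, so they can be computed in the
  quotient ring with identity.
\<close>
lemma proj_power:
  "f \<in> carrier (free_alg R) \<Longrightarrow> monoid.mult N = monoid.mult quot
     \<Longrightarrow> pow_Suc N (proj f) n = proj (f [^]\<^bsub>free_alg R\<^esub> Suc n)"
proof (induction n)
  case 0
  then show ?case by (simp add: A.nat_pow_Suc del: free_alg_simps)
next
  case (Suc n)
  have p: "f [^]\<^bsub>free_alg R\<^esub> Suc n \<in> carrier (free_alg R)" by (rule A.nat_pow_closed[OF Suc.prems(1)])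
  have "pow_Suc N (proj f) (Suc n) = proj (f [^]\<^bsub>free_alg R\<^esub> Suc n) \<otimes>\<^bsub>quot\<^esub> proj f"
    using Suc by simp
  also have "\<dots> = proj (conv R (f [^]\<^bsub>free_alg R\<^esub> Suc n) f)" by (rule proj_mult[OF p Suc.prems(1), symmetric])
  finally show ?case by simp
qed

text \<open>
  The record type is left open, so that the result applies to plain rings and to modules.
\<close>
lemma nil_ring_augmentation:
  fixes N :: "((nat list \<Rightarrow> 'a) set, 'z) ring_scheme"
  assumes N: "carrier N = augmentation" "monoid.mult N = monoid.mult quot" "add N = add quot"
    "zero N = zero quot"
  shows "nil_ring N"
proof -
  have sub: "X \<in> carrier quot" if "X \<in> augmentation" for X using that augmentation_sub by blast
  have "abelian_group N"
  proof (rule abelian_groupI)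
    show "\<zero>\<^bsub>N\<^esub> \<in> carrier N"
      unfolding N proj_zero[symmetric]
      using A.zero_closed by (intro augmentationI) simp_all
    show "\<exists>Y\<in>carrier N. Y \<oplus>\<^bsub>N\<^esub> X = \<zero>\<^bsub>N\<^esub>" if "X \<in> carrier N" for X
      using augmentation_neg that unfolding N .
  qed (auto simp: N augmentation_add Q.a_ac sub)
  then have "nonunital_ring N"
    by (intro nonunital_ring.intro nonunital_ring_axioms.intro)
      (auto simp: N augmentation_mult_left Q.m_assoc Q.l_distr Q.r_distr sub)
  moreover have "nil_ring_axioms N"
  proof
    fix X assume "X \<in> carrier N"
    then obtain f where f: "X = proj f" "f \<in> carrier (free_alg R)" "f [] = \<zero>"
      unfolding N by (rule augmentationE)
    obtain n where n: "n > 0" "f [^]\<^bsub>free_alg R\<^esub> (n :: nat) \<in> null_ideal"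
      using power_in_null_ideal[OF f(2,3)] by blast
    then obtain k where k: "n = Suc k" by (cases n) auto
    have "pow_Suc N X k = \<zero>\<^bsub>N\<^esub>"
      unfolding f(1) proj_power[OF f(2) N(2)] N(4) by (rule proj_null) (rule n(2)[unfolded k])
    then show "nilpotent N X" unfolding nilpotent_def by blast
  qed
  ultimately show ?thesis by (rule nil_ring.intro)
qed

lemma signed_wordE:
  assumes "w \<in> signed_words J e"
  obtains cs where "w = gap_word cs" "length cs = 2 ^ lev J" "set cs \<subseteq> {1, 2}"
    "sum_list cs = sum_list (map paperfold [1..<2 ^ lev J + 1])" "Phi J cs = e"
  using assms by (auto simp: signed_words_def gap_seqs_def)

text \<open>
  A monomial that is not a factor of any word with gaps one and two is invisible to all functionals.
\<close>
lemma single_in_null_ideal: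
  assumes "c \<in> carrier R" "\<And>cs x y. set cs \<subseteq> {1, 2} \<Longrightarrow> gap_word cs \<noteq> x @ u @ y"
  shows "single R c u \<in> null_ideal"
proof -
  have "(\<Oplus>w\<in>{w. x @ w @ y \<in> signed_words J e}. single R c u w) = \<zero>" for x y J e
  proof (rule add.finprod_one_eqI)
    fix w assume "w \<in> {w. x @ w @ y \<in> signed_words J e}"
    then have "x @ w @ y \<in> signed_words J e" by simp
    then obtain cs where cs: "x @ w @ y = gap_word cs" "set cs \<subseteq> {1, 2}" by (rule signed_wordE)
    have "w \<noteq> u"
    proof
      assume "w = u"
      from assms(2)[OF cs(2)] cs(1)[unfolded this, symmetric] show False by (rule notE)
    qed
    then show "single R c u w = \<zero>" by (simp add: single_def)
  qed
  then have "(\<Oplus>w\<in>{w. x @ w @ y \<in> signed_words J 1}. single R c u w)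
      = (\<Oplus>w\<in>{w. x @ w @ y \<in> signed_words J (- 1)}. single R c u w)" for x y J
    by metis
  then show ?thesis
    using single_in_free_alg[OF assms(1)] unfolding balanced_ideal_def by blast
qed

definition unit_x :: "nat list \<Rightarrow> 'a" where
  "unit_x = (\<lambda>w. single R \<one> [] w \<oplus> single R \<one> [0] w)"

definition inv_x :: "nat list \<Rightarrow> 'a" where
  "inv_x = (\<lambda>w. single R \<one> [] w \<oplus> single R (\<ominus> \<one>) [0] w)"

definition unit_y :: "nat list \<Rightarrow> 'a" where
  "unit_y = (\<lambda>w. single R \<one> [] w \<oplus> single R \<one> [1] w)"

definition inv_y :: "nat list \<Rightarrow> 'a" where
  "inv_y = (\<lambda>w. single R \<one> [] w \<oplus> (single R (\<ominus> \<one>) [1] w \<oplus> single R \<one> [1, 1] w))"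

lemma units_closed:
  "unit_x \<in> carrier (free_alg R)" "inv_x \<in> carrier (free_alg R)"
  "unit_y \<in> carrier (free_alg R)" "inv_y \<in> carrier (free_alg R)"
proof -
  note s1 = single_in_free_alg[OF one_closed] and s2 = single_in_free_alg[OF a_inv_closed[OF one_closed]]
  show "unit_x \<in> carrier (free_alg R)" unfolding unit_x_def by (rule add_in_free_alg[OF s1 s1])
  show "inv_x \<in> carrier (free_alg R)" unfolding inv_x_def by (rule add_in_free_alg[OF s1 s2])
  show "unit_y \<in> carrier (free_alg R)" unfolding unit_y_def by (rule add_in_free_alg[OF s1 s1])
  show "inv_y \<in> carrier (free_alg R)"
    unfolding inv_y_def by (rule add_in_free_alg[OF s1 add_in_free_alg[OF s2 s1]])
qed

text \<open>
  Lifts of \<open>D\<^sub>n\<close> and of its inverse to the free algebra.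
\<close>
primrec word_pair :: "nat \<Rightarrow> (nat list \<Rightarrow> 'a) \<times> (nat list \<Rightarrow> 'a)" where
  "word_pair 0 = (unit_x, inv_x)"
| "word_pair (Suc n) =
     (conv R (fst (word_pair n)) (conv R unit_y (snd (word_pair n))),
      conv R (fst (word_pair n)) (conv R inv_y (snd (word_pair n))))"

lemma word_pair_closed:
  "fst (word_pair n) \<in> carrier (free_alg R) \<and> snd (word_pair n) \<in> carrier (free_alg R)"
  by (induction n) (simp_all add: conv_in_free_alg units_closed)

lemma minus_one_nonzero: "\<ominus> \<one> \<noteq> \<zero>"
  using one_not_zero by (metis minus_minus minus_zero one_closed)

lemma leading_units:
  "leading_word R unit_x [0]" "leading_word R inv_x [0]"
  "leading_word R unit_y [1]" "leading_word R inv_y [1, 1]"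
  using minus_one_nonzero
  by (auto simp: leading_word_def unit_x_def inv_x_def unit_y_def inv_y_def single_def split: if_splits)

text \<open>
  The leading word of a product is the product of the leading words; the middle factors \<open>1 + b\<close> and
  \<open>1 - b + b\<^sup>2\<close> contribute one and two letters.
\<close>
lemma leading_word_pair:
  "leading_word R (fst (word_pair n)) (fold_word n) \<and> leading_word R (snd (word_pair n)) (fold_word_rev n)"
proof (induction n)
  case 0
  then show ?case using leading_units by (simp add: fold_word_0)
next
  case (Suc n)
  have D: "\<And>w. fst (word_pair n) w \<in> carrier R" and E: "\<And>w. snd (word_pair n) w \<in> carrier R"
    using word_pair_closed[of n] free_alg_coeff by blast+
  have y: "\<And>w. unit_y w \<in> carrier R" "\<And>w. inv_y w \<in> carrier R"
    using units_closed free_alg_coeff by blast+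
  have yE: "\<And>w. conv R unit_y (snd (word_pair n)) w \<in> carrier R"
    "\<And>w. conv R inv_y (snd (word_pair n)) w \<in> carrier R"
    using conv_closed[of unit_y "snd (word_pair n)", OF y(1) E] conv_closed[of inv_y "snd (word_pair n)", OF y(2) E]
    by blast+
  note IH = conjunct1[OF Suc] conjunct2[OF Suc]
  have "leading_word R (conv R unit_y (snd (word_pair n))) ([1] @ fold_word_rev n)"
    by (rule leading_word_conv, rule y(1), rule E, rule leading_units(3), rule IH(2))
  then have "leading_word R (fst (word_pair (Suc n))) (fold_word n @ ([1] @ fold_word_rev n))"
    unfolding word_pair.simps fst_conv
    by (intro leading_word_conv[OF _ _ IH(1)]) (rule D, rule yE(1))
  moreover have "leading_word R (conv R inv_y (snd (word_pair n))) ([1, 1] @ fold_word_rev n)"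
    by (rule leading_word_conv, rule y(2), rule E, rule leading_units(4), rule IH(2))
  then have "leading_word R (snd (word_pair (Suc n))) (fold_word n @ ([1, 1] @ fold_word_rev n))"
    unfolding word_pair.simps snd_conv
    by (intro leading_word_conv[OF _ _ IH(1)]) (rule D, rule yE(2))
  ultimately show ?case unfolding fold_word_Suc fold_word_rev_Suc by blast
qed

lemma proj_neg_single: "proj (single R (\<ominus> \<one>) u) = \<ominus>\<^bsub>quot\<^esub> proj (single R \<one> u)"
proof -
  note s1 = single_in_free_alg[OF one_closed, of u]
    and s2 = single_in_free_alg[OF a_inv_closed[OF one_closed], of u]
  have "proj (single R (\<ominus> \<one>) u) \<oplus>\<^bsub>quot\<^esub> proj (single R \<one> u)
      = proj (\<lambda>w. single R (\<ominus> \<one>) u w \<oplus> single R \<one> u w)"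
    by (rule proj_add[OF s2 s1, symmetric])
  also have "(\<lambda>w. single R (\<ominus> \<one>) u w \<oplus> single R \<one> u w) = (\<lambda>w. \<zero>)"
    by (auto simp: single_def l_neg)
  finally have "proj (single R (\<ominus> \<one>) u) \<oplus>\<^bsub>quot\<^esub> proj (single R \<one> u) = \<zero>\<^bsub>quot\<^esub>"
    unfolding proj_zero .
  from Q.minus_equality[OF this proj_closed[OF s1] proj_closed[OF s2]] show ?thesis by simp
qed

lemma proj_single_mult:
  "proj (single R \<one> u) \<otimes>\<^bsub>quot\<^esub> proj (single R \<one> v) = proj (single R \<one> (u @ v))"
  using proj_mult[OF single_in_free_alg[OF one_closed] single_in_free_alg[OF one_closed], of u v]
    single_single[OF one_closed one_closed, of u v] by simp

text \<open>
  The square of \<open>a\<close> vanishes in the quotient, since gaps are never empty.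
\<close>
lemma proj_units_x:
  "proj unit_x \<otimes>\<^bsub>quot\<^esub> proj inv_x = \<one>\<^bsub>quot\<^esub>" "proj inv_x \<otimes>\<^bsub>quot\<^esub> proj unit_x = \<one>\<^bsub>quot\<^esub>"
proof -
  note s1 = single_in_free_alg[OF one_closed]
    and s2 = single_in_free_alg[OF a_inv_closed[OF one_closed]]
  define a where "a = proj (single R \<one> [0])"
  have a: "a \<in> carrier quot" unfolding a_def by (rule proj_closed[OF s1])
  have aa: "a \<otimes>\<^bsub>quot\<^esub> a = \<zero>\<^bsub>quot\<^esub>"
    unfolding a_def proj_single_mult
    by (rule proj_null, rule single_in_null_ideal) (use gap_word_no_00 in auto)
  have x: "proj unit_x = \<one>\<^bsub>quot\<^esub> \<oplus>\<^bsub>quot\<^esub> a"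
    unfolding unit_x_def proj_add[OF s1 s1] proj_one a_def ..
  have y: "proj inv_x = \<one>\<^bsub>quot\<^esub> \<oplus>\<^bsub>quot\<^esub> \<ominus>\<^bsub>quot\<^esub> a"
    unfolding inv_x_def proj_add[OF s1 s2] proj_one proj_neg_single a_def ..
  show "proj unit_x \<otimes>\<^bsub>quot\<^esub> proj inv_x = \<one>\<^bsub>quot\<^esub>"
    unfolding x y using a aa
    by (simp add: Q.l_distr Q.r_distr Q.r_minus Q.a_assoc Q.l_neg Q.r_neg)
  show "proj inv_x \<otimes>\<^bsub>quot\<^esub> proj unit_x = \<one>\<^bsub>quot\<^esub>"
    unfolding x y using a aa
    by (simp add: Q.l_distr Q.r_distr Q.l_minus Q.a_assoc Q.l_neg Q.r_neg)
qed

text \<open>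
  The cube of \<open>b\<close> vanishes in the quotient, since gaps are at most two.
\<close>
lemma proj_units_y:
  "proj unit_y \<otimes>\<^bsub>quot\<^esub> proj inv_y = \<one>\<^bsub>quot\<^esub>" "proj inv_y \<otimes>\<^bsub>quot\<^esub> proj unit_y = \<one>\<^bsub>quot\<^esub>"
proof -
  note s1 = single_in_free_alg[OF one_closed]
    and s2 = single_in_free_alg[OF a_inv_closed[OF one_closed]]
  define b where "b = proj (single R \<one> [1])"
  define c where "c = b \<otimes>\<^bsub>quot\<^esub> b"
  have b: "b \<in> carrier quot" unfolding b_def by (rule proj_closed[OF s1])
  have c: "c \<in> carrier quot" unfolding c_def by (rule Q.m_closed[OF b b])
  have c_eq: "proj (single R \<one> [1, 1]) = c" unfolding c_def b_def proj_single_mult by simp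
  have "proj (single R \<one> [1, 1, 1]) = \<zero>\<^bsub>quot\<^esub>"
    by (rule proj_null, rule single_in_null_ideal) (use gap_word_no_111 in auto)
  then have bc: "b \<otimes>\<^bsub>quot\<^esub> c = \<zero>\<^bsub>quot\<^esub>" "c \<otimes>\<^bsub>quot\<^esub> b = \<zero>\<^bsub>quot\<^esub>"
    unfolding c_eq[symmetric] b_def proj_single_mult by simp_all
  have x: "proj unit_y = \<one>\<^bsub>quot\<^esub> \<oplus>\<^bsub>quot\<^esub> b"
    unfolding unit_y_def proj_add[OF s1 s1] proj_one b_def ..
  have y: "proj inv_y = \<one>\<^bsub>quot\<^esub> \<oplus>\<^bsub>quot\<^esub> (\<ominus>\<^bsub>quot\<^esub> b \<oplus>\<^bsub>quot\<^esub> c)"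
    unfolding inv_y_def proj_add[OF s1 add_in_free_alg[OF s2 s1]] proj_add[OF s2 s1] proj_one
      proj_neg_single c_eq b_def ..
  define d where "d = \<ominus>\<^bsub>quot\<^esub> b \<oplus>\<^bsub>quot\<^esub> c"
  have d: "d \<in> carrier quot" unfolding d_def using b c by simp
  have bd: "b \<otimes>\<^bsub>quot\<^esub> d = \<ominus>\<^bsub>quot\<^esub> c" "d \<otimes>\<^bsub>quot\<^esub> b = \<ominus>\<^bsub>quot\<^esub> c"
    unfolding d_def using b c bc by (simp_all add: Q.l_distr Q.r_distr Q.l_minus Q.r_minus c_def)
  have s: "d \<oplus>\<^bsub>quot\<^esub> (b \<oplus>\<^bsub>quot\<^esub> \<ominus>\<^bsub>quot\<^esub> c) = \<zero>\<^bsub>quot\<^esub>"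
  proof -
    have "d \<oplus>\<^bsub>quot\<^esub> (b \<oplus>\<^bsub>quot\<^esub> \<ominus>\<^bsub>quot\<^esub> c) = (\<ominus>\<^bsub>quot\<^esub> b \<oplus>\<^bsub>quot\<^esub> b) \<oplus>\<^bsub>quot\<^esub> (c \<oplus>\<^bsub>quot\<^esub> \<ominus>\<^bsub>quot\<^esub> c)"
      unfolding d_def using b c by (simp add: Q.a_ac)
    then show ?thesis using b c by (simp add: Q.l_neg Q.r_neg)
  qed
  have "(\<one>\<^bsub>quot\<^esub> \<oplus>\<^bsub>quot\<^esub> b) \<otimes>\<^bsub>quot\<^esub> (\<one>\<^bsub>quot\<^esub> \<oplus>\<^bsub>quot\<^esub> d) = \<one>\<^bsub>quot\<^esub> \<oplus>\<^bsub>quot\<^esub> (d \<oplus>\<^bsub>quot\<^esub> (b \<oplus>\<^bsub>quot\<^esub> \<ominus>\<^bsub>quot\<^esub> c))"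
    using b c d bd by (simp add: Q.l_distr Q.r_distr Q.a_ac)
  then show "proj unit_y \<otimes>\<^bsub>quot\<^esub> proj inv_y = \<one>\<^bsub>quot\<^esub>"
    unfolding x y d_def[symmetric] s by simp
  have "(\<one>\<^bsub>quot\<^esub> \<oplus>\<^bsub>quot\<^esub> d) \<otimes>\<^bsub>quot\<^esub> (\<one>\<^bsub>quot\<^esub> \<oplus>\<^bsub>quot\<^esub> b) = \<one>\<^bsub>quot\<^esub> \<oplus>\<^bsub>quot\<^esub> (d \<oplus>\<^bsub>quot\<^esub> (b \<oplus>\<^bsub>quot\<^esub> \<ominus>\<^bsub>quot\<^esub> c))"
    using b c d bd by (simp add: Q.l_distr Q.r_distr Q.a_ac)
  then show "proj inv_y \<otimes>\<^bsub>quot\<^esub> proj unit_y = \<one>\<^bsub>quot\<^esub>"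
    unfolding x y d_def[symmetric] s by simp
qed

lemma proj_word_pair_inverse:
  "proj (fst (word_pair n)) \<otimes>\<^bsub>quot\<^esub> proj (snd (word_pair n)) = \<one>\<^bsub>quot\<^esub>
   \<and> proj (snd (word_pair n)) \<otimes>\<^bsub>quot\<^esub> proj (fst (word_pair n)) = \<one>\<^bsub>quot\<^esub>"
proof (induction n)
  case 0
  then show ?case using proj_units_x by simp
next
  case (Suc n)
  note wc = word_pair_closed[of n]
  define D E Y Z where "D = proj (fst (word_pair n))" and "E = proj (snd (word_pair n))"
    and "Y = proj unit_y" and "Z = proj inv_y"
  have c: "D \<in> carrier quot" "E \<in> carrier quot" "Y \<in> carrier quot" "Z \<in> carrier quot"
    unfolding D_def E_def Y_def Z_def using wc units_closed by (auto intro!: proj_closed)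
  have fst: "proj (fst (word_pair (Suc n))) = D \<otimes>\<^bsub>quot\<^esub> (Y \<otimes>\<^bsub>quot\<^esub> E)"
    unfolding word_pair.simps fst_conv D_def E_def Y_def
    by (simp only: proj_mult conv_in_free_alg wc units_closed)
  have snd: "proj (snd (word_pair (Suc n))) = D \<otimes>\<^bsub>quot\<^esub> (Z \<otimes>\<^bsub>quot\<^esub> E)"
    unfolding word_pair.simps snd_conv D_def E_def Z_def
    by (simp only: proj_mult conv_in_free_alg wc units_closed)
  have cancel: "D \<otimes>\<^bsub>quot\<^esub> (U \<otimes>\<^bsub>quot\<^esub> E) \<otimes>\<^bsub>quot\<^esub> (D \<otimes>\<^bsub>quot\<^esub> (V \<otimes>\<^bsub>quot\<^esub> E)) = \<one>\<^bsub>quot\<^esub>"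
    if U: "U \<in> carrier quot" and V: "V \<in> carrier quot" and UV: "U \<otimes>\<^bsub>quot\<^esub> V = \<one>\<^bsub>quot\<^esub>" for U V
  proof -
    have DE: "D \<otimes>\<^bsub>quot\<^esub> E = \<one>\<^bsub>quot\<^esub>" "E \<otimes>\<^bsub>quot\<^esub> D = \<one>\<^bsub>quot\<^esub>"
      using Suc unfolding D_def E_def by auto
    have "D \<otimes>\<^bsub>quot\<^esub> (U \<otimes>\<^bsub>quot\<^esub> E) \<otimes>\<^bsub>quot\<^esub> (D \<otimes>\<^bsub>quot\<^esub> (V \<otimes>\<^bsub>quot\<^esub> E))
        = D \<otimes>\<^bsub>quot\<^esub> (U \<otimes>\<^bsub>quot\<^esub> ((E \<otimes>\<^bsub>quot\<^esub> D) \<otimes>\<^bsub>quot\<^esub> (V \<otimes>\<^bsub>quot\<^esub> E)))"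
      using c U V by (simp add: Q.m_assoc)
    also have "\<dots> = D \<otimes>\<^bsub>quot\<^esub> ((U \<otimes>\<^bsub>quot\<^esub> V) \<otimes>\<^bsub>quot\<^esub> E)"
      unfolding DE using c U V by (simp add: Q.m_assoc)
    also have "\<dots> = \<one>\<^bsub>quot\<^esub>" unfolding UV using c DE by simp
    finally show ?thesis .
  qed
  show ?case
    unfolding fst snd using cancel[OF c(3,4)] cancel[OF c(4,3)] proj_units_y
    unfolding Y_def Z_def by blast
qed

text \<open>
  The functional of index \<open>J\<close> in the context with \<open>b\<close> on the right sees no word of \<open>1 + b\<close>, and of \<open>D\<^sub>n\<close>,
  \<open>n = lev J\<close>, only the leading word. The letter \<open>b\<close> supplies the value of the paperfolding
  sequence at \<open>2 ^ lev J\<close>, which completes the last block.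
\<close>
lemma proj_word_pair_nontrivial: "proj (fst (word_pair (lev J))) \<noteq> proj unit_y"
proof
  define D where "D = fst (word_pair (lev J))"
  assume "proj (fst (word_pair (lev J))) = proj unit_y"
  then have eq: "proj D = proj unit_y" by (simp add: D_def)
  have DA: "D \<in> carrier (free_alg R)" unfolding D_def using word_pair_closed by blast
  have "D \<in> proj unit_y" using I.a_rcos_self[OF DA] eq by simp
  then obtain h where hI: "h \<in> null_ideal" and hD: "D = h \<oplus>\<^bsub>free_alg R\<^esub> unit_y"
    unfolding a_r_coset_def' by blast
  have h: "D w = h w \<oplus> unit_y w" for w
    unfolding hD free_alg_simps by (rule refl)
  have hA: "h \<in> carrier (free_alg R)" using hI unfolding balanced_ideal_def by blast
  note hc = free_alg_coeff[OF hA]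
  have lead: "leading_word R D (fold_word (lev J))"
    using leading_word_pair[of "lev J"] by (simp add: D_def)
  let ?u = "fold_word (lev J)" and ?cs = "map paperfold [1..<2 ^ lev J + 1]"
  have cs: "?cs = map paperfold [1..<2 ^ lev J] @ [1]"
  proof -
    have "[1..<2 ^ lev J + 1] = [1..<2 ^ lev J] @ [2 ^ lev J]"
      using upt_Suc_append[of 1 "2 ^ lev J"] by simp
    then show ?thesis by (simp only: map_append list.map paperfold_power)
  qed
  have u: "?u @ [1] = gap_word ?cs" unfolding cs by (simp add: fold_word_def gap_word_Cons)
  have u0: "count_list ?u 0 = 2 ^ lev J"
  proof -
    have "count_list (?u @ [1]) 0 = length ?cs" unfolding u by (rule count_gap_word_0)
    then show ?thesis by simp
  qed
  have u1: "count_list ?u 1 + 1 = sum_list ?cs"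
  proof -
    have "count_list (?u @ [1]) 1 = sum_list ?cs" unfolding u by (rule count_gap_word_1)
    then show ?thesis unfolding count_list_append by (simp del: upt_Suc)
  qed
  have Phi: "Phi J ?cs \<noteq> 0" using Phi_paperfold[of J 0] by simp
  have csC: "?cs \<in> gap_seqs J"
  proof -
    have "set ?cs \<subseteq> {1, 2}"
      unfolding set_map by (rule image_subsetI) (rule paperfold_range)
    moreover have "length ?cs = 2 ^ lev J" by simp
    ultimately show ?thesis unfolding gap_seqs_def by blast
  qed
  have words: "(h w = D w) \<and> (D w \<noteq> \<zero> \<longrightarrow> w = ?u)" if w: "w @ [1] \<in> signed_words J e" for w e
  proof -
    obtain ds where ds: "w @ [1] = gap_word ds" "length ds = 2 ^ lev J" "sum_list ds = sum_list ?cs"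
      using w by (rule signed_wordE)
    have w0: "count_list w 0 = 2 ^ lev J"
      using arg_cong[OF ds(1), of "\<lambda>v. count_list v 0"] ds(2) by (simp add: count_gap_word_0)
    have w1: "count_list w 1 + 1 = sum_list ?cs"
      using arg_cong[OF ds(1), of "\<lambda>v. count_list v 1"] ds(3) by (simp only: count_gap_word_1) simp
    have "unit_y w = \<zero>"
    proof -
      have "w \<noteq> []" "w \<noteq> [1]" using w0 by auto
      then show ?thesis by (simp add: unit_y_def single_def)
    qed
    then have "h w = D w" unfolding h using hc by simp
    moreover have "w = ?u" if "D w \<noteq> \<zero>"
      by (rule leading_wordD(4)[OF lead that]) (use w0 w1 u0 u1 in simp_all)
    ultimately show ?thesis by blast
  qed
  have fin: "finite {w. [] @ w @ [1] \<in> signed_words J e}" for e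
    by (rule finite_context[OF finite_signed_words])
  have Du: "D ?u \<noteq> \<zero>" by (rule leading_wordD(1)[OF lead])
  have sum: "finsum R h {w. [] @ w @ [1] \<in> signed_words J e}
      = (if Phi J ?cs = e then D ?u else \<zero>)" for e
  proof (cases "Phi J ?cs = e")
    case True
    then have mem: "?u @ [1] \<in> signed_words J e"
      unfolding u signed_words_def using csC by blast
    have "finsum R h {w. [] @ w @ [1] \<in> signed_words J e} = finsum R h {?u}"
    proof (rule add.finprod_mono_neutral_cong_right[OF fin])
      fix w assume "w \<in> {w. [] @ w @ [1] \<in> signed_words J e} - {?u}"
      then show "h w = \<zero>" using words[of w e] by auto
    qed (use mem hc in auto)
    also have "\<dots> = h ?u" using hc by simp
    finally show ?thesis using words[OF mem] True by simp
  next
    case False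
    have "finsum R h {w. [] @ w @ [1] \<in> signed_words J e} = \<zero>"
    proof (rule add.finprod_one_eqI)
      fix w assume "w \<in> {w. [] @ w @ [1] \<in> signed_words J e}"
      then have w: "w @ [1] \<in> signed_words J e" by simp
      have "w \<noteq> ?u"
      proof
        assume "w = ?u"
        then have "gap_word ?cs \<in> signed_words J e" using w u by simp
        then obtain ds where "gap_word ?cs = gap_word ds" "Phi J ds = e" by (rule signed_wordE)
        then show False using False gap_word_inject by blast
      qed
      then show "h w = \<zero>" using words[OF w] by auto
    qed
    then show ?thesis using False by simp
  qed
  have "finsum R h {w. [] @ w @ [1] \<in> signed_words J 1} = finsum R h {w. [] @ w @ [1] \<in> signed_words J (- 1)}"
    using hI unfolding balanced_ideal_def by blast
  then have "(if Phi J ?cs = 1 then D ?u else \<zero>) = (if Phi J ?cs = - 1 then D ?u else \<zero>)"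
    unfolding sum .
  then show False using Phi_cases[OF Phi] Du by auto
qed

text \<open>
  If the commutator with \<open>n\<close> copies of \<open>y\<close> were trivial, then so would be the one with \<open>lev n\<close> copies,
  which says that \<open>D = y\<close> in the quotient.
\<close>
lemma not_engel_augmentation:
  fixes N :: "((nat list \<Rightarrow> 'a) set, 'z) ring_scheme"
  assumes N: "carrier N = augmentation" "monoid.mult N = monoid.mult quot" "add N = add quot"
    "zero N = zero quot"
  shows "\<not> engel_group (adjoint_group N)"
proof
  assume engel: "engel_group (adjoint_group N)"
  interpret N: nil_subring N quot
  proof (rule nil_subring.intro)
    show "nil_ring N" by (rule nil_ring_augmentation[OF N])
    show "ring quot" by (rule Q.ring_axioms)
    show "nil_subring_axioms N quot"
      by (rule nil_subring_axioms.intro) (use N augmentation_sub in auto)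
  qed
  note s1 = single_in_free_alg[OF one_closed]
  define x y where "x = proj (single R \<one> [0])" and "y = proj (single R \<one> [1])"
  have xN: "x \<in> carrier N" and yN: "y \<in> carrier N"
    unfolding x_def y_def N(1) by (rule augmentationI[OF s1], simp add: single_def)+
  have ux: "N.unit_of x = proj unit_x"
    unfolding N.unit_of_def x_def unit_x_def proj_add[OF s1 s1] proj_one ..
  have uy: "N.unit_of y = proj unit_y"
    unfolding N.unit_of_def y_def unit_y_def proj_add[OF s1 s1] proj_one ..
  obtain n where n: "n \<ge> 1" "iter_commutator (adjoint_group N) x n y = \<one>\<^bsub>adjoint_group N\<^esub>"
    using engel xN yN unfolding engel_group_def N.carrier_adjoint by blast
  have "iter_commutator (adjoint_group N) x (lev n) y = \<one>\<^bsub>adjoint_group N\<^esub>"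
    by (rule N.iter_commutator_stays_one[OF yN n(2) le_lev])
  moreover obtain k where k: "lev n = Suc k" using le_lev[of n] n(1) by (cases "lev n") auto
  ultimately have one: "iter_commutator (adjoint_group N) x (Suc k) y = \<zero>\<^bsub>quot\<^esub>"
    by (simp only: N.one_adjoint)
  have wc: "fst (word_pair m) \<in> carrier (free_alg R)" "snd (word_pair m) \<in> carrier (free_alg R)" for m
    using word_pair_closed by auto
  have "N.unit_of (iter_commutator (adjoint_group N) x (Suc k) y) \<otimes>\<^bsub>quot\<^esub> N.unit_of y
      = proj (fst (word_pair (Suc k)))"
  proof (rule N.unit_of_iter_commutator[OF xN yN, where E = "\<lambda>m. proj (snd (word_pair m))"])
    show "proj (fst (word_pair 0)) = N.unit_of x" unfolding ux by simp
    show "proj (fst (word_pair (Suc m))) = proj (fst (word_pair m)) \<otimes>\<^bsub>quot\<^esub> (N.unit_of y \<otimes>\<^bsub>quot\<^esub> proj (snd (word_pair m)))" for m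
      unfolding uy word_pair.simps fst_conv
      by (simp only: proj_mult conv_in_free_alg wc units_closed)
    show "proj (fst (word_pair m)) \<in> carrier quot" "proj (snd (word_pair m)) \<in> carrier quot" for m
      using wc by (auto intro: proj_closed)
    show "proj (fst (word_pair m)) \<otimes>\<^bsub>quot\<^esub> proj (snd (word_pair m)) = \<one>\<^bsub>quot\<^esub>" for m
      using proj_word_pair_inverse by blast
  qed
  moreover have "N.unit_of \<zero>\<^bsub>quot\<^esub> = \<one>\<^bsub>quot\<^esub>" unfolding N.unit_of_def by simp
  ultimately have "proj unit_y = proj (fst (word_pair (lev n)))"
    unfolding one k uy using proj_closed[OF units_closed(3)] by simp
  then show False using proj_word_pair_nontrivial[of n] by simp
qed

lemma nil_algebra_augmentation:
  fixes N :: "('a, (nat list \<Rightarrow> 'a) set) module"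
  assumes N: "carrier N = augmentation" "monoid.mult N = monoid.mult quot" "add N = add quot"
    "zero N = zero quot" and smult: "smult N = (\<lambda>c X. proj (single R c []) \<otimes>\<^bsub>quot\<^esub> X)"
  shows "nil_algebra R N"
proof -
  have nil: "nil_ring N" by (rule nil_ring_augmentation[OF N])
  then interpret N: nil_ring N .
  have sub: "X \<in> carrier quot" if "X \<in> augmentation" for X using that augmentation_sub by blast
  have pc: "proj (single R c []) \<in> carrier quot" if "c \<in> carrier R" for c
    by (rule proj_closed[OF single_in_free_alg[OF that]])
  have s_add: "proj (single R (c \<oplus> d) []) = proj (single R c []) \<oplus>\<^bsub>quot\<^esub> proj (single R d [])"
    if c: "c \<in> carrier R" and d: "d \<in> carrier R" for c d
  proof -
    have "single R (c \<oplus> d) [] = (\<lambda>w. single R c [] w \<oplus> single R d [] w)"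
      using c d by (auto simp: single_def)
    then show ?thesis using proj_add[OF single_in_free_alg[OF c] single_in_free_alg[OF d], of "[]" "[]"] by simp
  qed
  have s_mult: "proj (single R (c \<otimes> d) []) = proj (single R c []) \<otimes>\<^bsub>quot\<^esub> proj (single R d [])"
    if c: "c \<in> carrier R" and d: "d \<in> carrier R" for c d
    using proj_mult[OF single_in_free_alg[OF c] single_in_free_alg[OF d], of "[]" "[]"]
      single_single[OF c d, of "[]" "[]"] by simp
  have central: "proj (single R c []) \<otimes>\<^bsub>quot\<^esub> X = X \<otimes>\<^bsub>quot\<^esub> proj (single R c [])"
    if c: "c \<in> carrier R" and X: "X \<in> augmentation" for c X
  proof -
    obtain f where f: "X = proj f" "f \<in> carrier (free_alg R)" using X by (rule augmentationE)
    show ?thesis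
      unfolding f(1) proj_mult[OF single_in_free_alg[OF c] f(2), symmetric]
        proj_mult[OF f(2) single_in_free_alg[OF c], symmetric] single_conv[OF c f(2)] ..
  qed
  have "module R N"
  proof (rule module.intro)
    show "cring R" by (rule is_cring)
    show "abelian_group N" by (rule N.abelian_group_axioms)
    show "module_axioms R N"
      by (rule module_axioms.intro)
        (auto simp: N smult augmentation_mult_left pc sub s_add s_mult Q.l_distr Q.r_distr Q.m_assoc
          proj_one)
  qed
  moreover have "nonunital_algebra_axioms R N"
  proof (rule nonunital_algebra_axioms.intro)
    fix c X Y assume c: "c \<in> carrier R" and "X \<in> carrier N" "Y \<in> carrier N"
    then have X: "X \<in> augmentation" and Y: "Y \<in> augmentation" by (simp_all add: N)
    show "c \<odot>\<^bsub>N\<^esub> (X \<otimes>\<^bsub>N\<^esub> Y) = (c \<odot>\<^bsub>N\<^esub> X) \<otimes>\<^bsub>N\<^esub> Y"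
      using c X Y by (simp add: N smult Q.m_assoc pc sub)
    have "proj (single R c []) \<otimes>\<^bsub>quot\<^esub> (X \<otimes>\<^bsub>quot\<^esub> Y) = (X \<otimes>\<^bsub>quot\<^esub> proj (single R c [])) \<otimes>\<^bsub>quot\<^esub> Y"
      using c X Y by (simp add: Q.m_assoc[symmetric] pc sub central)
    then show "c \<odot>\<^bsub>N\<^esub> (X \<otimes>\<^bsub>N\<^esub> Y) = X \<otimes>\<^bsub>N\<^esub> (c \<odot>\<^bsub>N\<^esub> Y)"
      using c X Y by (simp add: N smult Q.m_assoc pc sub)
  qed
  ultimately show ?thesis
    using nil by (simp add: nil_algebra_def nonunital_algebra_def nil_ring_def)
qed

lemma exists_nil_ring_not_engel:
  "\<exists>N :: (nat list \<Rightarrow> 'a) set ring. nil_ring N \<and> \<not> engel_group (adjoint_group N)"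
proof -
  define N :: "(nat list \<Rightarrow> 'a) set ring" where
    "N = \<lparr>carrier = augmentation, monoid.mult = monoid.mult quot, one = one quot,
      zero = zero quot, add = add quot\<rparr>"
  have N: "carrier N = augmentation" "monoid.mult N = monoid.mult quot" "add N = add quot"
    "zero N = zero quot" by (simp_all add: N_def)
  show ?thesis using nil_ring_augmentation[OF N] not_engel_augmentation[OF N] by blast
qed

lemma exists_nil_algebra_not_engel:
  "\<exists>N :: ('a, (nat list \<Rightarrow> 'a) set) module. nil_algebra R N \<and> \<not> engel_group (adjoint_group N)"
proof -
  define N :: "('a, (nat list \<Rightarrow> 'a) set) module" where
    "N = \<lparr>carrier = augmentation, monoid.mult = monoid.mult quot, one = one quot,
      zero = zero quot, add = add quot, smult = (\<lambda>c X. proj (single R c []) \<otimes>\<^bsub>quot\<^esub> X)\<rparr>"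
  have N: "carrier N = augmentation" "monoid.mult N = monoid.mult quot" "add N = add quot"
    "zero N = zero quot" and s: "smult N = (\<lambda>c X. proj (single R c []) \<otimes>\<^bsub>quot\<^esub> X)"
    by (simp_all add: N_def)
  show ?thesis using nil_algebra_augmentation[OF N s] not_engel_augmentation[OF N] by blast
qed

end

definition F2 :: "int ring" where
  "F2 = \<lparr>carrier = {0, 1}, monoid.mult = (\<lambda>x y. x * y), one = 1, zero = 0,
     add = (\<lambda>x y. (x + y) mod 2)\<rparr>"

lemma field_F2: "field F2"
proof (rule cring.cring_fieldI)
  show "cring F2"
  proof (rule cringI)
    show "abelian_group F2" by (rule abelian_groupI) (auto simp: F2_def)
    show "comm_monoid F2" by (rule comm_monoidI) (auto simp: F2_def)
  qed (auto simp: F2_def)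
  show "Units F2 = carrier F2 - {\<zero>\<^bsub>F2\<^esub>}" by (auto simp: F2_def Units_def)
qed

theorem theorem5:
  shows "(\<exists>R :: (nat list \<Rightarrow> int) set ring.
            nil_ring R \<and> \<not> engel_group (adjoint_group R)) \<and>
         (\<forall>F :: ('f, 'm) ring_scheme. field F \<longrightarrow>
            (\<exists>R :: ('f, (nat list \<Rightarrow> 'f) set) module.
               nil_algebra F R \<and> \<not> engel_group (adjoint_group R)))"
proof (intro conjI allI impI)
  show "\<exists>R :: (nat list \<Rightarrow> int) set ring. nil_ring R \<and> \<not> engel_group (adjoint_group R)"
    by (rule field.exists_nil_ring_not_engel[OF field_F2])
next
  fix F :: "('f, 'm) ring_scheme" assume "field F"
  then show "\<exists>R :: ('f, (nat list \<Rightarrow> 'f) set) module. nil_algebra F R \<and> \<not> engel_group (adjoint_group R)"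
    by (rule field.exists_nil_algebra_not_engel)
qed

end
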